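(* $G\in\mathcal{B}_3$ if and only if $G\cong P_5$ or $G\cong P_5\times\mathbb{Z}_2$ or $G\cong D_{10}$, where $P_5$ is a $5$-group of exponent $5$.
   Context: All groups are finite, and $G$ denotes a group. For a group $G$ and a subset $S\subseteq G$ with $1_G\notin S=S^{-1}$, $\mathrm{Cay}(G,S)$ is the undirected graph with vertex set $G$ in which $g,h$ are adjacent if and only if $hg^{-1}\in S$. A graph $\Gamma$ is $2$-integral if $[\mathbb{SF}(\Gamma):\mathbb{Q}]=2$, where $\mathbb{SF}(\Gamma)$ is the smallest field extension of $\mathbb{Q}$ containing all eigenvalues of the adjacency matrix of $\Gamma$. For an integer $k\geq 2$, $\mathcal{B}_k$ is the set of all groups $G$ such that $\mathrm{Cay}(G,S)$ is $2$-integral whenever $S\subset G$ satisfies $1_G\notin S=S^{-1}$ and $2\leq|S|\leq k$. $\mathbb{Z}_2$ is the cyclic group of order $2$ and $D_{10}$ is the dihedral group of order $10$.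
   Formalization: The formal theorem assumes that $G$ has order greater than 2, because groups of order 1 and 2 lie in $\mathcal{B}_3$ vacuously but are not of the listed forms when $P_5$ has exponent exactly 5. *)

theory Defs
  imports
    "HOL-Algebra.Algebra"
    "HOL-Algebra.Algebraic_Closure_Type"
    "HOL-Library.Countable_Set"
    "Graph_Theory.Pair_Digraph"
    "Jordan_Normal_Form.Spectral_Radius"
begin

text \<open>
  Undirected graphs are symmetric loop-free digraphs (locale \<^locale>\<open>pair_graph\<close>). The rows and
  columns of the adjacency matrix are indexed by natural numbers, so the definition fixes an
  enumeration of the vertices; for finite vertex sets \<^const>\<open>from_nat_into\<close> is a bijection from
  the numbers below the cardinality. Another enumeration gives a permutation-similar matrix, so
  the spectrum does not depend on this choice.
\<close>

definition adjacency_matrix :: "'a pair_pre_digraph \<Rightarrow> complex mat" where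
  "adjacency_matrix \<Gamma> =
     mat (card (pverts \<Gamma>)) (card (pverts \<Gamma>))
       (\<lambda>(i, j). if (from_nat_into (pverts \<Gamma>) i, from_nat_into (pverts \<Gamma>) j) \<in> parcs \<Gamma> then 1 else 0)"

abbreviation complex_field :: "complex ring" where
  "complex_field \<equiv> ring_of_type_algebra"

text \<open>
  Every subfield of the complex numbers contains the rationals, so the field generated by the
  spectrum is the smallest extension of the rationals containing all eigenvalues.
\<close>

definition splitting_field :: "'a pair_pre_digraph \<Rightarrow> complex set" where
  "splitting_field \<Gamma> = generate_field complex_field (spectrum (adjacency_matrix \<Gamma>))"

definition two_integral :: "'a pair_pre_digraph \<Rightarrow> bool" where
  "two_integral \<Gamma> \<longleftrightarrow> ring.dimension complex_field 2 \<rat> (splitting_field \<Gamma>)"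

definition Cay :: "('a, 'b) monoid_scheme \<Rightarrow> 'a set \<Rightarrow> 'a pair_pre_digraph" where
  "Cay G S = \<lparr> pverts = carrier G,
      parcs = {(g, h). g \<in> carrier G \<and> h \<in> carrier G \<and> h \<otimes>\<^bsub>G\<^esub> inv\<^bsub>G\<^esub> g \<in> S} \<rparr>"

definition class_B :: "nat \<Rightarrow> 'a monoid set" where
  "class_B k = {G. group G \<and> finite (carrier G) \<and>
     (\<forall>S \<subseteq> carrier G. \<one>\<^bsub>G\<^esub> \<notin> S \<and> S = set_inv\<^bsub>G\<^esub> S \<and> 2 \<le> card S \<and> card S \<le> k
        \<longrightarrow> two_integral (Cay G S))}"

definition p_group :: "nat \<Rightarrow> ('a, 'b) monoid_scheme \<Rightarrow> bool" where
  "p_group p G \<longleftrightarrow> group G \<and> (\<exists>n. Coset.order G = p ^ n)"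

definition exponent :: "('a, 'b) monoid_scheme \<Rightarrow> nat" where
  "exponent G = (LEAST n. 0 < n \<and> (\<forall>x \<in> carrier G. x [^]\<^bsub>G\<^esub> n = \<one>\<^bsub>G\<^esub>))"

text \<open>
  The dihedral group of order \<open>2 * n\<close>: the pair \<open>(a, c)\<close> stands for the \<open>a\<close>-th power of the rotation,
  times the reflection if \<open>c\<close> is true.
\<close>

definition dihedral_group :: "nat \<Rightarrow> (int \<times> bool) monoid" where
  "dihedral_group n = \<lparr> carrier = {0..<int n} \<times> UNIV,
     monoid.mult = (\<lambda>(a, c) (b, d). ((if c then a - b else a + b) mod int n, c \<noteq> d)),
     one = (0, False) \<rparr>"

lemma order_dihedral_group: "Coset.order (dihedral_group n) = 2 * n"
  by (simp add: Coset.order_def dihedral_group_def)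

lemma group_dihedral_group:
  assumes "0 < n"
  shows "group (dihedral_group n)"
proof (rule groupI)
  fix x y z
  assume "x \<in> carrier (dihedral_group n)" "y \<in> carrier (dihedral_group n)"
    "z \<in> carrier (dihedral_group n)"
  then show "x \<otimes>\<^bsub>dihedral_group n\<^esub> y \<otimes>\<^bsub>dihedral_group n\<^esub> z =
      x \<otimes>\<^bsub>dihedral_group n\<^esub> (y \<otimes>\<^bsub>dihedral_group n\<^esub> z)"
    by (cases x; cases y; cases z)
      (simp add: dihedral_group_def mod_add_left_eq mod_add_right_eq mod_diff_left_eq
        mod_diff_right_eq algebra_simps)
next
  fix x
  assume x: "x \<in> carrier (dihedral_group n)"
  obtain a c where ac: "x = (a, c)" by (cases x)
  define y where "y = ((if c then a else (- a) mod int n), c)"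
  have "y \<in> carrier (dihedral_group n)" "y \<otimes>\<^bsub>dihedral_group n\<^esub> x = \<one>\<^bsub>dihedral_group n\<^esub>"
    using x ac assms by (auto simp: y_def dihedral_group_def mod_add_left_eq)
  then show "\<exists>y \<in> carrier (dihedral_group n). y \<otimes>\<^bsub>dihedral_group n\<^esub> x = \<one>\<^bsub>dihedral_group n\<^esub>"
    by blast
qed (use assms in \<open>auto simp: dihedral_group_def\<close>)

lemma pair_graph_Cay:
  assumes "group G" "finite (carrier G)" "\<one>\<^bsub>G\<^esub> \<notin> S" "S = set_inv\<^bsub>G\<^esub> S"
  shows "pair_graph (Cay G S)"
proof -
  interpret group G by fact
  have sym_S: "g \<otimes>\<^bsub>G\<^esub> inv\<^bsub>G\<^esub> h \<in> S"
    if "g \<in> carrier G" "h \<in> carrier G" "h \<otimes>\<^bsub>G\<^esub> inv\<^bsub>G\<^esub> g \<in> S" for g h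
  proof -
    have "inv\<^bsub>G\<^esub> (h \<otimes>\<^bsub>G\<^esub> inv\<^bsub>G\<^esub> g) \<in> set_inv\<^bsub>G\<^esub> S"
      using that(3) by (auto simp: SET_INV_def)
    then have "inv\<^bsub>G\<^esub> (h \<otimes>\<^bsub>G\<^esub> inv\<^bsub>G\<^esub> g) \<in> S"
      using assms(4) by blast
    then show ?thesis
      using that(1,2) by (simp add: inv_mult_group)
  qed
  have "finite (parcs (Cay G S))"
    by (rule finite_subset[of _ "carrier G \<times> carrier G"]) (auto simp: Cay_def assms(2))
  then show ?thesis
    using assms(2,3) sym_S by unfold_locales
      (auto simp: Cay_def symmetric_def arcs_ends_def arc_to_ends_def sym_def image_iff)
qed

text \<open>
  A group of order at most 2 has no subset \<open>S\<close> as in the definition of \<^const>\<open>class_B\<close>, and hence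
  belongs to every class vacuously.
\<close>

lemma class_B_order_le_2:
  assumes "group G" "finite (carrier G)" "Coset.order G \<le> 2"
  shows "G \<in> class_B k"
proof -
  interpret group G by fact
  have small: "card S < 2" if "S \<subseteq> carrier G" "\<one>\<^bsub>G\<^esub> \<notin> S" for S
  proof -
    have "S \<subset> carrier G" using that by auto
    then have "card S < Coset.order G"
      unfolding Coset.order_def using assms(2) by (rule psubset_card_mono[rotated])
    then show ?thesis using assms(3) by simp
  qed
  show ?thesis
    unfolding class_B_def
    by (intro CollectI conjI allI impI assms(1,2)) (use small in \<open>force simp: not_le[symmetric]\<close>)
qed

end

(*
  An eigenvalue of Cay(G,S) has an eigenfunction f on G with sum_{s in S} f(s g) = l f(g), so all
  spectra can be studied through translation operators.

  If G lies in B_3, then S = {a, a^-1} with eigenvalue 2 cos(2 pi / ord a) forces ord a in {1, 2, 5, 10}: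
  a quadratic irrationality of this form and its conjugate are algebraic integers in [-2, 2], so the norm
  of 2 - 2 cos(2 pi / n) is a positive integer, which gives n <= 12, and 7 and 11 are excluded by
  reduction mod 2.  Two commuting involutions give an integral graph, so |G| = 5^k or 2 * 5^k.  In the
  second case let t be an involution acting on the normal Sylow 5-subgroup P.  If t is not central it
  inverts some x in P.  Should t also centralise a nontrivial element, there are commuting x inverted
  and y centralised by t, and S = {yt, y^-1 t, xt} has an eigenvalue with square 4 - sqrt 5 or its
  conjugate; if P contained two independent elements a, b inverted by t, then {t, ta, tb} would have one with
  square 4 + sqrt 5 or its conjugate.  Such numbers are not quadratic, because 11 is not a square.
  Hence t inverts P and P is cyclic of order 5.

  Conversely, for the three families every admissible S is one of {x, x^-1}, {x, x^-1, t}, {tx, tx^-1},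
  {tx, tx^-1, t} with x of order 5 and t^2 = 1, where t normalises {x, x^-1}.  The operator of
  x + x^-1 satisfies (X - 2)(X^2 + X - 1)^2 = 0 and commutes with t, so the spectrum lies in Q(sqrt 5).
*)
theory Submission
  imports Defs
begin

subsection \<open>Quadratic number fields\<close>

text \<open>No Galois group and no ring of algebraic integers is set up. Conjugation is replaced by
  the fact that \<open>cheb_rational_linear\<close> holds uniformly for both roots of a rational
  quadratic, and integrality by a lattice of rationals that is stable under multiplication.
  Necessity uses 2-integrality only in two ways: every eigenvalue satisfies a rational quadratic
  equation, and some eigenvalue is irrational.

  The two forbidden triples are built so that the operator is a sum of commuting translations
  composed with one by \<open>t\<close>. It moves a joint eigenfunction to another eigenspace, but
  its square acts by a scalar. Giving both generators the same primitive fifth root of unity z, with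
  w = z + 1/z, the scalars are (1 + 2z)(1 + 2/z) and (w + z)(w + 1/z), both of the form 4 + sqrt 5
  or 4 - sqrt 5, with norm 16 - 5 = 11.

  The main obstacle is that the Sylow 5-subgroup is not known to be abelian, while both triples need
  commuting elements. A nontrivial central element supplies them and shows that \<open>t\<close> has
  no nontrivial fixed point. Such an action is inversion, and inversion is a homomorphism only on an
  abelian group.\<close>

lemma complex_field_simps [simp]:
  "carrier complex_field = UNIV" "monoid.mult complex_field = (*)" "one complex_field = 1"
  "ring.zero complex_field = 0" "add complex_field = (+)"
  by (auto simp: ring_of_type_algebra_def)

lemma field_complex_field: "field complex_field"
  by (rule field_from_type_algebra)

interpretation complex_field: ring complex_field
  by (rule ring_from_type_algebra)

lemma complex_field_minus [simp]: "\<ominus>\<^bsub>complex_field\<^esub> x = - x"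
  using complex_field.minus_equality[of "- x" x] by simp

lemma complex_field_inv: "x \<noteq> 0 \<Longrightarrow> inv\<^bsub>complex_field\<^esub> x = inverse x"
  using complex_field.inv_unique'[of x "inverse x"] by simp

lemma subfield_complexI:
  assumes "1 \<in> K" "\<And>x. x \<in> K \<Longrightarrow> - x \<in> K"
    "\<And>x y. x \<in> K \<Longrightarrow> y \<in> K \<Longrightarrow> x * y \<in> K" "\<And>x y. x \<in> K \<Longrightarrow> y \<in> K \<Longrightarrow> x + y \<in> K"
    "\<And>x. x \<in> K \<Longrightarrow> inverse x \<in> K"
  shows "subfield K complex_field"
proof (rule field.subfieldI'[OF field_complex_field])
  show "subring K complex_field"
    by (rule complex_field.subringI) (use assms in auto)
qed (use assms(5) in \<open>auto simp: complex_field_inv\<close>)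

lemma subfield_Rats: "subfield \<rat> complex_field"
  by (rule subfield_complexI) auto

lemma Span_single: "u \<in> complex_field.Span K [x] \<longleftrightarrow> (\<exists>a\<in>K. u = a * x)"
  using complex_field.line_extension_mem_iff[of u K x "{0}"] by simp

lemma Span_pair: "u \<in> complex_field.Span K [x, y] \<longleftrightarrow> (\<exists>a\<in>K. \<exists>b\<in>K. u = a * x + b * y)"
proof -
  have "complex_field.Span K [y] = {a * y | a. a \<in> K}"
    using Span_single[of _ K y] by auto
  then show ?thesis
    using complex_field.line_extension_mem_iff[of u K x "complex_field.Span K [y]"] by auto
qed

lemma independent_pair_Rats:
  assumes "x \<notin> \<rat>"
  shows "complex_field.independent \<rat> [x, 1]"
proof (intro complex_field.independent.intros)
  show "x \<notin> complex_field.Span \<rat> [1]" "1 \<notin> complex_field.Span \<rat> []"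
    using assms by (auto simp: Span_single simp del: complex_field.Span.simps) simp
qed auto

text \<open>Three elements of a two-dimensional space are dependent. As \<open>[x, 1]\<close> is
  independent for irrational \<open>x\<close>, the dependence can be solved for the square.\<close>

lemma quadratic_of_dimension_two:
  assumes dim: "complex_field.dimension 2 \<rat> F" and x: "1 \<in> F" "x \<in> F" "x\<^sup>2 \<in> F"
  shows "\<exists>p\<in>\<rat>. \<exists>q\<in>\<rat>. x\<^sup>2 = p * x + q"
proof (cases "x \<in> \<rat>")
  case True
  then show ?thesis by (intro bexI[of _ 0] bexI[of _ "x\<^sup>2"]) auto
next
  case False
  have "\<not> complex_field.independent \<rat> [x\<^sup>2, x, 1]"
    using complex_field.independent_length_le_dimension[OF subfield_Rats dim, of "[x\<^sup>2, x, 1]"] x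
    by auto
  then have "x\<^sup>2 \<in> complex_field.Span \<rat> [x, 1]"
    using complex_field.li_Cons[of "x\<^sup>2" \<rat> "[x, 1]"] independent_pair_Rats[OF False] by auto
  then show ?thesis by (simp add: Span_pair del: complex_field.Span.simps)
qed

lemma splitting_field_subfield: "subfield (splitting_field \<Gamma>) complex_field"
  unfolding splitting_field_def by (rule field.generate_field_is_subfield[OF field_complex_field]) auto

lemma spectrum_subset_splitting_field: "spectrum (adjacency_matrix \<Gamma>) \<subseteq> splitting_field \<Gamma>"
  unfolding splitting_field_def by (auto intro: generate_field.incl)

lemma splitting_field_least:
  "subfield K complex_field \<Longrightarrow> spectrum (adjacency_matrix \<Gamma>) \<subseteq> K \<Longrightarrow> splitting_field \<Gamma> \<subseteq> K"
  unfolding splitting_field_def by (rule field.generate_field_min_subfield1[OF field_complex_field]) auto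

lemma subfield_complexD:
  assumes "subfield K complex_field"
  shows "1 \<in> K" "0 \<in> K" "x \<in> K \<Longrightarrow> - x \<in> K" "x \<in> K \<Longrightarrow> y \<in> K \<Longrightarrow> x * y \<in> K"
    "x \<in> K \<Longrightarrow> y \<in> K \<Longrightarrow> x + y \<in> K" "x \<in> K \<Longrightarrow> inverse x \<in> K"
proof -
  note sub = subringE[OF subfieldE(1)[OF assms]]
  show "1 \<in> K" "0 \<in> K" "x \<in> K \<Longrightarrow> - x \<in> K" "x \<in> K \<Longrightarrow> y \<in> K \<Longrightarrow> x * y \<in> K"
    "x \<in> K \<Longrightarrow> y \<in> K \<Longrightarrow> x + y \<in> K"
    using sub(2,3,5-7) by auto
  then show "x \<in> K \<Longrightarrow> inverse x \<in> K"
    using complex_field.subfield_m_inv(1)[OF assms, of x] complex_field_inv[of x]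
    by (cases "x = 0") auto
qed

lemma Rats_subset_subfield:
  assumes "subfield K complex_field"
  shows "\<rat> \<subseteq> K"
proof
  note K = subfield_complexD[OF assms]
  have nat: "of_nat n \<in> K" for n by (induction n) (use K in auto)
  have int: "of_int i \<in> K" for i
    using nat[of "nat i"] K(3)[OF nat[of "nat (- i)"]] by (cases "i \<ge> 0") auto
  fix x :: complex assume "x \<in> \<rat>"
  then obtain a b where "x = of_int a / of_int b" by (auto elim: Rats_cases')
  then show "x \<in> K" using K(4)[OF int K(6)[OF int]] by (simp add: divide_inverse)
qed

lemma two_integral_quadratic:
  assumes "two_integral \<Gamma>" "x \<in> spectrum (adjacency_matrix \<Gamma>)"
  shows "\<exists>p\<in>\<rat>. \<exists>q\<in>\<rat>. x\<^sup>2 = p * x + q"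
proof (rule quadratic_of_dimension_two)
  note F = subfield_complexD[OF splitting_field_subfield[of \<Gamma>]]
  show "complex_field.dimension 2 \<rat> (splitting_field \<Gamma>)"
    using assms(1) by (simp add: two_integral_def)
  show "x \<in> splitting_field \<Gamma>"
    using assms(2) spectrum_subset_splitting_field by blast
  then show "x\<^sup>2 \<in> splitting_field \<Gamma>" using F(4) by (simp add: power2_eq_square)
qed (rule subfield_complexD[OF splitting_field_subfield])

text \<open>With rational spectrum the splitting field is \<open>\<rat>\<close> itself, of dimension
  1. This is what excludes integral graphs.\<close>

lemma two_integral_imp_irrational:
  assumes "two_integral \<Gamma>"
  shows "\<not> spectrum (adjacency_matrix \<Gamma>) \<subseteq> \<rat>"
proof
  assume "spectrum (adjacency_matrix \<Gamma>) \<subseteq> \<rat>"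
  then have "splitting_field \<Gamma> = \<rat>"
    using splitting_field_least[OF subfield_Rats] Rats_subset_subfield[OF splitting_field_subfield]
    by blast
  then have "complex_field.dimension 2 \<rat> \<rat>"
    using assms by (simp add: two_integral_def)
  then show False
    using complex_field.dimension_is_inj[OF subfield_Rats]
      complex_field.dimension_one[OF subfield_Rats] by fastforce
qed

text \<open>Given by coordinates instead of as a generated field, so that membership is checked by
  exhibiting two rationals and the basis for the dimension count is visible.\<close>

definition Q_sqrt5 :: "complex set" where
  "Q_sqrt5 = {x. \<exists>a\<in>\<rat>. \<exists>b\<in>\<rat>. x = a + b * of_real (sqrt 5)}"

lemma Q_sqrt5I: "a \<in> \<rat> \<Longrightarrow> b \<in> \<rat> \<Longrightarrow> a + b * of_real (sqrt 5) \<in> Q_sqrt5"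
  by (auto simp: Q_sqrt5_def)

text \<open>In lowest terms the squared denominator divides the squared numerator, so it is 1.
  Applied below with 5 and 11, which are not squares.\<close>

lemma rational_square_root_of_nat:
  fixes x :: "'a::field_char_0"
  assumes "x \<in> \<rat>" "x\<^sup>2 = of_nat n"
  shows "\<exists>m::nat. m\<^sup>2 = n"
proof -
  obtain r where r: "x = of_rat r" using assms(1) by (auto elim: Rats_cases)
  have "of_rat (r\<^sup>2) = (of_rat (of_nat n) :: 'a)"
    using assms(2) r by (simp add: of_rat_power)
  then have rn: "r\<^sup>2 = of_nat n" by (simp only: of_rat_eq_iff)
  obtain a b where ab: "quotient_of r = (a, b)" by (cases "quotient_of r") auto
  have b: "b > 0" "coprime a b" and rab: "r = of_int a / of_int b"
    using quotient_of_denom_pos[OF ab] quotient_of_coprime[OF ab] quotient_of_div[OF ab] by auto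
  have "(of_int (a\<^sup>2) :: rat) = of_int (int n * b\<^sup>2)"
    using rn b unfolding rab by (simp add: field_simps)
  then have eq: "a\<^sup>2 = int n * b\<^sup>2" by (simp only: of_int_eq_iff)
  then have "b\<^sup>2 dvd a\<^sup>2" by simp
  then have "b dvd a" by simp
  then have "is_unit b" using coprime_common_divisor[OF b(2), of b] by simp
  with b(1) have "b = 1" by simp
  with eq have "int ((nat \<bar>a\<bar>)\<^sup>2) = int n" by simp
  then show ?thesis by (metis of_nat_eq_iff)
qed

lemma rational_square_neq_5:
  fixes x :: "'a::field_char_0"
  assumes "x \<in> \<rat>"
  shows "x\<^sup>2 \<noteq> 5"
proof
  assume "x\<^sup>2 = 5"
  then obtain m :: nat where m: "m\<^sup>2 = 5"
    using rational_square_root_of_nat[OF assms, of 5] by auto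
  then have "m < 3" using power_mono[of 3 m 2] by (cases "m < 3") simp_all
  then consider "m = 0" | "m = 1" | "m = 2" by linarith
  then show False using m by cases simp_all
qed

lemma sqrt5_irrat: "complex_of_real (sqrt 5) \<notin> \<rat>"
proof
  assume "complex_of_real (sqrt 5) \<in> \<rat>"
  moreover have "(complex_of_real (sqrt 5))\<^sup>2 = 5"
    unfolding of_real_power[symmetric] by simp
  ultimately show False using rational_square_neq_5 by blast
qed

lemma subfield_Q_sqrt5: "subfield Q_sqrt5 complex_field"
proof (rule subfield_complexI)
  define s where "s = complex_of_real (sqrt 5)"
  have s5: "s * s = 5"
    unfolding s_def of_real_mult[symmetric] by simp
  have irr: "s \<notin> \<rat>" using sqrt5_irrat by (simp only: s_def not_False_eq_True)
  have I: "a + b * s \<in> Q_sqrt5" if "a \<in> \<rat>" "b \<in> \<rat>" for a b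
    unfolding s_def using that by (rule Q_sqrt5I)
  have E: "\<exists>a\<in>\<rat>. \<exists>b\<in>\<rat>. x = a + b * s" if "x \<in> Q_sqrt5" for x
    using that unfolding Q_sqrt5_def s_def by blast
  show "1 \<in> Q_sqrt5" using I[of 1 0] by simp
  fix x assume "x \<in> Q_sqrt5"
  then obtain a b where x: "a \<in> \<rat>" "b \<in> \<rat>" "x = a + b * s"
    using E by blast
  show "- x \<in> Q_sqrt5" using I[of "- a" "- b"] x by simp
  show "inverse x \<in> Q_sqrt5"
  proof (cases "x = 0")
    case True
    then show ?thesis using I[of 0 0] by simp
  next
    case False
    \<comment> \<open>\<open>e\<close> is the norm of \<open>x\<close>; the inverse is the conjugate
      \<open>a - b * s\<close> divided by it.\<close>
    define e where "e = a * a - 5 * b * b"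
    have "(a + b * s) * (a - b * s) = a * a - b * b * (s * s)"
      by (simp add: algebra_simps)
    then have *: "x * (a - b * s) = e"
      using s5 by (simp add: e_def x(3))
    have "a - b * s \<noteq> 0"
    proof
      assume eq: "a - b * s = 0"
      show False
      proof (cases "b = 0")
        case True
        then show False using eq x(3) False by simp
      next
        case b: False
        then have "s = a / b" using eq by (simp add: field_simps)
        then show False using irr x by simp
      qed
    qed
    then have "e \<noteq> 0" using * False by force
    then have "inverse x = (a - b * s) / e"
      using * by (intro inverse_unique) simp
    then have "inverse x = a / e + (- b / e) * s"
      by (simp add: diff_divide_distrib)
    moreover have "e \<in> \<rat>" using x by (simp add: e_def)
    ultimately show ?thesis using I[of "a / e" "- b / e"] x by simp
  qed
  fix y assume "y \<in> Q_sqrt5"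
  then obtain c d where y: "c \<in> \<rat>" "d \<in> \<rat>" "y = c + d * s"
    using E by blast
  have sum: "x + y = (a + c) + (b + d) * s" by (simp add: x(3) y(3) algebra_simps)
  show "x + y \<in> Q_sqrt5" unfolding sum by (rule I) (use x y in auto)
  have prod: "x * y = (a * c + b * d * (s * s)) + (a * d + b * c) * s"
    by (simp add: x(3) y(3) algebra_simps)
  show "x * y \<in> Q_sqrt5" unfolding prod s5 by (rule I) (use x y in auto)
qed

text \<open>A single irrational element of a quadratic field generates it, so one irrational
  eigenvalue upgrades the inclusion in \<open>Q_sqrt5\<close> to an equality.\<close>

lemma two_integralI:
  assumes sub: "spectrum (adjacency_matrix \<Gamma>) \<subseteq> Q_sqrt5"
    and x: "x \<in> spectrum (adjacency_matrix \<Gamma>)" "x \<notin> \<rat>"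
  shows "two_integral \<Gamma>"
proof -
  note sf = splitting_field_subfield[of \<Gamma>]
  note F = subfield_complexD[OF sf] and R = Rats_subset_subfield[OF sf]
  have xF: "x \<in> splitting_field \<Gamma>" using x spectrum_subset_splitting_field by blast
  obtain a b where ab: "a \<in> \<rat>" "b \<in> \<rat>" "x = a + b * of_real (sqrt 5)"
    using subsetD[OF sub x(1)] unfolding Q_sqrt5_def by blast
  \<comment> \<open>The nonzero coordinate allows \<open>sqrt 5\<close> to be recovered from
    \<open>x\<close>.\<close>
  have "b \<noteq> 0" using ab x(2) by auto
  then have "of_real (sqrt 5) = (x + (- a)) * inverse b" unfolding ab(3) by simp
  then have s: "of_real (sqrt 5) \<in> splitting_field \<Gamma>"
    using F(5)[OF xF F(3)[OF subsetD[OF R ab(1)]]] F(4)[OF _ F(6)[OF subsetD[OF R ab(2)]]]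
    by metis
  have "Q_sqrt5 \<subseteq> splitting_field \<Gamma>"
    using F(5)[OF _ F(4)[OF _ s]] R by (auto simp: Q_sqrt5_def)
  then have eq: "splitting_field \<Gamma> = Q_sqrt5"
    using splitting_field_least[OF subfield_Q_sqrt5 sub] by blast
  have span: "complex_field.Span \<rat> [of_real (sqrt 5), 1] = Q_sqrt5"
  proof (rule Set.set_eqI)
    fix u
    have "u \<in> complex_field.Span \<rat> [of_real (sqrt 5), 1] \<longleftrightarrow>
        (\<exists>b\<in>\<rat>. \<exists>a\<in>\<rat>. u = a + b * of_real (sqrt 5))"
      by (simp only: Span_pair mult_1_right add.commute)
    then show "u \<in> complex_field.Span \<rat> [of_real (sqrt 5), 1] \<longleftrightarrow> u \<in> Q_sqrt5"
      unfolding Q_sqrt5_def by blast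
  qed
  have "complex_field.dimension (length [complex_of_real (sqrt 5), 1]) \<rat> Q_sqrt5"
    using independent_pair_Rats[OF sqrt5_irrat] span by (rule complex_field.dimensionI[OF subfield_Rats])
  then show ?thesis unfolding two_integral_def eq by (simp add: numeral_2_eq_2)
qed

subsection \<open>Quadratic irrationalities of the form 2 cos (2 pi / n)\<close>

text \<open>The additive subgroup generated by a nonempty \<open>V\<close>; zero arises as
  \<open>x + - x\<close>. The inductive form makes stability under multiplication an induction over
  three rules.\<close>

inductive_set int_span :: "'a::ring_1 set \<Rightarrow> 'a set" for V where
  base: "x \<in> V \<Longrightarrow> x \<in> int_span V"
| add: "x \<in> int_span V \<Longrightarrow> y \<in> int_span V \<Longrightarrow> x + y \<in> int_span V"
| minus: "x \<in> int_span V \<Longrightarrow> - x \<in> int_span V"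

lemma common_denominator:
  fixes V :: "real set"
  assumes "finite V" "V \<subseteq> \<rat>"
  shows "\<exists>d::int. d > 0 \<and> (\<forall>x\<in>V. of_int d * x \<in> \<int>)"
  using assms
proof (induction V)
  case empty
  then show ?case by (intro exI[of _ 1]) auto
next
  case (insert x V)
  then obtain d where d: "d > 0" "\<forall>x\<in>V. of_int d * x \<in> \<int>" by auto
  from insert.prems obtain a b where ab: "b > 0" "x = of_int a / of_int b"
    by (auto elim: Rats_cases')
  have "of_int (d * b) * x = of_int (d * a)" using ab by simp
  moreover have "of_int (d * b) * y = of_int b * (of_int d * y)" for y :: real by simp
  ultimately have "\<forall>y\<in>insert x V. of_int (d * b) * y \<in> \<int>"
    using d(2) by (metis Ints_mult Ints_of_int insert_iff)
  then show ?case using d(1) ab(1) by (intro exI[of _ "d * b"]) auto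
qed

text \<open>If \<open>b\<close> is the reduced denominator of \<open>N\<close>, then every power of
  \<open>b\<close> divides the fixed nonzero \<open>e\<close>, which is impossible for
  \<open>b\<close> at least 2.\<close>

lemma int_of_bounded_denominator_powers:
  fixes N :: real and e :: int
  assumes "N \<in> \<rat>" "e \<noteq> 0" "\<And>k. of_int e * N ^ k \<in> \<int>"
  shows "N \<in> \<int>"
proof -
  obtain a b :: int where ab: "b > 0" "coprime a b" "N = of_int a / of_int b"
    using assms(1) by (auto elim: Rats_cases')
  have dvd: "b ^ k dvd e" for k
  proof -
    obtain m where "of_int e * N ^ k = of_int m" using assms(3) by (auto elim: Ints_cases)
    then have "(of_int (e * a ^ k) :: real) = of_int (m * b ^ k)"
      using ab by (simp add: power_divide field_simps)
    then have "e * a ^ k = m * b ^ k" by (simp only: of_int_eq_iff)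
    then have "b ^ k dvd e * a ^ k" by simp
    moreover have "coprime (b ^ k) (a ^ k)" using ab(2) by (simp add: ac_simps)
    ultimately show ?thesis by (simp add: coprime_dvd_mult_left_iff)
  qed
  have "b = 1"
  proof (rule ccontr)
    assume "b \<noteq> 1"
    then have b: "b \<ge> 2" using ab(1) by simp
    define k where "k = nat \<bar>e\<bar>"
    have "int k < 2 ^ k" using of_nat_less_two_power[of k] by simp
    also have "(2::int) ^ k \<le> b ^ k" using b by (intro power_mono) auto
    also have "b ^ k \<le> \<bar>e\<bar>" using dvd_imp_le_int[OF assms(2) dvd[of k]] ab(1) by simp
    finally show False by (simp add: k_def)
  qed
  then show ?thesis using ab(3) by simp
qed

text \<open>A finitely generated group of rationals has a common denominator. If it is stable under
  \<open>N\<close>, all numbers \<open>N ^ k * x0\<close> share that denominator, so the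
  denominators of the powers of \<open>N\<close> stay bounded.\<close>

lemma Ints_if_stabilizes_rational_lattice:
  fixes N :: real
  assumes V: "finite V" "V \<subseteq> \<rat>" "x0 \<in> V" "x0 \<noteq> 0"
    and N: "N \<in> \<rat>" "\<And>x. x \<in> V \<Longrightarrow> N * x \<in> int_span V"
  shows "N \<in> \<int>"
proof -
  obtain d where d: "d > 0" "\<And>x. x \<in> V \<Longrightarrow> of_int d * x \<in> \<int>"
    using common_denominator[OF V(1,2)] by blast
  have dL: "of_int d * x \<in> \<int>" if "x \<in> int_span V" for x
    using that by induction (auto simp: d(2) distrib_left)
  have NL: "N * x \<in> int_span V" if "x \<in> int_span V" for x
    using that by induction (auto simp: N(2) distrib_left intro: int_span.intros)
  have pow: "N ^ k * x0 \<in> int_span V" for k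
    by (induction k) (use V(3) NL in \<open>auto intro: int_span.base simp: mult.assoc\<close>)
  obtain e where e: "of_int d * x0 = of_int e" using d(2)[OF V(3)] by (auto elim: Ints_cases)
  have "e \<noteq> 0" using e d(1) V(4) by auto
  moreover have "of_int e * N ^ k \<in> \<int>" for k
    using dL[OF pow[of k]] e[symmetric] by (simp add: ac_simps)
  ultimately show ?thesis using int_of_bounded_denominator_powers[OF N(1)] by blast
qed

text \<open>The Chebyshev polynomials normalised so that \<open>cheb (x + 1 / x) k = x ^ k + 1 / x ^ k\<close>.\<close>

fun cheb :: "'a::comm_ring_1 \<Rightarrow> nat \<Rightarrow> 'a" where
  "cheb x 0 = 2"
| "cheb x (Suc 0) = x"
| "cheb x (Suc (Suc k)) = x * cheb x (Suc k) - cheb x k"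

lemma cheb_cos: "cheb (2 * cos t) k = 2 * cos (real k * t)"
proof (induction k rule: induct_nat_012)
  case (ge2 k)
  have "cos (real (Suc (Suc k)) * t) + cos (real k * t) = 2 * cos (real (Suc k) * t) * cos t"
    using cos_times_cos[of "real (Suc k) * t" t] by (simp add: algebra_simps)
  then show ?case unfolding cheb.simps ge2 by (simp only: mult.commute mult.left_commute)
qed auto

lemma cheb_Rats: "x \<in> \<rat> \<Longrightarrow> cheb x k \<in> (\<rat> :: real set)"
  by (induction k rule: induct_nat_012) auto

text \<open>Reduction modulo the quadratic polynomial. The order of quantifiers is the point:
  \<open>a\<close> and \<open>b\<close> are chosen before \<open>x\<close>, so both roots share
  them.\<close>

lemma cheb_rational_linear:
  fixes p q :: real
  assumes "p \<in> \<rat>" "q \<in> \<rat>"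
  shows "\<exists>a\<in>\<rat>. \<exists>b\<in>\<rat>. \<forall>x. x\<^sup>2 = p * x + q \<longrightarrow> cheb x k = a * x + b"
proof (induction k rule: induct_nat_012)
  case 0
  show ?case by (intro bexI[of _ 0] bexI[of _ 2]) auto
next
  case 1
  show ?case by (intro bexI[of _ 1] bexI[of _ 0]) auto
next
  case (ge2 k)
  obtain a b a' b' where ab: "a \<in> \<rat>" "b \<in> \<rat>" "a' \<in> \<rat>" "b' \<in> \<rat>"
    and eq: "\<And>x. x\<^sup>2 = p * x + q \<Longrightarrow> cheb x k = a * x + b"
      "\<And>x. x\<^sup>2 = p * x + q \<Longrightarrow> cheb x (Suc k) = a' * x + b'"
    using ge2 by metis
  have "cheb x (Suc (Suc k)) = (a' * p + b' - a) * x + (a' * q - b)" if "x\<^sup>2 = p * x + q" for x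
  proof -
    have "cheb x (Suc (Suc k)) = a' * x\<^sup>2 + b' * x - a * x - b"
      unfolding cheb.simps eq[OF that] by (simp add: algebra_simps power2_eq_square)
    then show ?thesis by (simp add: that algebra_simps)
  qed
  moreover have "a' * p + b' - a \<in> \<rat>" "a' * q - b \<in> \<rat>" using ab assms by auto
  ultimately show ?case by blast
qed

text \<open>Outside [-2, 2] the absolute values increase strictly from \<open>cheb x 0 = 2\<close>
  on, so the sequence cannot be periodic. This confines the conjugate of a cosine value.\<close>

lemma cheb_abs_gt_2:
  fixes x :: real
  assumes "\<bar>x\<bar> > 2" "k > 0"
  shows "\<bar>cheb x k\<bar> > 2"
proof -
  have "\<bar>cheb x (Suc k)\<bar> > \<bar>cheb x k\<bar> \<and> \<bar>cheb x k\<bar> \<ge> 2" for k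
  proof (induction k)
    case (Suc k)
    have "\<bar>cheb x (Suc (Suc k))\<bar> \<ge> \<bar>x\<bar> * \<bar>cheb x (Suc k)\<bar> - \<bar>cheb x k\<bar>"
      by (simp add: abs_mult[symmetric] abs_triangle_ineq2)
    moreover have "\<bar>x\<bar> * \<bar>cheb x (Suc k)\<bar> > 2 * \<bar>cheb x (Suc k)\<bar>"
      using assms(1) Suc by (intro mult_strict_right_mono) auto
    ultimately show ?case using Suc by linarith
  qed (use assms in auto)
  from this[of "k - 1"] assms(2) show ?thesis by (cases k) auto
qed

lemma rational_linear_relation:
  fixes x :: real
  assumes "x \<notin> \<rat>" "a \<in> \<rat>" "b \<in> \<rat>" "a * x + b = 0"
  shows "a = 0" "b = 0"
proof -
  show "a = 0"
  proof (rule ccontr)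
    assume "a \<noteq> 0"
    then have "x = - b / a" using assms(4) by (simp add: field_simps)
    then show False using assms by simp
  qed
  then show "b = 0" using assms(4) by simp
qed

text \<open>The bound on \<open>n\<close> below needs 4 (pi / 13)^2 < 1/4, that is, pi < 13/4.
  Machin's formula with the crude estimate arctan (1/5) <= 1/5 already gives pi / 4 < 4/5.\<close>

lemma pi_less_16_5: "pi < 16 / 5"
proof -
  have "\<exists>z. 0 < z \<and> z < 1 / 5 \<and> arctan (1 / 5) - arctan 0 = (1 / 5 - 0) * inverse (1 + z\<^sup>2)"
    by (rule MVT2) (auto intro: DERIV_arctan)
  then obtain z where "arctan (1 / 5) = 1 / 5 * inverse (1 + z\<^sup>2)" by auto
  moreover have "inverse (1 + z\<^sup>2) \<le> 1" by (simp add: inverse_le_1_iff)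
  ultimately have "arctan (1 / 5) \<le> 1 / 5" by simp
  moreover have "arctan (1 / 239) > (0 :: real)" by simp
  ultimately show ?thesis using machin by linarith
qed

text \<open>Both sides are rational linear expressions in \<open>c\<close>. As \<open>c\<close> is
  irrational their coefficients agree, and the equality passes to the other root: this is Galois
  conjugation by hand.\<close>

lemma cheb_conjugate:
  fixes c c' :: real
  assumes "c \<notin> \<rat>" "p \<in> \<rat>" "q \<in> \<rat>" "c\<^sup>2 = p * c + q" "c'\<^sup>2 = p * c' + q"
    and "cheb c j = cheb c k"
  shows "cheb c' j = cheb c' k"
proof -
  obtain a b where ab: "a \<in> \<rat>" "b \<in> \<rat>" "\<And>x. x\<^sup>2 = p * x + q \<Longrightarrow> cheb x j = a * x + b"
    using cheb_rational_linear[OF assms(2,3), of j] by blast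
  obtain d e where de: "d \<in> \<rat>" "e \<in> \<rat>" "\<And>x. x\<^sup>2 = p * x + q \<Longrightarrow> cheb x k = d * x + e"
    using cheb_rational_linear[OF assms(2,3), of k] by blast
  have "(a - d) * c + (b - e) = 0"
    using ab(3)[OF assms(4)] de(3)[OF assms(4)] assms(6) by (simp add: algebra_simps)
  then have "a = d" "b = e"
    using rational_linear_relation[of c "a - d" "b - e"] assms(1) ab de by auto
  then show ?thesis using ab(3)[OF assms(5)] de(3)[OF assms(5)] by simp
qed

text \<open>The conjugate \<open>p - c\<close> inherits from \<open>c\<close> the period
  \<open>n\<close> of its \<open>cheb\<close> sequence, so it cannot lie outside [-2, 2].
  Periodicity also makes a finitely generated lattice available, from which the integrality of trace
  and norm is read off.\<close>

lemma quadratic_cos_coefficients: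
  fixes p q :: real and n :: nat
  defines "c \<equiv> 2 * cos (2 * pi / real n)"
  assumes n: "n > 0" and c: "c \<notin> \<rat>" and pq: "p \<in> \<rat>" "q \<in> \<rat>" "c\<^sup>2 = p * c + q"
  shows "p \<in> \<int>" "q \<in> \<int>" "\<bar>p - c\<bar> \<le> 2"
proof -
  define c' where "c' = p - c"
  have c': "c'\<^sup>2 = p * c' + q"
    using pq(3) by (simp add: c'_def power2_eq_square algebra_simps)
  note conj = cheb_conjugate[OF c pq c']
  have per: "cheb c (i + n) = cheb c i" for i
  proof -
    have "real (i + n) * (2 * pi / real n) = real i * (2 * pi / real n) + 2 * pi"
      using n by (simp add: field_simps)
    then show ?thesis by (simp add: c_def cheb_cos)
  qed
  have per': "cheb c' (i + n) = cheb c' i" for i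
    by (rule conj[OF per])
  show "\<bar>p - c\<bar> \<le> 2"
    using cheb_abs_gt_2[of c' n] per'[of 0] n by (force simp: c'_def)
  \<comment> \<open>The numbers \<open>r i j\<close> are rational by symmetry in \<open>c\<close> and \<open>c'\<close>, and finite in number by
    periodicity; multiplication by \<open>p = c + c'\<close> and by \<open>- q = c * c'\<close> preserves the lattice that they span.\<close>
  define r where "r i j = cheb c i * cheb c' j + cheb c' i * cheb c j" for i j
  define V where "V = range (\<lambda>(i, j). r i j)"
  have red: "\<exists>l<n. cheb c i = cheb c l \<and> cheb c' i = cheb c' l" for i
  proof (induction i rule: less_induct)
    case (less i)
    show ?case
    proof (cases "i < n")
      case False
      then have "i = (i - n) + n" "i - n < i" using n by auto
      then show ?thesis using less[of "i - n"] per[of "i - n"] per'[of "i - n"] by metis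
    qed auto
  qed
  have "V \<subseteq> (\<lambda>(i, j). r i j) ` ({..<n} \<times> {..<n})"
  proof
    fix v assume "v \<in> V"
    then obtain i j where v: "v = r i j" by (auto simp: V_def)
    obtain k l where "k < n" "cheb c i = cheb c k" "cheb c' i = cheb c' k"
      and "l < n" "cheb c j = cheb c l" "cheb c' j = cheb c' l"
      using red[of i] red[of j] by blast
    then have "v = r k l" "(k, l) \<in> {..<n} \<times> {..<n}" by (auto simp: v r_def)
    then show "v \<in> (\<lambda>(i, j). r i j) ` ({..<n} \<times> {..<n})" by force
  qed
  then have fin: "finite V" by (rule finite_subset) auto
  have sum: "c + c' = p" by (simp add: c'_def)
  have prod: "c * c' = - q"
    using pq(3) by (simp add: c'_def power2_eq_square algebra_simps)
  have rat: "V \<subseteq> \<rat>"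
  proof
    fix v assume "v \<in> V"
    then obtain i j where v: "v = r i j" by (auto simp: V_def)
    obtain a b where ab: "a \<in> \<rat>" "b \<in> \<rat>" "\<And>x. x\<^sup>2 = p * x + q \<Longrightarrow> cheb x i = a * x + b"
      using cheb_rational_linear[OF pq(1,2), of i] by blast
    obtain d e where de: "d \<in> \<rat>" "e \<in> \<rat>" "\<And>x. x\<^sup>2 = p * x + q \<Longrightarrow> cheb x j = d * x + e"
      using cheb_rational_linear[OF pq(1,2), of j] by blast
    have "v = (a * c + b) * (d * c' + e) + (a * c' + b) * (d * c + e)"
      by (simp add: v r_def ab(3) de(3) pq(3) c')
    also have "\<dots> = 2 * a * d * (c * c') + (a * e + b * d) * (c + c') + 2 * b * e"
      by (simp add: algebra_simps)
    finally have "v = 2 * a * d * (- q) + (a * e + b * d) * p + 2 * b * e"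
      by (simp only: sum prod)
    then show "v \<in> \<rat>" using ab de pq by simp
  qed
  have rV: "r i j \<in> int_span V" for i j
    by (rule int_span.base) (auto simp: V_def intro!: image_eqI[of _ _ "(i, j)"])
  have r00: "r 0 0 \<in> V" "r 0 0 \<noteq> 0"
    by (auto simp: V_def r_def intro!: image_eqI[of _ _ "(0, 0)"])
  \<comment> \<open>Shifting by the period makes both indices positive, so that the recurrence
    \<open>c * cheb c (Suc k) = cheb c (k + 2) + cheb c k\<close> can be used without negative
    indices.\<close>
  have shift: "\<exists>k l. v = r (Suc k) (Suc l)" if "v \<in> V" for v
  proof -
    from that obtain i j where v: "v = r i j" by (auto simp: V_def)
    have "v = r (i + n) (j + n)" by (simp add: v r_def per per')
    then show ?thesis using n by (metis add_Suc_right gr0_implies_Suc)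
  qed
  have "p * v \<in> int_span V" if v: "v \<in> V" for v
  proof -
    obtain k l where "v = r (Suc k) (Suc l)" using shift[OF v] by blast
    then have "p * v = (r (k + 2) (Suc l) + r k (Suc l)) + (r (Suc k) (l + 2) + r (Suc k) l)"
      by (simp add: sum[symmetric] r_def algebra_simps)
    then show ?thesis by (metis rV int_span.add)
  qed
  with Ints_if_stabilizes_rational_lattice[OF fin rat r00 pq(1)] show "p \<in> \<int>" by blast
  have "- q * v \<in> int_span V" if v: "v \<in> V" for v
  proof -
    obtain k l where "v = r (Suc k) (Suc l)" using shift[OF v] by blast
    then have "- q * v = (r (k + 2) (l + 2) + r (k + 2) l) + (r k (l + 2) + r k l)"
      by (simp add: prod[symmetric] r_def algebra_simps)
    then show ?thesis by (metis rV int_span.add)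
  qed
  with Ints_if_stabilizes_rational_lattice[OF fin rat r00, of "- q"] pq(2) show "q \<in> \<int>"
    by (metis Ints_minus Rats_minus_iff minus_minus)
qed

text \<open>The norm is at least 1 and its second factor at most 4, which forces 2 - c >= 1/4. But 2
  - c = 4 sin^2 (pi / n) <= 4 (pi / n)^2, and this is too small from n = 13 on.\<close>

lemma quadratic_cos_bound:
  fixes p q :: real and n :: nat
  defines "c \<equiv> 2 * cos (2 * pi / real n)"
  assumes n: "n > 0" and c: "c \<notin> \<rat>" and pq: "p \<in> \<rat>" "q \<in> \<rat>" "c\<^sup>2 = p * c + q"
  shows "n \<le> 12"
proof (rule ccontr)
  assume "\<not> n \<le> 12"
  then have n13: "n \<ge> 13" by simp
  note int = quadratic_cos_coefficients[OF n c[unfolded c_def] pq(1,2) pq(3)[unfolded c_def],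
      folded c_def]
  \<comment> \<open>The norm of \<open>2 - c\<close>.\<close>
  define N where "N = (2 - c) * (2 - (p - c))"
  have "N = 4 - 2 * p - q"
    using pq(3) by (simp add: N_def power2_eq_square algebra_simps)
  then have Nint: "N \<in> \<int>" using int by simp
  have "p - c \<noteq> 2"
  proof
    assume "p - c = 2"
    then have "c = p - 2" by simp
    then show False using c pq(1) by simp
  qed
  moreover have "c \<noteq> 2" using c by auto
  moreover have "c \<le> 2" by (simp add: c_def)
  ultimately have "2 - c > 0" "2 - (p - c) > 0" using int(3) by auto
  then have "N > 0" by (simp add: N_def)
  with Nint have N1: "N \<ge> 1" by (auto elim: Ints_cases)
  have "N \<le> (2 - c) * 4"
    unfolding N_def using \<open>2 - c > 0\<close> int(3) by (intro mult_left_mono) auto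
  then have low: "2 - c \<ge> 1 / 4" using N1 by simp
  have "c = 2 - 4 * (sin (pi / real n))\<^sup>2"
    using cos_double_sin[of "pi / real n"] by (simp add: c_def)
  then have "2 - c = 4 * (sin (pi / real n))\<^sup>2" by simp
  also have "\<dots> \<le> 4 * (pi / real n)\<^sup>2"
  proof -
    have "0 \<le> pi / real n" "pi / real n \<le> pi" using n by (auto simp: field_simps)
    then have "0 \<le> sin (pi / real n)" "sin (pi / real n) \<le> pi / real n"
      using sin_ge_zero sin_x_le_x by auto
    then show ?thesis by (intro mult_left_mono power_mono) auto
  qed
  also have "\<dots> \<le> 4 * ((16 / 5) / 13)\<^sup>2"
    using pi_less_16_5 n13 by (intro mult_left_mono power_mono frac_le) auto
  also have "\<dots> < 1 / 4" by (simp add: power2_eq_square)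
  finally show False using low by simp
qed

lemma cube_of_quadratic:
  fixes c p q :: "'a::comm_ring_1"
  assumes "c\<^sup>2 = p * c + q"
  shows "c ^ 3 = (p\<^sup>2 + q) * c + p * q"
proof -
  have "c ^ 3 = c * c\<^sup>2" by (simp add: power3_eq_cube power2_eq_square)
  also have "\<dots> = c * (p * c + q)" by (simp only: assms)
  also have "\<dots> = p * c\<^sup>2 + q * c" by (simp add: power2_eq_square algebra_simps)
  finally show ?thesis unfolding assms by (simp add: power2_eq_square algebra_simps)
qed

text \<open>With angle 2 pi / 7 the cosines of its triple and quadruple agree, and
  \<open>cheb c 4 - cheb c 3\<close> is (c - 2)(c^3 + c^2 - 2c - 1). Reducing the cubic modulo the
  quadratic leaves two integer equations: modulo 2 the first makes \<open>Q\<close> even, and then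
  the constant term is odd.\<close>

lemma quadratic_cos_not_7:
  fixes p q :: real
  defines "c \<equiv> 2 * cos (2 * pi / 7)"
  assumes c: "c \<notin> \<rat>" and pq: "p \<in> \<rat>" "q \<in> \<rat>" "c\<^sup>2 = p * c + q"
  shows False
proof -
  have "p \<in> \<int>" "q \<in> \<int>"
    using quadratic_cos_coefficients[of 7 p q] c pq by (auto simp only: c_def of_nat_numeral zero_less_numeral)
  then obtain P Q where P: "p = of_int P" and Q: "q = of_int Q" unfolding Ints_def by blast
  have "cheb c 4 = cheb c 3"
  proof -
    have "4 * (2 * pi / 7) = 2 * pi - 3 * (2 * pi / 7)" by simp
    then have "cos (4 * (2 * pi / 7)) = cos (3 * (2 * pi / 7))"
      by (metis cos_2pi_minus)
    then show ?thesis unfolding c_def cheb_cos by simp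
  qed
  then have "(c - 2) * (c ^ 3 + c ^ 2 - 2 * c - 1) = 0"
    by (simp add: numeral_eq_Suc algebra_simps)
  moreover have "c \<noteq> 2" using c by auto
  ultimately have cub: "c ^ 3 + c ^ 2 - 2 * c - 1 = 0" by simp
  have "(p * p + q + p - 2) * c + (p * q + q - 1) = 0"
    using cub unfolding cube_of_quadratic[OF pq(3)] pq(3)
    by (simp add: algebra_simps power2_eq_square)
  moreover have "p * p + q + p - 2 \<in> \<rat>" "p * q + q - 1 \<in> \<rat>" using pq by auto
  ultimately have "p * p + q + p - 2 = 0" "p * q + q - 1 = 0"
    using rational_linear_relation[OF c] by blast+
  then have "real_of_int (P * P + Q + P - 2) = of_int 0" "real_of_int (P * Q + Q - 1) = of_int 0"
    by (simp_all add: P Q)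
  then have "P * P + Q + P - 2 = 0" "P * Q + Q - 1 = 0"
    by (simp_all only: of_int_eq_iff)
  then have "even (P * P + Q + P - 2)" "even (P * Q + Q - 1)" by simp_all
  then show False by auto
qed

text \<open>The same method, with \<open>cheb c 6 - cheb c 5\<close> equal to \<open>c - 2\<close>
  times a quintic. After reduction modulo the quadratic the constant term is odd for all
  \<open>P\<close> and \<open>Q\<close>.\<close>

lemma quadratic_cos_not_11:
  fixes p q :: real
  defines "c \<equiv> 2 * cos (2 * pi / 11)"
  assumes c: "c \<notin> \<rat>" and pq: "p \<in> \<rat>" "q \<in> \<rat>" "c\<^sup>2 = p * c + q"
  shows False
proof -
  have "p \<in> \<int>" "q \<in> \<int>"
    using quadratic_cos_coefficients[of 11 p q] c pq by (auto simp only: c_def of_nat_numeral zero_less_numeral)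
  then obtain P Q where P: "p = of_int P" and Q: "q = of_int Q" unfolding Ints_def by blast
  have "cheb c 6 = cheb c 5"
  proof -
    have "6 * (2 * pi / 11) = 2 * pi - 5 * (2 * pi / 11)" by simp
    then have "cos (6 * (2 * pi / 11)) = cos (5 * (2 * pi / 11))"
      by (metis cos_2pi_minus)
    then show ?thesis unfolding c_def cheb_cos by simp
  qed
  then have "(c - 2) * (c ^ 5 + c ^ 4 - 4 * c ^ 3 - 3 * c ^ 2 + 3 * c + 1) = 0"
    by (simp add: numeral_eq_Suc algebra_simps)
  moreover have "c \<noteq> 2" using c by auto
  ultimately have quint: "c ^ 5 + c ^ 4 - 4 * c ^ 3 - 3 * c ^ 2 + 3 * c + 1 = 0" by simp
  note c3 = cube_of_quadratic[OF pq(3)]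
  have c4: "c ^ 4 = (p ^ 3 + 2 * p * q) * c + (p\<^sup>2 + q) * q"
  proof -
    have "c ^ 4 = c * c ^ 3" by (simp add: numeral_eq_Suc)
    also have "\<dots> = (p\<^sup>2 + q) * c\<^sup>2 + p * q * c" unfolding c3 by (simp add: power2_eq_square algebra_simps)
    finally show ?thesis unfolding pq(3) by (simp add: numeral_eq_Suc algebra_simps)
  qed
  have c5: "c ^ 5 = (p ^ 4 + 3 * p\<^sup>2 * q + q\<^sup>2) * c + (p ^ 3 + 2 * p * q) * q"
  proof -
    have "c ^ 5 = c * c ^ 4" by (simp add: numeral_eq_Suc)
    also have "\<dots> = (p ^ 3 + 2 * p * q) * c\<^sup>2 + (p\<^sup>2 + q) * q * c"
      unfolding c4 by (simp add: power2_eq_square algebra_simps)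
    finally show ?thesis unfolding pq(3) by (simp add: numeral_eq_Suc algebra_simps)
  qed
  define a where "a = p ^ 4 + 3 * p\<^sup>2 * q + q\<^sup>2 + p ^ 3 + 2 * p * q - 4 * (p\<^sup>2 + q) - 3 * p + 3"
  define b where "b = (p ^ 3 + 2 * p * q) * q + (p\<^sup>2 + q) * q - 4 * p * q - 3 * q + 1"
  have "a * c + b = 0"
    using quint unfolding c3 c4 c5 pq(3) by (simp add: a_def b_def algebra_simps)
  moreover have "a \<in> \<rat>" "b \<in> \<rat>" using pq by (auto simp: a_def b_def)
  ultimately have "a = 0" "b = 0" using rational_linear_relation[OF c] by auto
  then have "real_of_int (P ^ 4 + 3 * P\<^sup>2 * Q + Q\<^sup>2 + P ^ 3 + 2 * P * Q - 4 * (P\<^sup>2 + Q) - 3 * P + 3) = of_int 0"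
    "real_of_int ((P ^ 3 + 2 * P * Q) * Q + (P\<^sup>2 + Q) * Q - 4 * P * Q - 3 * Q + 1) = of_int 0"
    by (simp_all add: P Q a_def b_def)
  then have "P ^ 4 + 3 * P\<^sup>2 * Q + Q\<^sup>2 + P ^ 3 + 2 * P * Q - 4 * (P\<^sup>2 + Q) - 3 * P + 3 = 0"
    "(P ^ 3 + 2 * P * Q) * Q + (P\<^sup>2 + Q) * Q - 4 * P * Q - 3 * Q + 1 = 0"
    by (simp_all only: of_int_eq_iff)
  then have "even (P ^ 4 + 3 * P\<^sup>2 * Q + Q\<^sup>2 + P ^ 3 + 2 * P * Q - 4 * (P\<^sup>2 + Q) - 3 * P + 3)"
    "even ((P ^ 3 + 2 * P * Q) * Q + (P\<^sup>2 + Q) * Q - 4 * P * Q - 3 * Q + 1)" by simp_all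
  then show False by auto
qed

subsection \<open>Eigenfunctions of Cayley graphs\<close>

text \<open>Eigenvectors as functions on the group, free of the enumeration in
  \<open>adjacency_matrix\<close>. Functions are total, so the nonzero value must be demanded on the
  carrier.\<close>

definition Cay_eigenvalue :: "('a, 'b) monoid_scheme \<Rightarrow> 'a set \<Rightarrow> complex \<Rightarrow> bool" where
  "Cay_eigenvalue G S l \<longleftrightarrow> (\<exists>f. (\<exists>g\<in>carrier G. f g \<noteq> 0) \<and>
     (\<forall>g\<in>carrier G. (\<Sum>s\<in>S. f (s \<otimes>\<^bsub>G\<^esub> g)) = l * f g))"

lemma (in group) sum_Cay_row:
  fixes f :: "'a \<Rightarrow> complex"
  assumes "finite (carrier G)" "S \<subseteq> carrier G" "g \<in> carrier G"
  shows "(\<Sum>h\<in>carrier G. (if h \<otimes> inv g \<in> S then 1 else 0) * f h) = (\<Sum>s\<in>S. f (s \<otimes> g))"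
proof -
  have "(\<Sum>h\<in>carrier G. (if h \<otimes> inv g \<in> S then 1 else 0) * f h)
      = (\<Sum>h\<in>{h \<in> carrier G. h \<otimes> inv g \<in> S}. f h)"
    using assms(1) by (intro sum.mono_neutral_cong_right) auto
  also have "\<dots> = (\<Sum>s\<in>S. f (s \<otimes> g))"
    using assms(2,3)
    by (intro sum.reindex_bij_witness[of _ "\<lambda>s. s \<otimes> g" "\<lambda>h. h \<otimes> inv g"])
       (auto simp: m_assoc)
  finally show ?thesis .
qed

text \<open>The enumeration \<open>e\<close> identifies vectors with functions on the group. The row
  of \<open>g\<close> runs over the \<open>h\<close> with \<open>h \<otimes> inv g \<in> S\<close>,
  that is, over \<open>s \<otimes> g\<close> with \<open>s \<in> S\<close>.\<close>

lemma (in group) spectrum_Cay_iff: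
  assumes fin: "finite (carrier G)" and S: "S \<subseteq> carrier G"
  shows "l \<in> spectrum (adjacency_matrix (Cay G S)) \<longleftrightarrow> Cay_eigenvalue G S l"
proof -
  define n where "n = card (carrier G)"
  define e where "e = from_nat_into (carrier G)"
  define A where "A = adjacency_matrix (Cay G S)"
  have bij: "bij_betw e {..<n} (carrier G)"
    unfolding e_def n_def using fin by (rule bij_betw_from_nat_into_finite)
  have e: "e i \<in> carrier G" if "i < n" for i
    using bij that by (auto simp: bij_betw_def)
  have ex_e: "\<exists>j<n. g = e j" if "g \<in> carrier G" for g
  proof -
    have "g \<in> e ` {..<n}" using bij that by (simp add: bij_betw_def)
    then show ?thesis by blast
  qed
  have dim: "dim_row A = n" "dim_col A = n"
    by (simp_all add: A_def adjacency_matrix_def Cay_def n_def)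
  have Av: "(A *\<^sub>v v) $ i = (\<Sum>s\<in>S. f (s \<otimes> e i))"
    if v: "v \<in> carrier_vec n" "\<And>j. j < n \<Longrightarrow> f (e j) = v $ j" and i: "i < n"
    for v :: "complex vec" and f i
  proof -
    have "(A *\<^sub>v v) $ i = (\<Sum>j<n. (if e j \<otimes> inv (e i) \<in> S then 1 else 0) * f (e j))"
      using v i e dim
      by (auto simp: A_def adjacency_matrix_def Cay_def n_def[symmetric] e_def[symmetric]
          scalar_prod_def atLeast0LessThan intro!: sum.cong)
    also have "\<dots> = (\<Sum>h\<in>carrier G. (if h \<otimes> inv (e i) \<in> S then 1 else 0) * f h)"
      by (rule sum.reindex_bij_betw[OF bij])
    finally show ?thesis using sum_Cay_row[OF fin S e[OF i]] by simp
  qed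
  have "eigenvalue A l \<longleftrightarrow> Cay_eigenvalue G S l"
  proof
    assume "eigenvalue A l"
    then obtain v :: "complex vec" where v: "v \<in> carrier_vec n" "v \<noteq> 0\<^sub>v n" "A *\<^sub>v v = l \<cdot>\<^sub>v v"
      by (auto simp: eigenvalue_def eigenvector_def dim)
    define f where "f = (\<lambda>g. v $ the_inv_into {..<n} e g)"
    have fe: "f (e j) = v $ j" if "j < n" for j
      using that bij by (simp add: f_def bij_betw_def the_inv_into_f_f)
    obtain i where i: "i < n" "v $ i \<noteq> 0"
      using v(1,2) by (metis carrier_vecD eq_vecI index_zero_vec)
    have "(\<Sum>s\<in>S. f (s \<otimes> g)) = l * f g" if g: "g \<in> carrier G" for g
    proof -
      obtain j where j: "j < n" "g = e j" using ex_e[OF g] by blast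
      have "(A *\<^sub>v v) $ j = l * v $ j" using v j by simp
      then show ?thesis using Av[of v f j] fe v j by simp
    qed
    moreover have "f (e i) \<noteq> 0" using i fe by simp
    ultimately show "Cay_eigenvalue G S l"
      unfolding Cay_eigenvalue_def using e[OF i(1)] by blast
  next
    assume "Cay_eigenvalue G S l"
    then obtain f g where f: "g \<in> carrier G" "f g \<noteq> 0"
      "\<And>g. g \<in> carrier G \<Longrightarrow> (\<Sum>s\<in>S. f (s \<otimes> g)) = l * f g"
      unfolding Cay_eigenvalue_def by blast
    define v where "v = vec n (\<lambda>i. f (e i))"
    have v: "v \<in> carrier_vec n" by (simp add: v_def)
    obtain j where j: "j < n" "g = e j" using ex_e[OF f(1)] by blast
    then have "v $ j \<noteq> 0" using f(2) by (simp add: v_def)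
    then have "v \<noteq> 0\<^sub>v n" using j by auto
    moreover have "A *\<^sub>v v = l \<cdot>\<^sub>v v"
    proof (rule eq_vecI)
      fix i assume "i < dim_vec (l \<cdot>\<^sub>v v)"
      then have i: "i < n" using v by simp
      show "(A *\<^sub>v v) $ i = (l \<cdot>\<^sub>v v) $ i"
        using Av[OF v _ i, of f] f(3)[OF e[OF i]] i by (simp add: v_def)
    qed (use v dim in auto)
    ultimately show "eigenvalue A l"
      using v by (auto simp: eigenvalue_def eigenvector_def dim)
  qed
  then show ?thesis by (simp add: spectrum_def A_def)
qed

lemma (in group) Cay_eigenvalue_quadratic:
  assumes "finite (carrier G)" "S \<subseteq> carrier G" "two_integral (Cay G S)" "Cay_eigenvalue G S l"
  shows "\<exists>p\<in>\<rat>. \<exists>q\<in>\<rat>. l\<^sup>2 = p * l + q"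
  using assms(4) by (intro two_integral_quadratic[OF assms(3)]) (simp add: spectrum_Cay_iff[OF assms(1,2)])

lemma (in group) Cay_irrational_eigenvalue:
  assumes "finite (carrier G)" "S \<subseteq> carrier G" "two_integral (Cay G S)"
  obtains l where "Cay_eigenvalue G S l" "l \<notin> \<rat>"
proof -
  obtain l where "l \<in> spectrum (adjacency_matrix (Cay G S))" "l \<notin> \<rat>"
    using two_integral_imp_irrational[OF assms(3)] by blast
  then show thesis using that[of l] spectrum_Cay_iff[OF assms(1,2), of l] by simp
qed

lemma (in group) Cay_two_integralI:
  assumes "finite (carrier G)" "S \<subseteq> carrier G"
    "\<And>l. Cay_eigenvalue G S l \<Longrightarrow> l \<in> Q_sqrt5" "Cay_eigenvalue G S l" "l \<notin> \<rat>"
  shows "two_integral (Cay G S)"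
proof (rule two_integralI)
  show "spectrum (adjacency_matrix (Cay G S)) \<subseteq> Q_sqrt5"
    using assms(3) by (simp add: spectrum_Cay_iff[OF assms(1,2)] subset_iff)
  show "l \<in> spectrum (adjacency_matrix (Cay G S))"
    using assms(4) by (simp add: spectrum_Cay_iff[OF assms(1,2)])
qed (rule assms(5))

text \<open>Needed when \<open>S\<close> contains elements that invert those defining
  \<open>f\<close>: the operator itself then moves \<open>f\<close> to another eigenspace and only
  its square acts by a scalar.\<close>

lemma (in group) Cay_eigenvalue_of_square:
  assumes S: "S \<subseteq> carrier G" and g: "g \<in> carrier G" "f g \<noteq> 0"
    and f: "\<And>g. g \<in> carrier G \<Longrightarrow> (\<Sum>s\<in>S. \<Sum>s'\<in>S. f (s' \<otimes> (s \<otimes> g))) = m\<^sup>2 * f g"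
  shows "Cay_eigenvalue G S m \<or> Cay_eigenvalue G S (- m)"
proof -
  \<comment> \<open>\<open>(A - m) (A + m) f = 0\<close>, so \<open>(A + m) f\<close> is an eigenfunction unless it vanishes.\<close>
  define h where "h g = (\<Sum>s\<in>S. f (s \<otimes> g))" for g
  have h: "(\<Sum>s\<in>S. h (s \<otimes> g)) = m\<^sup>2 * f g" if "g \<in> carrier G" for g
    using f[OF that] by (simp add: h_def)
  show ?thesis
  proof (cases "\<exists>g\<in>carrier G. h g + m * f g \<noteq> 0")
    case True
    have "(\<Sum>s\<in>S. h (s \<otimes> g) + m * f (s \<otimes> g)) = m * (h g + m * f g)" if g: "g \<in> carrier G" for g
    proof -
      have "(\<Sum>s\<in>S. h (s \<otimes> g) + m * f (s \<otimes> g)) = m\<^sup>2 * f g + m * h g"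
        unfolding sum.distrib sum_distrib_left[symmetric] h[OF g] by (simp add: h_def)
      then show ?thesis by (simp add: algebra_simps power2_eq_square)
    qed
    with True show ?thesis
      unfolding Cay_eigenvalue_def by (intro disjI1 exI[of _ "\<lambda>g. h g + m * f g"]) auto
  next
    case False
    then have "h g = - m * f g" if "g \<in> carrier G" for g
      using that by (simp add: add_eq_0_iff2)
    then show ?thesis
      unfolding Cay_eigenvalue_def h_def using g by blast
  qed
qed

text \<open>The projection, up to a factor, to the \<open>z\<close>-eigenspace of translation by an element \<open>a\<close> with
  \<open>a\<^sup>n = 1\<close>.\<close>

definition twist :: "('a, 'b) monoid_scheme \<Rightarrow> 'a \<Rightarrow> nat \<Rightarrow> complex \<Rightarrow> ('a \<Rightarrow> complex) \<Rightarrow> 'a \<Rightarrow> complex"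
  where "twist G a n z f g = (\<Sum>j<n. z ^ j * f (inv\<^bsub>G\<^esub> a [^]\<^bsub>G\<^esub> j \<otimes>\<^bsub>G\<^esub> g))"

text \<open>Translation by \<open>a\<close> shifts the summation index by one. The sum is cyclic
  because \<open>a [^] n = \<one>\<close> and \<open>z ^ n = 1\<close> make the last term agree with
  the first.\<close>

lemma (in group) twist_mult:
  assumes a: "a \<in> carrier G" "a [^] n = \<one>" and z: "z ^ n = 1" and g: "g \<in> carrier G"
  shows "twist G a n z f (a \<otimes> g) = z * twist G a n z f g"
proof (cases n)
  case 0
  then show ?thesis by (simp add: twist_def)
next
  case (Suc m)
  define h where "h j = z ^ j * f (inv a [^] j \<otimes> (a \<otimes> g))" for j
  have inv_n: "inv a [^] n = \<one>" using a by (simp add: nat_pow_inv)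
  have "h n = h 0" by (simp add: h_def z inv_n)
  have hS: "h (Suc j) = z * (z ^ j * f (inv a [^] j \<otimes> g))" for j
  proof -
    have "inv a \<otimes> (a \<otimes> g) = g" using a g by (simp add: m_assoc[symmetric])
    then have "inv a [^] Suc j \<otimes> (a \<otimes> g) = inv a [^] j \<otimes> g"
      using a g by (simp add: m_assoc)
    then show ?thesis unfolding h_def by simp
  qed
  have "twist G a n z f (a \<otimes> g) = (\<Sum>j<n. h j)" by (simp add: twist_def h_def)
  also have "\<dots> = (\<Sum>j<n. h (Suc j))"
  proof -
    have "(\<Sum>j<Suc m. h j) = h 0 + (\<Sum>j<m. h (Suc j))" by (rule sum.lessThan_Suc_shift)
    also have "\<dots> = (\<Sum>j<Suc m. h (Suc j))"
      using \<open>h n = h 0\<close> by (simp only: sum.lessThan_Suc Suc add.commute)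
    finally show ?thesis by (simp only: Suc)
  qed
  also have "\<dots> = z * twist G a n z f g"
    by (simp add: hS twist_def sum_distrib_left)
  finally show ?thesis .
qed

lemma (in group) commute_inv:
  assumes "a \<in> carrier G" "b \<in> carrier G" "a \<otimes> b = b \<otimes> a"
  shows "inv a \<otimes> b = b \<otimes> inv a"
proof -
  have "inv a \<otimes> b = inv a \<otimes> (b \<otimes> a) \<otimes> inv a" using assms(1,2) by (simp add: m_assoc)
  also have "\<dots> = (inv a \<otimes> a) \<otimes> b \<otimes> inv a"
    unfolding assms(3)[symmetric] using assms(1,2) by (simp only: m_assoc m_closed inv_closed)
  finally show ?thesis using assms(1,2) by simp
qed

lemma (in group) twist_commute:
  assumes "a \<in> carrier G" "b \<in> carrier G" "a \<otimes> b = b \<otimes> a" "g \<in> carrier G"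
    and f: "\<And>g. g \<in> carrier G \<Longrightarrow> f (b \<otimes> g) = w * f g"
  shows "twist G a n z f (b \<otimes> g) = w * twist G a n z f g"
proof -
  note c = commute_inv[OF assms(1-3)]
  have "inv a [^] j \<otimes> b = b \<otimes> inv a [^] j" for j :: nat
    using group_commutes_pow[OF c] assms(1,2) by simp
  then have "inv a [^] j \<otimes> (b \<otimes> g) = b \<otimes> (inv a [^] j \<otimes> g)" for j :: nat
    using assms(1,2,4) by (metis inv_closed m_assoc nat_pow_closed)
  then show ?thesis
    unfolding twist_def sum_distrib_left
    using assms(1,4) f by (intro sum.cong refl) (simp add: mult.left_commute)
qed

lemma (in group) translate_inv_eigen:
  fixes f :: "'a \<Rightarrow> complex"
  assumes a: "a \<in> carrier G" and f: "\<And>g. g \<in> carrier G \<Longrightarrow> f (a \<otimes> g) = z * f g"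
    and z: "z \<noteq> 0" and g: "g \<in> carrier G"
  shows "f (inv a \<otimes> g) = inverse z * f g"
proof -
  have "f g = z * f (inv a \<otimes> g)"
  proof -
    have "a \<otimes> (inv a \<otimes> g) = g" using a g by (simp add: m_assoc[symmetric])
    then show ?thesis using f[of "inv a \<otimes> g"] a g by (simp only: inv_closed m_closed)
  qed
  then show ?thesis using z by simp
qed

text \<open>Both projections are applied to the indicator function of \<open>\<one>\<close>. By
  \<open>indep\<close> only the term with both exponents zero survives at \<open>\<one>\<close>, so
  the result takes the value 1 there and is not the zero function.\<close>

lemma (in group) exists_joint_eigenfunction:
  fixes z w :: complex and m n :: nat
  assumes a: "a \<in> carrier G" "a [^] m = \<one>" "z ^ m = 1" "m > 0"
    and b: "b \<in> carrier G" "b [^] n = \<one>" "w ^ n = 1" "n > 0"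
    and comm: "a \<otimes> b = b \<otimes> a"
    and indep: "\<And>i j. i < m \<Longrightarrow> j < n \<Longrightarrow> a [^] i \<otimes> b [^] j = \<one> \<Longrightarrow> i = 0 \<and> j = 0"
  shows "\<exists>f :: 'a \<Rightarrow> complex. f \<one> \<noteq> 0 \<and> (\<forall>g\<in>carrier G. f (a \<otimes> g) = z * f g) \<and>
    (\<forall>g\<in>carrier G. f (b \<otimes> g) = w * f g)"
proof -
  define d :: "'a \<Rightarrow> complex" where "d g = (if g = \<one> then 1 else 0)" for g
  define f where "f = twist G a m z (twist G b n w d)"
  have "f (a \<otimes> g) = z * f g" if "g \<in> carrier G" for g
    unfolding f_def using a that by (intro twist_mult) auto
  moreover have "f (b \<otimes> g) = w * f g" if g: "g \<in> carrier G" for g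
    unfolding f_def by (rule twist_commute[OF a(1) b(1) comm g]) (rule twist_mult[OF b(1-3)])
  moreover have "f \<one> = 1"
  proof -
    have zero: "d (inv b [^] j \<otimes> (inv a [^] i \<otimes> \<one>)) = (if j = 0 \<and> i = 0 then 1 else 0)"
      if ij: "i < m" "j < n" for i j :: nat
    proof -
      have "inv b [^] j \<otimes> (inv a [^] i \<otimes> \<one>) = inv (a [^] i \<otimes> b [^] j)"
        using a(1) b(1) by (simp add: inv_mult_group nat_pow_inv)
      moreover have "inv (a [^] i \<otimes> b [^] j) = \<one> \<longleftrightarrow> a [^] i \<otimes> b [^] j = \<one>"
        using a(1) b(1) by (simp add: inv_eq_1_iff)
      moreover have "a [^] i \<otimes> b [^] j = \<one> \<longleftrightarrow> j = 0 \<and> i = 0"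
        using indep[OF ij] by auto
      ultimately show ?thesis by (simp add: d_def)
    qed
    have "f \<one> = (\<Sum>i<m. \<Sum>j<n. z ^ i * (w ^ j * (if j = 0 \<and> i = 0 then 1 else 0)))"
      unfolding f_def twist_def sum_distrib_left by (intro sum.cong refl) (simp add: zero)
    also have "\<dots> = (\<Sum>i<m. if i = 0 then 1 else 0)"
    proof (rule sum.cong[OF refl])
      fix i
      have "(\<Sum>j<n. z ^ i * (w ^ j * (if j = 0 \<and> i = 0 then 1 else 0)))
          = (\<Sum>j<n. if j = 0 then (if i = 0 then 1 else 0) else 0)"
        by (rule sum.cong) auto
      then show "(\<Sum>j<n. z ^ i * (w ^ j * (if j = 0 \<and> i = 0 then 1 else 0))) = (if i = 0 then 1 else 0)"
        using b(4) by simp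
    qed
    also have "\<dots> = 1" using a(4) by simp
    finally show ?thesis .
  qed
  ultimately show ?thesis by (intro exI[of _ f]) auto
qed

lemma (in group) exists_eigenfunction:
  fixes z :: complex
  assumes a: "a \<in> carrier G" "ord a > 0" "z ^ ord a = 1"
  shows "\<exists>f :: 'a \<Rightarrow> complex. f \<one> \<noteq> 0 \<and> (\<forall>g\<in>carrier G. f (a \<otimes> g) = z * f g)"
proof -
  have "i = 0" if "i < ord a" "a [^] i = \<one>" for i
    using that a(1) pow_eq_id[of a i] by (auto dest: dvd_imp_le)
  then show ?thesis
    using exists_joint_eigenfunction[of a "ord a" z \<one> 1 1] a by auto
qed

lemma (in group) Cay_eigenvalue_cycle:
  assumes a: "a \<in> carrier G" "a \<noteq> inv a" "ord a > 0"
  shows "Cay_eigenvalue G {a, inv a} (of_real (2 * cos (2 * pi / real (ord a))))"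
proof -
  define z where "z = cis (2 * pi / real (ord a))"
  have z1: "z ^ ord a = 1" using a(3) by (simp add: z_def DeMoivre)
  have z0: "z \<noteq> 0" by (simp add: z_def)
  have zz: "z + inverse z = of_real (2 * cos (2 * pi / real (ord a)))"
    by (simp add: z_def complex_eq_iff)
  obtain f :: "'a \<Rightarrow> complex" where f: "f \<one> \<noteq> 0" "\<And>g. g \<in> carrier G \<Longrightarrow> f (a \<otimes> g) = z * f g"
    using exists_eigenfunction[OF a(1,3) z1] by blast
  have "f (inv a \<otimes> g) = inverse z * f g" if "g \<in> carrier G" for g
    by (rule translate_inv_eigen[OF a(1) _ z0 that]) (rule f(2))
  then have "(\<Sum>s\<in>{a, inv a}. f (s \<otimes> g)) = (z + inverse z) * f g" if "g \<in> carrier G" for g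
    using that a(2) f(2) by (simp add: distrib_right)
  then show ?thesis unfolding zz Cay_eigenvalue_def using f(1) by blast
qed

text \<open>The two-sided translates obey the recurrence of \<open>cheb\<close>. Hence
  \<open>a [^] n = \<one>\<close> becomes the equation \<open>cheb l n = 2\<close>, without
  diagonalising translation by \<open>a\<close>.\<close>

lemma (in group) translate_cheb:
  fixes f :: "'a \<Rightarrow> complex"
  assumes a: "a \<in> carrier G"
    and f: "\<And>g. g \<in> carrier G \<Longrightarrow> f (a \<otimes> g) + f (inv a \<otimes> g) = l * f g"
    and g: "g \<in> carrier G"
  shows "f (a [^] k \<otimes> g) + f (inv a [^] k \<otimes> g) = cheb l k * f g"
proof (induction k rule: induct_nat_012)
  case (ge2 k)
  have 1: "f (a [^] Suc (Suc k) \<otimes> g) + f (a [^] k \<otimes> g) = l * f (a [^] Suc k \<otimes> g)"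
  proof -
    have "a \<otimes> (a [^] Suc k \<otimes> g) = a [^] Suc (Suc k) \<otimes> g"
      using a g by (metis m_assoc nat_pow_Suc2 nat_pow_closed)
    moreover have "inv a \<otimes> (a [^] Suc k \<otimes> g) = a [^] k \<otimes> g"
      unfolding nat_pow_Suc2[OF a] using a g by (simp add: m_assoc[symmetric])
    ultimately show ?thesis using f[of "a [^] Suc k \<otimes> g"] a g by simp
  qed
  have 2: "f (inv a [^] Suc (Suc k) \<otimes> g) + f (inv a [^] k \<otimes> g) = l * f (inv a [^] Suc k \<otimes> g)"
  proof -
    have "inv a \<otimes> (inv a [^] Suc k \<otimes> g) = inv a [^] Suc (Suc k) \<otimes> g"
      using a g by (metis inv_closed m_assoc nat_pow_Suc2 nat_pow_closed)
    moreover have "a \<otimes> (inv a [^] Suc k \<otimes> g) = inv a [^] k \<otimes> g"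
      unfolding nat_pow_Suc2[OF inv_closed[OF a]] using a g by (simp add: m_assoc[symmetric])
    ultimately show ?thesis using f[of "inv a [^] Suc k \<otimes> g"] a g by (simp add: add.commute)
  qed
  have "f (a [^] Suc (Suc k) \<otimes> g) + f (inv a [^] Suc (Suc k) \<otimes> g) =
      l * (f (a [^] Suc k \<otimes> g) + f (inv a [^] Suc k \<otimes> g)) - (f (a [^] k \<otimes> g) + f (inv a [^] k \<otimes> g))"
    unfolding distrib_left 1[symmetric] 2[symmetric] by simp
  also have "\<dots> = l * (cheb l (Suc k) * f g) - cheb l k * f g" by (simp only: ge2)
  finally show ?case by (simp add: algebra_simps)
qed (use a f g in auto)

lemma cheb_add_inverse:
  fixes z :: complex
  assumes "z \<noteq> 0"
  shows "cheb (z + inverse z) k = z ^ k + inverse z ^ k"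
proof (induction k rule: induct_nat_012)
  case (ge2 k)
  have c: "z * (inverse z * y) = y" for y using assms by (simp add: mult.assoc[symmetric])
  have "(z + inverse z) * (z ^ Suc k + inverse z ^ Suc k) =
      z ^ Suc (Suc k) + inverse z ^ Suc (Suc k) + (z ^ k + inverse z ^ k)"
    by (simp add: algebra_simps c)
  with ge2 show ?case by simp
qed auto

text \<open>Write l = z + 1/z. Then z^n + 1/z^n = 2 says (z^n - 1)^2 = 0, so z is a root of unity
  and l a cosine value. Expressing it through \<open>cheb\<close> shows that all these numbers are
  rational as soon as the first one is.\<close>

lemma cheb_eq_2:
  fixes l :: complex
  assumes "cheb l n = 2" "n > 0"
  shows "\<exists>k. l = of_real (cheb (2 * cos (2 * pi / real n)) k)"
proof -
  \<comment> \<open>A root of z^2 - l z + 1.\<close>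
  define z where "z = (l + csqrt (l\<^sup>2 - 4)) / 2"
  have "(2 * z - l)\<^sup>2 = l\<^sup>2 - 4" by (simp add: z_def)
  then have "4 * (z * z + 1) = 4 * (l * z)" by (simp add: power2_eq_square algebra_simps)
  then have zz: "z * z + 1 = l * z" by (simp only: mult_cancel_left) simp
  then have z0: "z \<noteq> 0" by auto
  have l: "l = z + inverse z" using zz z0 by (simp add: field_simps)
  have "(z ^ n - 1)\<^sup>2 = 0"
  proof -
    have "z ^ n + inverse z ^ n = 2" using assms(1) cheb_add_inverse[OF z0] l by simp
    then have "z ^ n * (z ^ n + inverse z ^ n) = 2 * z ^ n" by simp
    moreover have "z ^ n * inverse z ^ n = 1" using z0 by (simp add: power_mult_distrib[symmetric])
    ultimately show ?thesis by (simp add: power2_eq_square algebra_simps)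
  qed
  then have "z ^ n = 1" by simp
  then obtain k where k: "z = cis (2 * pi * real k / real n)"
    using bij_betw_roots_unity[OF assms(2)] unfolding bij_betw_def by blast
  have "l = of_real (2 * cos (real k * (2 * pi / real n)))"
    unfolding l k by (simp add: complex_eq_iff ac_simps)
  then show ?thesis unfolding cheb_cos[symmetric] by blast
qed

lemma complex_Rats_eq_of_real:
  assumes "(p :: complex) \<in> \<rat>"
  obtains r :: real where "r \<in> \<rat>" "p = of_real r"
proof -
  obtain a b where ab: "p = of_int a / of_int b" using assms by (auto elim: Rats_cases')
  show thesis by (rule that[of "of_int a / of_int b"]) (auto simp: ab)
qed

text \<open>Every eigenvalue is a \<open>cheb\<close> value at \<open>c\<close>, so a rational
  \<open>c\<close> would make the whole spectrum rational. This excludes orders 3 and 4, where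
  \<open>c\<close> is -1 and 0; the other exclusions apply to a quadratic irrational
  \<open>c\<close>.\<close>

lemma (in group) two_integral_cycle:
  assumes fin: "finite (carrier G)" and a: "a \<in> carrier G" "a \<noteq> inv a"
    and two: "two_integral (Cay G {a, inv a})"
  shows "ord a \<le> 12" "ord a \<noteq> 3" "ord a \<noteq> 4" "ord a \<noteq> 7" "ord a \<noteq> 11"
proof -
  define n where "n = ord a"
  define c where "c = 2 * cos (2 * pi / real n)"
  have n: "n > 0" unfolding n_def using ord_ge_1[OF fin a(1)] by simp
  have sub: "{a, inv a} \<subseteq> carrier G" using a by simp
  have "c \<notin> \<rat>"
  proof
    assume c: "c \<in> \<rat>"
    obtain l where l: "Cay_eigenvalue G {a, inv a} l" "l \<notin> \<rat>"
      using Cay_irrational_eigenvalue[OF fin sub two] .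
    then obtain f g where f: "g \<in> carrier G" "f g \<noteq> 0"
      "\<And>g. g \<in> carrier G \<Longrightarrow> f (a \<otimes> g) + f (inv a \<otimes> g) = l * f g"
      unfolding Cay_eigenvalue_def using a(2) by auto
    have "f (a [^] n \<otimes> g) + f (inv a [^] n \<otimes> g) = cheb l n * f g"
      using translate_cheb[OF a(1) f(3) f(1)] .
    moreover have "a [^] n = \<one>" "inv a [^] n = \<one>"
      using a(1) by (simp_all add: n_def nat_pow_inv)
    ultimately have "cheb l n = 2" using f(1,2) by simp
    then obtain k where "l = of_real (cheb c k)" using cheb_eq_2[OF _ n] c_def by auto
    moreover have "cheb c k \<in> \<rat>" using c by (rule cheb_Rats)
    ultimately have "l \<in> \<rat>" by (auto elim!: Rats_cases)
    then show False using l by simp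
  qed
  moreover have "Cay_eigenvalue G {a, inv a} (of_real c)"
    unfolding c_def n_def using Cay_eigenvalue_cycle[OF a] n n_def by simp
  then obtain p q :: complex where pq: "p \<in> \<rat>" "q \<in> \<rat>" "(of_real c)\<^sup>2 = p * of_real c + q"
    using Cay_eigenvalue_quadratic[OF fin sub two] by blast
  obtain p' q' :: real where p': "p' \<in> \<rat>" "p = of_real p'" and q': "q' \<in> \<rat>" "q = of_real q'"
    using pq by (metis complex_Rats_eq_of_real)
  have "complex_of_real (c\<^sup>2) = of_real (p' * c + q')" using pq(3) p' q' by simp
  then have eq: "c\<^sup>2 = p' * c + q'" by (simp only: of_real_eq_iff)
  \<comment> \<open>\<open>calculation\<close> still holds the irrationality of \<open>c\<close>,
    stored by \<open>moreover\<close> above.\<close>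
  note * = calculation[unfolded c_def] p'(1) q'(1) eq[unfolded c_def]
  show "ord a \<le> 12" using quadratic_cos_bound[OF n *] by (simp add: n_def)
  show "ord a \<noteq> 7" using quadratic_cos_not_7[of p' q'] * by (auto simp: n_def)
  show "ord a \<noteq> 11" using quadratic_cos_not_11[of p' q'] * by (auto simp: n_def)
  show "ord a \<noteq> 3" using *(1) cos_120 by (auto simp: n_def)
  show "ord a \<noteq> 4" using *(1) by (auto simp: n_def)
qed

subsection \<open>Connection sets without 2-integrality\<close>

lemma (in group) inverted_inv:
  assumes "x \<in> carrier G" "t \<in> carrier G" "t \<otimes> x = inv x \<otimes> t"
  shows "t \<otimes> inv x = x \<otimes> t"
proof -
  have "t \<otimes> inv x = x \<otimes> (inv x \<otimes> t) \<otimes> inv x"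
    using assms(1,2) by (simp add: m_assoc[symmetric])
  also have "\<dots> = x \<otimes> t" unfolding assms(3)[symmetric] using assms(1,2) by (simp add: m_assoc)
  finally show ?thesis .
qed

text \<open>For commuting translations S and T of square 1, (S + T)^2 - 2 = 2 S T has square 4. So
  every eigenvalue is 0, 2 or -2.\<close>

lemma (in group) not_two_integral_commuting_involutions:
  assumes fin: "finite (carrier G)" and st: "s \<in> carrier G" "t \<in> carrier G" "s \<noteq> t"
    and inv: "s \<otimes> s = \<one>" "t \<otimes> t = \<one>" "s \<otimes> t = t \<otimes> s"
  shows "\<not> two_integral (Cay G {s, t})"
proof
  assume two: "two_integral (Cay G {s, t})"
  have sub: "{s, t} \<subseteq> carrier G" using st by simp
  obtain l where l: "Cay_eigenvalue G {s, t} l" "l \<notin> \<rat>"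
    using Cay_irrational_eigenvalue[OF fin sub two] .
  then obtain f g where f: "g \<in> carrier G" "f g \<noteq> 0"
    "\<And>g. g \<in> carrier G \<Longrightarrow> f (s \<otimes> g) + f (t \<otimes> g) = l * f g"
    unfolding Cay_eigenvalue_def using st(3) by auto
  have red: "s \<otimes> (s \<otimes> g) = g" "t \<otimes> (t \<otimes> g) = g" "t \<otimes> (s \<otimes> g) = s \<otimes> (t \<otimes> g)"
    if "g \<in> carrier G" for g
    using st inv that by (simp_all add: m_assoc[symmetric])
  have sq: "2 * f (s \<otimes> (t \<otimes> g)) = (l\<^sup>2 - 2) * f g" if g: "g \<in> carrier G" for g
  proof -
    have "l * (l * f g) = l * f (s \<otimes> g) + l * f (t \<otimes> g)"
      unfolding f(3)[OF g, symmetric] by (rule distrib_left)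
    also have "l * f (s \<otimes> g) = f g + f (s \<otimes> (t \<otimes> g))"
      using f(3)[of "s \<otimes> g"] st g red[OF g] by simp
    also have "l * f (t \<otimes> g) = f (s \<otimes> (t \<otimes> g)) + f g"
      using f(3)[of "t \<otimes> g"] st g red[OF g] by simp
    finally show ?thesis by (simp add: algebra_simps power2_eq_square)
  qed
  have "s \<otimes> (t \<otimes> (s \<otimes> (t \<otimes> g))) = g"
    using red st f(1) by simp
  then have "4 * f g = (l\<^sup>2 - 2) * ((l\<^sup>2 - 2) * f g)"
    using sq[of g] sq[of "s \<otimes> (t \<otimes> g)"] st f(1) by (simp add: sq[OF f(1), symmetric])
  then have "(l\<^sup>2 - 2) * (l\<^sup>2 - 2) = 4" using f(2) by simp
  then have "l * l * ((l - 2) * (l + 2)) = 0" by (simp add: power2_eq_square algebra_simps)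
  then have "l = 0 \<or> l = 2 \<or> l = - 2" by (auto simp: add_eq_0_iff2)
  then show False using l(2) by auto
qed

lemma (in group) two_integral_eigenvalue_square:
  assumes "finite (carrier G)" "S \<subseteq> carrier G" "two_integral (Cay G S)" "Cay_eigenvalue G S l"
  shows "(l\<^sup>2 - 4)\<^sup>2 \<noteq> 5"
proof
  assume sq: "(l\<^sup>2 - 4)\<^sup>2 = 5"
  obtain p q where pq: "p \<in> \<rat>" "q \<in> \<rat>" "l\<^sup>2 = p * l + q"
    using Cay_eigenvalue_quadratic[OF assms] by blast
  define \<theta> where "\<theta> = l\<^sup>2"
  \<comment> \<open>Squaring \<open>p * l = \<theta> - q\<close> gives a linear relation for the irrational \<open>\<theta>\<close>, whose constant term is
    \<open>q\<^sup>2 - 11\<close>.\<close>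
  have t2: "\<theta> * \<theta> = 8 * \<theta> - 11" 
  proof -
    have "(\<theta> - 4)\<^sup>2 = 5" using sq by (simp add: \<theta>_def)
    then show ?thesis by (simp add: power2_eq_square algebra_simps)
  qed
  have irr: "\<theta> \<notin> \<rat>"
  proof
    assume "\<theta> \<in> \<rat>"
    then have "\<theta> - 4 \<in> \<rat>" by simp
    then show False using rational_square_neq_5[of "\<theta> - 4"] sq by (simp add: \<theta>_def)
  qed
  have "p\<^sup>2 * \<theta> = (p * l)\<^sup>2" by (simp add: \<theta>_def power_mult_distrib)
  also have "p * l = \<theta> - q" using pq(3) by (simp add: \<theta>_def)
  also have "(\<theta> - q)\<^sup>2 = \<theta> * \<theta> - 2 * q * \<theta> + q\<^sup>2" by (simp add: power2_eq_square algebra_simps)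
  finally have eq: "(p\<^sup>2 - 8 + 2 * q) * \<theta> = q\<^sup>2 - 11" by (simp add: t2 algebra_simps)
  have rat: "p\<^sup>2 - 8 + 2 * q \<in> \<rat>" "q\<^sup>2 - 11 \<in> \<rat>" using pq by auto
  have "p\<^sup>2 - 8 + 2 * q = 0"
  proof (rule ccontr)
    assume "p\<^sup>2 - 8 + 2 * q \<noteq> 0"
    then have "\<theta> = (q\<^sup>2 - 11) / (p\<^sup>2 - 8 + 2 * q)" using eq by (simp add: field_simps)
    then show False using irr Rats_divide[OF rat(2,1)] by simp
  qed
  then have "q\<^sup>2 = of_nat 11" using eq by simp
  then obtain m :: nat where m: "m\<^sup>2 = 11" using rational_square_root_of_nat[OF pq(2)] by blast
  then have "m < 4" using power_mono[of 4 m 2] by (cases "m < 4") simp_all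
  then consider "m = 0" | "m = 1" | "m = 2" | "m = 3" by linarith
  then show False using m by cases simp_all
qed

lemma (in group) pow_mod_exponent:
  assumes "a \<in> carrier G" "a [^] (n::nat) = \<one>"
  shows "a [^] (k::nat) = a [^] (k mod n)"
proof -
  have "a [^] k = a [^] (n * (k div n) + k mod n)" by simp
  also have "\<dots> = a [^] (k mod n)"
    using assms by (simp only: nat_pow_mult[symmetric] nat_pow_pow[symmetric] nat_pow_one l_one nat_pow_closed)
  finally show ?thesis .
qed

text \<open>Nonzero exponents are invertible modulo 5: by Fermat, raising to the power
  \<open>j ^ 3\<close> undoes raising to the power \<open>j\<close>. A relation involving
  \<open>b\<close> would thus make \<open>b\<close> a power of \<open>a\<close>.\<close>

lemma (in group) independent_order_5:
  assumes a: "a \<in> carrier G" "a [^] (5::nat) = \<one>" "a \<noteq> \<one>"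
    and b: "b \<in> carrier G" "b [^] (5::nat) = \<one>" "\<And>k::nat. b \<noteq> a [^] k"
    and ij: "i < 5" "j < 5" "a [^] (i::nat) \<otimes> b [^] (j::nat) = \<one>"
  shows "i = 0 \<and> j = 0"
proof -
  have root: "c [^] (j * j ^ 3) = c" if "c \<in> carrier G" "c [^] (5::nat) = \<one>" "0 < j" "j < 5"
    for c and j :: nat
  proof -
    have "j = 1 \<or> j = 2 \<or> j = 3 \<or> j = 4" using that by auto
    then have "j * j ^ 3 mod 5 = 1" by auto
    then show ?thesis using pow_mod_exponent[OF that(1,2), of "j * j ^ 3"] that(1) by simp
  qed
  have j: "j = 0"
  proof (rule ccontr)
    assume "j \<noteq> 0"
    have "a [^] i \<otimes> a [^] (5 - i) = \<one>"
      using ij(1) a by (simp add: nat_pow_mult)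
    then have "b [^] j = a [^] (5 - i)"
      using ij(3) a(1) b(1) by (metis l_cancel nat_pow_closed)
    then have "b [^] (j * j ^ 3) = a [^] ((5 - i) * j ^ 3)"
      using a(1) b(1) by (simp add: nat_pow_pow[symmetric])
    then show False using root[OF b(1,2) _ ij(2)] b(3) \<open>j \<noteq> 0\<close> by simp
  qed
  moreover have "i = 0"
  proof (rule ccontr)
    assume "i \<noteq> 0"
    moreover have "a [^] (i * i ^ 3) = \<one>"
      using ij(3) j a(1) by (simp add: nat_pow_pow[symmetric])
    ultimately show False using root[OF a(1,2) _ ij(1)] a(3) by simp
  qed
  ultimately show ?thesis by simp
qed

text \<open>For a primitive fifth root of unity, dividing z^4 + z^3 + z^2 + z + 1 = 0 by z^2 gives
  w^2 + w - 1 = 0 for w = z + 1/z.\<close>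

lemma golden_root:
  obtains z :: complex where "z ^ 5 = 1" "z \<noteq> 0" "(z + inverse z)\<^sup>2 = 1 - (z + inverse z)"
proof -
  define z where "z = cis (2 * pi / 5)"
  have z5: "z ^ 5 = 1" by (simp add: z_def DeMoivre)
  have z0: "z \<noteq> 0" by (simp add: z_def)
  have "z \<noteq> 1"
  proof
    assume "z = 1"
    then have "sin (2 * pi / 5) = 0" by (simp add: z_def complex_eq_iff)
    moreover have "sin (2 * pi / 5) > 0" by (rule sin_gt_zero) auto
    ultimately show False by simp
  qed
  moreover have "(z - 1) * (z ^ 4 + z ^ 3 + z ^ 2 + z + 1) = 0"
    using z5 by (simp add: numeral_eq_Suc algebra_simps)
  ultimately have "z ^ 4 + z ^ 3 + z ^ 2 + z + 1 = 0" by simp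
  then have "z ^ 2 * ((z + inverse z)\<^sup>2 - (1 - (z + inverse z))) = 0"
  proof -
    have zw: "z * (z + inverse z) = z ^ 2 + 1" using z0 by (simp add: distrib_left power2_eq_square)
    have "z ^ 2 * ((z + inverse z)\<^sup>2 - (1 - (z + inverse z))) =
        (z * (z + inverse z))\<^sup>2 - z ^ 2 + z * (z * (z + inverse z))"
      by (simp only: power2_eq_square right_diff_distrib mult.assoc mult.left_commute mult_1_right) simp
    also have "\<dots> = z ^ 4 + z ^ 3 + z ^ 2 + z + 1"
      unfolding zw by (simp add: numeral_eq_Suc algebra_simps)
    finally show ?thesis using \<open>z ^ 4 + z ^ 3 + z ^ 2 + z + 1 = 0\<close> by simp
  qed
  then have "(z + inverse z)\<^sup>2 = 1 - (z + inverse z)" using z0 by simp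
  then show thesis using that z5 z0 by blast
qed

text \<open>Independence of \<open>a\<close> and \<open>b\<close> allows their eigenvalues to be
  prescribed separately. Choosing the same \<open>z\<close> for both makes
  \<open>inv a \<otimes> b\<close> act trivially, so all later expressions reduce to polynomials in
  z + 1/z.\<close>

lemma (in group) golden_eigenfunction_pair:
  assumes a: "a \<in> carrier G" "a [^] (5::nat) = \<one>" "a \<noteq> \<one>"
    and b: "b \<in> carrier G" "b [^] (5::nat) = \<one>" "\<And>k::nat. b \<noteq> a [^] k" and comm: "a \<otimes> b = b \<otimes> a"
  obtains f :: "'a \<Rightarrow> complex" and z where "f \<one> \<noteq> 0" "z \<noteq> 0" "(z + inverse z)\<^sup>2 = 1 - (z + inverse z)"
    "\<And>g. g \<in> carrier G \<Longrightarrow> f (a \<otimes> g) = z * f g"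
    "\<And>g. g \<in> carrier G \<Longrightarrow> f (inv a \<otimes> g) = inverse z * f g"
    "\<And>g. g \<in> carrier G \<Longrightarrow> f (b \<otimes> g) = z * f g"
    "\<And>g. g \<in> carrier G \<Longrightarrow> f (inv b \<otimes> g) = inverse z * f g"
proof -
  obtain z :: complex where z: "z ^ 5 = 1" "z \<noteq> 0" "(z + inverse z)\<^sup>2 = 1 - (z + inverse z)"
    by (rule golden_root)
  obtain f :: "'a \<Rightarrow> complex" where f: "f \<one> \<noteq> 0" "\<And>g. g \<in> carrier G \<Longrightarrow> f (a \<otimes> g) = z * f g"
    "\<And>g. g \<in> carrier G \<Longrightarrow> f (b \<otimes> g) = z * f g"
  proof -
    have "\<exists>f :: 'a \<Rightarrow> complex. f \<one> \<noteq> 0 \<and> (\<forall>g\<in>carrier G. f (a \<otimes> g) = z * f g) \<and>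
        (\<forall>g\<in>carrier G. f (b \<otimes> g) = z * f g)"
      by (rule exists_joint_eigenfunction[OF a(1,2) z(1) _ b(1,2) z(1) _ comm])
         (simp, simp, rule independent_order_5[OF a b])
    then show thesis using that by blast
  qed
  show thesis
  proof (rule that[of f z, OF f(1) z(2,3)])
    show "f (a \<otimes> g) = z * f g" "f (b \<otimes> g) = z * f g" if "g \<in> carrier G" for g
      using f that by auto
    show "f (inv a \<otimes> g) = inverse z * f g" if "g \<in> carrier G" for g
      by (rule translate_inv_eigen[OF a(1) _ z(2) that]) (rule f(2))
    show "f (inv b \<otimes> g) = inverse z * f g" if "g \<in> carrier G" for g
      by (rule translate_inv_eigen[OF b(1) _ z(2) that]) (rule f(3))
  qed
qed

text \<open>On \<open>f\<close> the square of the operator is (1 + 2z)(1 + 2/z) = 5 + 2w with w = z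
  + 1/z, since passing \<open>t\<close> inverts \<open>a\<close> and \<open>b\<close>. Subtracting 4
  leaves 1 + 2w, whose square is 5.\<close>

lemma (in group) not_two_integral_three_reflections:
  assumes fin: "finite (carrier G)"
    and a: "a \<in> carrier G" "a [^] (5::nat) = \<one>" "a \<noteq> \<one>"
    and b: "b \<in> carrier G" "b [^] (5::nat) = \<one>" "\<And>k::nat. b \<noteq> a [^] k" and comm: "a \<otimes> b = b \<otimes> a"
    and t: "t \<in> carrier G" "t \<otimes> t = \<one>" "t \<otimes> a = inv a \<otimes> t" "t \<otimes> b = inv b \<otimes> t"
  shows "\<not> two_integral (Cay G {t, t \<otimes> a, t \<otimes> b})"
proof
  assume two: "two_integral (Cay G {t, t \<otimes> a, t \<otimes> b})"
  obtain f :: "'a \<Rightarrow> complex" and z where f1: "f \<one> \<noteq> 0" and z: "z \<noteq> 0" "(z + inverse z)\<^sup>2 = 1 - (z + inverse z)"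
    and f: "\<And>g. g \<in> carrier G \<Longrightarrow> f (a \<otimes> g) = z * f g"
    "\<And>g. g \<in> carrier G \<Longrightarrow> f (inv a \<otimes> g) = inverse z * f g"
    "\<And>g. g \<in> carrier G \<Longrightarrow> f (b \<otimes> g) = z * f g"
    "\<And>g. g \<in> carrier G \<Longrightarrow> f (inv b \<otimes> g) = inverse z * f g"
    using golden_eigenfunction_pair[OF a b comm] by metis
  define m where "m = csqrt (5 + 2 * (z + inverse z))"
  have m2: "m\<^sup>2 = 5 + 2 * (z + inverse z)" by (simp add: m_def)
  have sub: "{t, t \<otimes> a, t \<otimes> b} \<subseteq> carrier G" using a b t by simp
  have ne: "t \<noteq> t \<otimes> a" "t \<noteq> t \<otimes> b" "t \<otimes> a \<noteq> t \<otimes> b"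
    using a(1,3) b(1) b(3)[of 0] b(3)[of 1] t(1) by auto
  have red: "t \<otimes> (t \<otimes> g) = g" "t \<otimes> (a \<otimes> g) = inv a \<otimes> (t \<otimes> g)" "t \<otimes> (b \<otimes> g) = inv b \<otimes> (t \<otimes> g)"
    "inv a \<otimes> (a \<otimes> g) = g" "inv b \<otimes> (b \<otimes> g) = g" "t \<otimes> (inv a \<otimes> (t \<otimes> g)) = a \<otimes> g"
    "t \<otimes> (inv b \<otimes> (t \<otimes> g)) = b \<otimes> g"
    if "g \<in> carrier G" for g
  proof -
    have tt: "t \<otimes> (t \<otimes> h) = h" if "h \<in> carrier G" for h
      using t(1,2) that by (simp add: m_assoc[symmetric])
    show "t \<otimes> (t \<otimes> g) = g" using tt that by simp
    show ta: "t \<otimes> (a \<otimes> g) = inv a \<otimes> (t \<otimes> g)" and tb: "t \<otimes> (b \<otimes> g) = inv b \<otimes> (t \<otimes> g)"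
      and "inv a \<otimes> (a \<otimes> g) = g" "inv b \<otimes> (b \<otimes> g) = g"
      using a(1) b(1) t that by (simp_all add: m_assoc[symmetric])
    show "t \<otimes> (inv a \<otimes> (t \<otimes> g)) = a \<otimes> g" "t \<otimes> (inv b \<otimes> (t \<otimes> g)) = b \<otimes> g"
      unfolding ta[symmetric] tb[symmetric] using a(1) b(1) that by (simp_all add: tt)
  qed
  have "(\<Sum>s\<in>{t, t \<otimes> a, t \<otimes> b}. \<Sum>s'\<in>{t, t \<otimes> a, t \<otimes> b}. f (s' \<otimes> (s \<otimes> g))) = m\<^sup>2 * f g"
    if g: "g \<in> carrier G" for g
  proof -
    have "(\<Sum>s\<in>{t, t \<otimes> a, t \<otimes> b}. \<Sum>s'\<in>{t, t \<otimes> a, t \<otimes> b}. f (s' \<otimes> (s \<otimes> g))) =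
      f g + f (inv a \<otimes> g) + f (inv b \<otimes> g) + (f (a \<otimes> g) + f g + f (inv b \<otimes> (a \<otimes> g)))
      + (f (b \<otimes> g) + f (inv a \<otimes> (b \<otimes> g)) + f g)"
      using ne a(1) b(1) t(1) g by (simp add: m_assoc red)
    also have "\<dots> = m\<^sup>2 * f g"
      using g a(1) b(1) z(1) by (simp add: f m2 algebra_simps)
    finally show ?thesis .
  qed
  from Cay_eigenvalue_of_square[OF sub one_closed f1 this]
  obtain l where l: "Cay_eigenvalue G {t, t \<otimes> a, t \<otimes> b} l" "l\<^sup>2 = m\<^sup>2" by auto
  have "(l\<^sup>2 - 4)\<^sup>2 = 1 + 4 * (z + inverse z) + 4 * (z + inverse z)\<^sup>2"
    unfolding l(2) m2 by (simp only: power2_eq_square) (simp add: algebra_simps)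
  also have "\<dots> = 5" unfolding z(2) by simp
  finally show False using two_integral_eigenvalue_square[OF fin sub two l(1)] by simp
qed

text \<open>Passing \<open>t\<close> inverts \<open>x\<close> but fixes \<open>y\<close>, so on
  \<open>f\<close> the square of the operator is (w + z)(w + 1/z) = 2w^2 + 1 = 3 - 2w with w = z +
  1/z. Subtracting 4 leaves -(1 + 2w), whose square is 5.\<close>

lemma (in group) not_two_integral_mixed:
  assumes fin: "finite (carrier G)"
    and x: "x \<in> carrier G" "x [^] (5::nat) = \<one>" "x \<noteq> \<one>"
    and y: "y \<in> carrier G" "y [^] (5::nat) = \<one>" "\<And>k::nat. y \<noteq> x [^] k" and comm: "x \<otimes> y = y \<otimes> x"
    and t: "t \<in> carrier G" "t \<otimes> t = \<one>" "t \<otimes> x = inv x \<otimes> t" "t \<otimes> y = y \<otimes> t"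
  shows "\<not> two_integral (Cay G {y \<otimes> t, inv y \<otimes> t, x \<otimes> t})"
proof
  assume two: "two_integral (Cay G {y \<otimes> t, inv y \<otimes> t, x \<otimes> t})"
  obtain f :: "'a \<Rightarrow> complex" and z where f1: "f \<one> \<noteq> 0" and z: "z \<noteq> 0" "(z + inverse z)\<^sup>2 = 1 - (z + inverse z)"
    and f: "\<And>g. g \<in> carrier G \<Longrightarrow> f (x \<otimes> g) = z * f g"
    "\<And>g. g \<in> carrier G \<Longrightarrow> f (inv x \<otimes> g) = inverse z * f g"
    "\<And>g. g \<in> carrier G \<Longrightarrow> f (y \<otimes> g) = z * f g"
    "\<And>g. g \<in> carrier G \<Longrightarrow> f (inv y \<otimes> g) = inverse z * f g"
    using golden_eigenfunction_pair[OF x y comm] by metis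
  define m where "m = csqrt (3 - 2 * (z + inverse z))"
  have m2: "m\<^sup>2 = 3 - 2 * (z + inverse z)" by (simp add: m_def)
  have sub: "{y \<otimes> t, inv y \<otimes> t, x \<otimes> t} \<subseteq> carrier G" using x y t by simp
  have "y \<noteq> inv y"
  proof
    assume "y = inv y"
    then have "y \<otimes> y = \<one>" using r_inv[OF y(1)] by metis
    then have "y [^] (2::nat) = \<one>" using y(1) by (simp add: numeral_2_eq_2)
    then have "y [^] (2 * 3 :: nat) = \<one>" using y(1) by (simp only: nat_pow_pow[symmetric] nat_pow_one)
    then have "y = \<one>" using pow_mod_exponent[OF y(1,2), of 6] y(1) by simp
    then show False using y(3)[of 0] by simp
  qed
  moreover have "x \<noteq> inv y"
  proof
    assume "x = inv y"
    then have "y = inv x" using y(1) by simp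
    moreover have "inv x = x [^] (4::nat)"
    proof (rule inv_equality)
      have "x [^] (4::nat) \<otimes> x = x [^] Suc 4" by (simp only: nat_pow_Suc)
      then show "x [^] (4::nat) \<otimes> x = \<one>" using x(2) by simp
    qed (use x(1) in auto)
    ultimately show False using y(3)[of 4] by simp
  qed
  moreover have "x \<noteq> y" using y(3)[of 1] x(1) by auto
  ultimately have ne: "y \<otimes> t \<noteq> inv y \<otimes> t" "y \<otimes> t \<noteq> x \<otimes> t" "inv y \<otimes> t \<noteq> x \<otimes> t"
    using x(1) y(1) t(1) by auto
  have ty: "t \<otimes> inv y = inv y \<otimes> t"
    using commute_inv[OF y(1) t(1)] t(4) by simp
  have tx: "t \<otimes> inv x = x \<otimes> t" by (rule inverted_inv[OF x(1) t(1,3)])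
  have red: "t \<otimes> (t \<otimes> g) = g" "t \<otimes> (x \<otimes> g) = inv x \<otimes> (t \<otimes> g)" "t \<otimes> (y \<otimes> g) = y \<otimes> (t \<otimes> g)"
    "t \<otimes> (inv y \<otimes> g) = inv y \<otimes> (t \<otimes> g)" "t \<otimes> (inv x \<otimes> g) = x \<otimes> (t \<otimes> g)"
    if "g \<in> carrier G" for g
    using x y t tx ty that by (simp_all add: m_assoc[symmetric])
  have "(\<Sum>s\<in>{y \<otimes> t, inv y \<otimes> t, x \<otimes> t}. \<Sum>s'\<in>{y \<otimes> t, inv y \<otimes> t, x \<otimes> t}. f (s' \<otimes> (s \<otimes> g))) = m\<^sup>2 * f g"
    if g: "g \<in> carrier G" for g
  proof -
    have "(\<Sum>s\<in>{y \<otimes> t, inv y \<otimes> t, x \<otimes> t}. \<Sum>s'\<in>{y \<otimes> t, inv y \<otimes> t, x \<otimes> t}. f (s' \<otimes> (s \<otimes> g))) =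
      f (y \<otimes> (y \<otimes> g)) + f (inv y \<otimes> (y \<otimes> g)) + f (x \<otimes> (y \<otimes> g)) +
      (f (y \<otimes> (inv y \<otimes> g)) + f (inv y \<otimes> (inv y \<otimes> g)) + f (x \<otimes> (inv y \<otimes> g))) +
      (f (y \<otimes> (inv x \<otimes> g)) + f (inv y \<otimes> (inv x \<otimes> g)) + f (x \<otimes> (inv x \<otimes> g)))"
      using ne x(1) y(1) t(1) g by (simp add: m_assoc red)
    also have "\<dots> = (2 * (z + inverse z)\<^sup>2 + 1) * f g"
      using g x(1) y(1) z(1) by (simp add: f power2_eq_square algebra_simps)
    also have "\<dots> = m\<^sup>2 * f g" unfolding z(2) m2 by simp
    finally show ?thesis .
  qed
  from Cay_eigenvalue_of_square[OF sub one_closed f1 this]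
  obtain l where l: "Cay_eigenvalue G {y \<otimes> t, inv y \<otimes> t, x \<otimes> t} l" "l\<^sup>2 = m\<^sup>2" by auto
  have "(l\<^sup>2 - 4)\<^sup>2 = 1 + 4 * (z + inverse z) + 4 * (z + inverse z)\<^sup>2"
    unfolding l(2) m2 by (simp only: power2_eq_square) (simp add: algebra_simps)
  also have "\<dots> = 5" unfolding z(2) by simp
  finally show False using two_integral_eigenvalue_square[OF fin sub two l(1)] by simp
qed

subsection \<open>2-integral connection sets\<close>

text \<open>Completing the square: (2x + 1)^2 = 5.\<close>

lemma golden_in_Q_sqrt5:
  assumes "x\<^sup>2 = 1 - x"
  shows "x \<in> Q_sqrt5" "x \<notin> \<rat>"
proof -
  define s where "s = complex_of_real (sqrt 5)"
  have s2: "s\<^sup>2 = 5" unfolding s_def of_real_power[symmetric] by simp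
  have "(2 * x + 1)\<^sup>2 = 4 * x\<^sup>2 + 4 * x + 1" by (simp add: power2_eq_square algebra_simps)
  also have "\<dots> = s\<^sup>2" unfolding assms s2 by simp
  finally have "2 * x + 1 = s \<or> 2 * x + 1 = - s" by (simp only: power2_eq_iff)
  then obtain e where e: "e \<in> \<rat>" "e \<noteq> 0" "2 * x + 1 = 2 * (e * s)"
  proof
    assume "2 * x + 1 = s"
    then show thesis using that[of "1 / 2"] by simp
  next
    assume "2 * x + 1 = - s"
    then show thesis using that[of "- 1 / 2"] by simp
  qed
  then have x: "x = - 1 / 2 + e * s" by (simp add: field_simps)
  show "x \<in> Q_sqrt5" unfolding x s_def using e(1) by (intro Q_sqrt5I) auto
  show "x \<notin> \<rat>"
  proof
    assume "x \<in> \<rat>"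
    moreover have "s = (x + 1 / 2) / e" unfolding x using e(2) by simp
    ultimately have "s \<in> \<rat>" using e(1) by simp
    then show False using sqrt5_irrat by (simp only: s_def)
  qed
qed

text \<open>The adjacency operator is \<open>d T + X\<close> or \<open>d T + X T\<close>, where \<open>T\<close> is translation by \<open>t\<close> and \<open>X\<close> is
  the sum of the translations by \<open>x\<close> and its inverse. These commute, so it suffices to consider the
  eigenspaces of \<open>T\<close> for the eigenvalues 1 and -1.\<close>

lemma (in group) two_integral_of_operator:
  fixes d :: complex
  assumes fin: "finite (carrier G)" and S: "S \<subseteq> carrier G"
    and x: "x \<in> carrier G" "x [^] (5::nat) = \<one>" "x \<noteq> \<one>"
    and t: "t \<in> carrier G" "t \<otimes> t = \<one>" "t \<otimes> x = x \<otimes> t \<or> t \<otimes> x = inv x \<otimes> t"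
    and d: "d \<in> \<rat>"
    and op: "\<And>f g. g \<in> carrier G \<Longrightarrow> (\<Sum>s\<in>S. f (s \<otimes> g)) = d * f (t \<otimes> g) +
      (if e then f (x \<otimes> (t \<otimes> g)) + f (inv x \<otimes> (t \<otimes> g)) else f (x \<otimes> g) + f (inv x \<otimes> g))"
  shows "two_integral (Cay G S)"
proof -
  define Xf where "Xf f g = f (x \<otimes> g) + f (inv x \<otimes> g)" for f :: "'a \<Rightarrow> complex" and g
  \<comment> \<open>For \<open>r\<close> equal to 1 or -1 this is twice the projection to the
    \<open>r\<close>-eigenspace of translation by \<open>t\<close>. There the factor T in X T acts
    as \<open>r\<close>, which \<open>sg r\<close> records.\<close>
  define tw where "tw r f g = f g + r * f (t \<otimes> g)" for r and f :: "'a \<Rightarrow> complex" and g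
  define sg where "sg r = (if e then r else 1)" for r :: complex
  have tt: "t \<otimes> (t \<otimes> g) = g" if "g \<in> carrier G" for g
    using t(1,2) that by (simp add: m_assoc[symmetric])
  have tx: "(t \<otimes> x = x \<otimes> t \<and> t \<otimes> inv x = inv x \<otimes> t) \<or> (t \<otimes> x = inv x \<otimes> t \<and> t \<otimes> inv x = x \<otimes> t)"
    using t(3)
  proof
    assume "t \<otimes> x = x \<otimes> t"
    then show ?thesis using commute_inv[OF x(1) t(1)] by simp
  next
    assume "t \<otimes> x = inv x \<otimes> t"
    then show ?thesis using inverted_inv[OF x(1) t(1)] by simp
  qed
  \<comment> \<open>Whether \<open>t\<close> centralises or inverts \<open>x\<close>, it permutes
    the two summands of X.\<close>
  have XT: "f (t \<otimes> (x \<otimes> g)) + f (t \<otimes> (inv x \<otimes> g)) = Xf f (t \<otimes> g)" if g: "g \<in> carrier G" for f g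
    using tx
  proof
    assume *: "t \<otimes> x = x \<otimes> t \<and> t \<otimes> inv x = inv x \<otimes> t"
    have "t \<otimes> (x \<otimes> g) = x \<otimes> (t \<otimes> g)" "t \<otimes> (inv x \<otimes> g) = inv x \<otimes> (t \<otimes> g)"
      using * t(1) x(1) g by (simp_all add: m_assoc[symmetric])
    then show ?thesis by (simp add: Xf_def)
  next
    assume *: "t \<otimes> x = inv x \<otimes> t \<and> t \<otimes> inv x = x \<otimes> t"
    have "t \<otimes> (x \<otimes> g) = inv x \<otimes> (t \<otimes> g)" "t \<otimes> (inv x \<otimes> g) = x \<otimes> (t \<otimes> g)"
      using * t(1) x(1) g by (simp_all add: m_assoc[symmetric])
    then show ?thesis by (simp add: Xf_def)
  qed
  have Xtw: "Xf (tw r f) g = Xf f g + r * Xf f (t \<otimes> g)" if g: "g \<in> carrier G" for r f g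
    unfolding XT[OF g, symmetric] by (simp add: Xf_def tw_def algebra_simps)
  have tw_t: "tw r f (t \<otimes> g) = r * tw r f g" if "g \<in> carrier G" "r * r = 1" for r f g
    using that by (simp add: tw_def tt distrib_left mult.assoc[symmetric])
  have Xtw_t: "Xf (tw r f) (t \<otimes> g) = r * Xf (tw r f) g" if "g \<in> carrier G" "r * r = 1" for r f g
    using that t(1) by (simp add: Xtw tt distrib_left mult.assoc[symmetric])
  have op': "(\<Sum>s\<in>S. f (s \<otimes> g)) = d * f (t \<otimes> g) + (if e then Xf f (t \<otimes> g) else Xf f g)"
    if "g \<in> carrier G" for f g
    using op[OF that] by (simp add: Xf_def)
  have Atw: "(\<Sum>s\<in>S. tw r f (s \<otimes> g)) = d * r * tw r f g + sg r * Xf (tw r f) g"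
    if "g \<in> carrier G" "r * r = 1" for r f g
    using op'[OF that(1), of "tw r f"] that by (simp add: tw_t Xtw_t sg_def)
  have Atw': "(\<Sum>s\<in>S. tw r f (s \<otimes> g)) = (\<Sum>s\<in>S. f (s \<otimes> g)) + r * (\<Sum>s\<in>S. f (s \<otimes> (t \<otimes> g)))"
    if g: "g \<in> carrier G" for r f g
  proof -
    have "(\<Sum>s\<in>S. f (t \<otimes> (s \<otimes> g))) = (\<Sum>s\<in>S. f (s \<otimes> (t \<otimes> g)))"
      using op'[OF g, of "\<lambda>h. f (t \<otimes> h)"] op'[of "t \<otimes> g" f] XT[of g f] XT[of "t \<otimes> g" f] g t(1)
      by (simp add: Xf_def tt)
    then show ?thesis by (simp add: tw_def sum.distrib sum_distrib_left[symmetric])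
  qed
  \<comment> \<open>The two projections add up to \<open>2 * f g\<close>.\<close>
  have nz: "\<exists>r. (r = 1 \<or> r = - 1) \<and> tw r f g \<noteq> 0" if "f g \<noteq> 0" for f g
  proof (rule ccontr)
    assume "\<not> ?thesis"
    then have "tw 1 f g = 0" "tw (- 1) f g = 0" by auto
    then have "2 * f g = 0" unfolding tw_def by (simp add: add_eq_0_iff2)
    then show False using that by simp
  qed
  obtain z :: complex where z: "z ^ 5 = 1" "z \<noteq> 0" "(z + inverse z)\<^sup>2 = 1 - (z + inverse z)"
    by (rule golden_root)
  have "ord x dvd 5" using x(1,2) by (simp add: pow_eq_id)
  then have "ord x = 1 \<or> ord x = 5" using prime_nat_iff[of 5] by auto
  then have ord: "ord x = 5" using ord_eq_1[OF x(1)] x(3) by blast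
  obtain f :: "'a \<Rightarrow> complex" where f: "f \<one> \<noteq> 0" "\<And>g. g \<in> carrier G \<Longrightarrow> f (x \<otimes> g) = z * f g"
    using exists_eigenfunction[OF x(1), of z] z(1) ord by auto
  have Xf: "Xf f g = (z + inverse z) * f g" if g: "g \<in> carrier G" for g
  proof -
    have "f (inv x \<otimes> g) = inverse z * f g"
      by (rule translate_inv_eigen[OF x(1) _ z(2) g]) (rule f(2))
    then show ?thesis using f(2)[OF g] by (simp add: Xf_def distrib_right)
  qed
  obtain r where r: "r = 1 \<or> r = - 1" "tw r f \<one> \<noteq> 0" using nz[of f \<one>] f(1) by blast
  have rr: "r * r = 1" using r(1) by auto
  have "(\<Sum>s\<in>S. tw r f (s \<otimes> g)) = (d * r + sg r * (z + inverse z)) * tw r f g" if g: "g \<in> carrier G" for g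
  proof -
    have "Xf (tw r f) g = (z + inverse z) * tw r f g"
      unfolding Xtw[OF g] using g t(1) by (simp add: Xf tw_def distrib_left)
    then show ?thesis unfolding Atw[OF g rr] by (simp add: distrib_right)
  qed
  then have ev: "Cay_eigenvalue G S (d * r + sg r * (z + inverse z))"
    unfolding Cay_eigenvalue_def using r(2) one_closed by blast
  have sgr: "sg r = 1 \<or> sg r = - 1" using r(1) by (auto simp: sg_def)
  have irr: "d * r + sg r * (z + inverse z) \<notin> \<rat>"
  proof
    assume "d * r + sg r * (z + inverse z) \<in> \<rat>"
    moreover have "z + inverse z = sg r * ((d * r + sg r * (z + inverse z)) - d * r)"
      using sgr by auto
    moreover have "sg r \<in> \<rat>" "r \<in> \<rat>" using sgr r(1) by auto
    ultimately have "z + inverse z \<in> \<rat>" using d by (metis Rats_diff Rats_mult)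
    then show False using golden_in_Q_sqrt5(2)[OF z(3)] by simp
  qed
  show ?thesis
  proof (rule Cay_two_integralI[OF fin S _ ev irr])
    fix l assume "Cay_eigenvalue G S l"
    then obtain f g where fg: "g \<in> carrier G" "f g \<noteq> 0"
      "\<And>g. g \<in> carrier G \<Longrightarrow> (\<Sum>s\<in>S. f (s \<otimes> g)) = l * f g"
      unfolding Cay_eigenvalue_def by blast
    obtain r where r: "r = 1 \<or> r = - 1" "tw r f g \<noteq> 0" using nz[of f g] fg(2) by blast
    have rr: "r * r = 1" using r(1) by auto
    have sgr: "sg r = 1 \<or> sg r = - 1" using r(1) by (auto simp: sg_def)
    \<comment> \<open>The eigenvalue of X on the projected eigenfunction, solved from
      \<open>l = d * r + sg r * m\<close>.\<close>
    define m where "m = sg r * (l - d * r)"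
    have "tw r f (x \<otimes> h) + tw r f (inv x \<otimes> h) = m * tw r f h" if h: "h \<in> carrier G" for h
    proof -
      have "l * tw r f h = (\<Sum>s\<in>S. tw r f (s \<otimes> h))"
        unfolding Atw'[OF h] using fg(3) h t(1) by (simp add: tw_def distrib_left)
      also have "\<dots> = d * r * tw r f h + sg r * Xf (tw r f) h" by (rule Atw[OF h rr])
      finally have "sg r * Xf (tw r f) h = (l - d * r) * tw r f h" by (simp add: left_diff_distrib)
      then have "sg r * (sg r * Xf (tw r f) h) = m * tw r f h" by (simp add: m_def)
      then have "Xf (tw r f) h = m * tw r f h" using sgr by auto
      then show ?thesis by (simp add: Xf_def)
    qed
    from translate_cheb[OF x(1) this fg(1), of 5]
    have "2 * tw r f g = cheb m 5 * tw r f g"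
      using fg(1) x(1,2) by (simp add: nat_pow_inv)
    then have "cheb m 5 = 2" using r(2) by simp
    \<comment> \<open>The factorisation of \<open>cheb m 5 - 2\<close>.\<close>
    then have "(m - 2) * ((m\<^sup>2 - (1 - m)) * (m\<^sup>2 - (1 - m))) = 0"
      by (simp add: numeral_eq_Suc algebra_simps)
    then have "m = 2 \<or> m\<^sup>2 = 1 - m" by auto
    then have mQ: "m \<in> Q_sqrt5"
      using golden_in_Q_sqrt5(1) Q_sqrt5I[of 2 0] by auto
    note K = subfield_complexD[OF subfield_Q_sqrt5] and R = Rats_subset_subfield[OF subfield_Q_sqrt5]
    have "l = sg r * m + d * r" using sgr by (auto simp: m_def)
    moreover have "sg r \<in> \<rat>" "d * r \<in> \<rat>" using sgr r(1) d by auto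
    ultimately show "l \<in> Q_sqrt5" using K(4)[OF _ mQ] K(5) R by blast
  qed
qed

lemma (in group) inv_eq_pow:
  assumes "x \<in> carrier G" "x [^] Suc n = \<one>"
  shows "inv x = x [^] n"
  by (rule inv_equality) (use assms in auto)

lemma (in group) order_5_not_involution:
  assumes "x \<in> carrier G" "x [^] (5::nat) = \<one>" "x \<otimes> x = \<one>"
  shows "x = \<one>"
proof -
  have "x [^] (2 * 3 :: nat) = \<one>"
    using assms(1,3) unfolding nat_pow_pow[symmetric, OF assms(1)] by (simp add: numeral_2_eq_2)
  then show ?thesis using pow_mod_exponent[OF assms(1,2), of 6] assms(1) by simp
qed

text \<open>Instances of the preceding operator: \<open>d\<close> is 1 or 0 according to whether
  \<open>t\<close> belongs to \<open>S\<close>, and the flag \<open>e\<close> tells whether the pair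
  carries a factor \<open>t\<close>. The inequalities ensure that the sum over \<open>S\<close> has
  the expected number of terms.\<close>

lemma (in group) two_integral_standard_connection_sets:
  assumes fin: "finite (carrier G)"
    and x: "x \<in> carrier G" "x [^] (5::nat) = \<one>" "x \<noteq> \<one>"
    and t: "t \<in> carrier G" "t \<otimes> t = \<one>" "t \<otimes> x = x \<otimes> t \<or> t \<otimes> x = inv x \<otimes> t"
    and S: "S = {x, inv x} \<or> S = {x, inv x, t} \<or> S = {t \<otimes> x, t \<otimes> inv x} \<or> S = {t \<otimes> x, t \<otimes> inv x, t}"
  shows "two_integral (Cay G S)"
proof -
  have ne: "x \<noteq> inv x"
  proof
    assume "x = inv x"
    then have "x \<otimes> x = \<one>" using r_inv[OF x(1)] by metis
    then show False using order_5_not_involution[OF x(1,2)] x(3) by blast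
  qed
  have inv5: "inv x [^] (5::nat) = \<one>" "inv x \<noteq> \<one>" using x by (auto simp: nat_pow_inv inv_eq_1_iff)
  have tne: "t \<noteq> x" "t \<noteq> inv x"
    using order_5_not_involution[OF x(1,2)] order_5_not_involution[OF _ inv5(1)] t(2) x inv5(2) by auto
  have tx: "(t \<otimes> x = x \<otimes> t \<and> t \<otimes> inv x = inv x \<otimes> t) \<or> (t \<otimes> x = inv x \<otimes> t \<and> t \<otimes> inv x = x \<otimes> t)"
    using t(3)
  proof
    assume "t \<otimes> x = x \<otimes> t"
    then show ?thesis using commute_inv[OF x(1) t(1)] by simp
  next
    assume "t \<otimes> x = inv x \<otimes> t"
    then show ?thesis using inverted_inv[OF x(1) t(1)] by simp
  qed
  have xt: "{t \<otimes> x, t \<otimes> inv x} = {x \<otimes> t, inv x \<otimes> t}" using tx by auto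
  have ne': "x \<otimes> t \<noteq> inv x \<otimes> t" "x \<otimes> t \<noteq> t" "inv x \<otimes> t \<noteq> t"
    using ne x(1,3) t(1) inv5(2) by auto
  have sub: "S \<subseteq> carrier G" using S x(1) t(1) by auto
  note op = two_integral_of_operator[OF fin sub x t]
  from S consider "S = {x, inv x}" | "S = {x, inv x, t}" | "S = {x \<otimes> t, inv x \<otimes> t}"
    | "S = {x \<otimes> t, inv x \<otimes> t, t}"
    using xt by (metis insert_commute)
  then show ?thesis
  proof cases
    case 1
    show ?thesis by (rule op[of 0 False]) (use ne 1 in auto)
  next
    case 2
    show ?thesis by (rule op[of 1 False]) (use ne tne 2 in auto)
  next
    case 3
    show ?thesis by (rule op[of 0 True]) (use ne' 3 x(1) t(1) in \<open>auto simp: m_assoc\<close>)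
  next
    case 4
    show ?thesis by (rule op[of 1 True]) (use ne' 4 x(1) t(1) in \<open>auto simp: m_assoc\<close>)
  qed
qed

text \<open>Once a pair of distinct mutual inverses is removed, at most one element is left, and
  inversion must fix it.\<close>

lemma (in group) inverse_closed_small_set_cases:
  assumes S: "S \<subseteq> carrier G" "S = set_inv S" "2 \<le> card S" "card S \<le> 3"
  shows "(\<forall>s\<in>S. inv s = s) \<or> (\<exists>x\<in>S. inv x \<noteq> x \<and>
    (S = {x, inv x} \<or> (\<exists>u. inv u = u \<and> S = {x, inv x, u})))"
proof (cases "\<forall>s\<in>S. inv s = s")
  case False
  then obtain x where x: "x \<in> S" "inv x \<noteq> x" by auto
  have cl: "inv s \<in> S" if "s \<in> S" for s using S(2) that by (auto simp: SET_INV_def)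
  have fin: "finite S" using S(3) by (metis card.infinite not_numeral_le_zero)
  define R where "R = S - {x, inv x}"
  have SR: "S = insert x (insert (inv x) R)" using x(1) cl by (auto simp: R_def)
  have "card R = card S - 2"
    unfolding R_def using x cl[OF x(1)] fin by (subst card_Diff_subset) auto
  then have cR: "card R \<le> 1" using S(4) by simp
  have "finite R" using fin by (simp add: R_def)
  then have "R = {} \<or> (\<exists>u. R = {u})"
    using cR by (metis One_nat_def card_0_eq card_1_singletonE le_Suc_eq le_zero_eq)
  then show ?thesis
  proof
    assume "R = {}"
    then show ?thesis using SR x by blast
  next
    assume "\<exists>u. R = {u}"
    then obtain u where u: "R = {u}" by blast
    have "u \<in> carrier G" "x \<in> carrier G" using u S(1) x by (auto simp: R_def)
    moreover have "u \<in> R" using u by blast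
    then have "u \<noteq> x" "u \<noteq> inv x" unfolding R_def by blast+
    ultimately have "inv u \<noteq> x" "inv u \<noteq> inv x" by (metis inv_inv)+
    moreover have "inv u \<in> S" using u cl by (auto simp: R_def)
    ultimately have "inv u \<in> R" by (simp add: R_def)
    then have "inv u = u" using u by simp
    then show ?thesis using SR u x by blast
  qed
qed simp

lemma (in group) inv_eq_selfD:
  assumes "u \<in> carrier G" "inv u = u"
  shows "u \<otimes> u = \<one>"
  using r_inv[OF assms(1)] assms(2) by metis

text \<open>Covers two families at once, since \<open>t = \<one>\<close> is allowed: it yields the
  groups of exponent 5, and a genuine involution yields their products with a group of order
  2.\<close>

lemma (in group) class_B_3_of_central_involution:
  assumes fin: "finite (carrier G)"
    and t: "t \<in> carrier G" "t \<otimes> t = \<one>" "\<And>g. g \<in> carrier G \<Longrightarrow> t \<otimes> g = g \<otimes> t"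
    and exp: "\<And>g. g \<in> carrier G \<Longrightarrow> g [^] (5::nat) = \<one> \<or> (t \<otimes> g) [^] (5::nat) = \<one>"
    and S: "S \<subseteq> carrier G" "\<one> \<notin> S" "S = set_inv S" "2 \<le> card S" "card S \<le> 3"
  shows "two_integral (Cay G S)"
proof -
  have tt: "t \<otimes> (t \<otimes> g) = g" if "g \<in> carrier G" for g
    using t(1,2) that by (simp add: m_assoc[symmetric])
  have invol: "u = \<one> \<or> u = t" if u: "u \<in> carrier G" "u \<otimes> u = \<one>" for u
    using exp[OF u(1)]
  proof
    assume "(t \<otimes> u) [^] (5::nat) = \<one>"
    moreover have "(t \<otimes> u) \<otimes> (t \<otimes> u) = \<one>"
    proof -
      have "(t \<otimes> u) \<otimes> (t \<otimes> u) = (u \<otimes> t) \<otimes> (t \<otimes> u)" by (simp only: t(3)[OF u(1)])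
      also have "\<dots> = u \<otimes> (t \<otimes> (t \<otimes> u))" using u(1) t(1) by (simp add: m_assoc)
      finally show ?thesis using tt[OF u(1)] u(2) by simp
    qed
    ultimately have "t \<otimes> u = \<one>" using order_5_not_involution u(1) t(1) by blast
    then have "t \<otimes> (t \<otimes> u) = t" using t(1) by simp
    then show ?thesis using tt[OF u(1)] by simp
  qed (use order_5_not_involution u in blast)
  from inverse_closed_small_set_cases[OF S(1,3-5)] show ?thesis
  proof
    assume *: "\<forall>s\<in>S. inv s = s"
    have "s = t" if s: "s \<in> S" for s
    proof -
      have "s \<in> carrier G" "s \<noteq> \<one>" using S(1,2) s by auto
      then show ?thesis using invol inv_eq_selfD * s by blast
    qed
    then have "S \<subseteq> {t}" by blast
    then have "card S \<le> card {t}" by (rule card_mono[rotated]) simp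
    then show ?thesis using S(4) by simp
  next
    assume "\<exists>x\<in>S. inv x \<noteq> x \<and> (S = {x, inv x} \<or> (\<exists>u. inv u = u \<and> S = {x, inv x, u}))"
    then obtain x where x: "x \<in> S" "inv x \<noteq> x"
      and alt: "S = {x, inv x} \<or> (\<exists>u. inv u = u \<and> S = {x, inv x, u})" by blast
    have xG: "x \<in> carrier G" using x(1) S(1) by blast
    have "S = {x, inv x} \<or> S = {x, inv x, t}"
      using alt
    proof
      assume "\<exists>u. inv u = u \<and> S = {x, inv x, u}"
      then obtain u where u: "inv u = u" "S = {x, inv x, u}" by blast
      have "u \<in> carrier G" "u \<noteq> \<one>" using u(2) S(1,2) by auto
      then have "u = t" using invol inv_eq_selfD u(1) by blast
      then show ?thesis using u(2) by simp
    qed simp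
    moreover have "x \<noteq> \<one>" using x by auto
    moreover have "x \<noteq> t"
    proof
      assume "x = t"
      then have "inv x = x" using inv_equality[OF t(2) t(1) t(1)] by simp
      then show False using x(2) by simp
    qed
    ultimately show ?thesis
    proof (cases "x [^] (5::nat) = \<one>")
      case True
      show ?thesis
        using two_integral_standard_connection_sets[OF fin xG True \<open>x \<noteq> \<one>\<close> t(1,2)] t(3)[OF xG]
          \<open>S = {x, inv x} \<or> S = {x, inv x, t}\<close> by blast
    next
      case False
      \<comment> \<open>Here \<open>y\<close> has order 5 and \<open>x = t \<otimes> y\<close>, so
        \<open>S\<close> becomes one of the standard sets whose pair carries a factor
        \<open>t\<close>.\<close>
      define y where "y = t \<otimes> x"
      have y: "y \<in> carrier G" "y [^] (5::nat) = \<one>" using exp[OF xG] False xG t(1) by (auto simp: y_def)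
      have xy: "x = t \<otimes> y" using tt[OF xG] by (simp add: y_def)
      have "inv x = inv y \<otimes> inv t" unfolding xy using y t(1) by (simp add: inv_mult_group)
      also have "inv t = t" using inv_equality[OF t(2) t(1) t(1)] .
      also have "inv y \<otimes> t = t \<otimes> inv y" using t(3)[of "inv y"] y by simp
      finally have ixy: "inv x = t \<otimes> inv y" .
      have "y \<noteq> \<one>" using xy \<open>x \<noteq> t\<close> t(1) by auto
      then show ?thesis
        using two_integral_standard_connection_sets[OF fin y _ t(1,2)] t(3)[OF y(1)]
          \<open>S = {x, inv x} \<or> S = {x, inv x, t}\<close> unfolding xy[symmetric] ixy[symmetric] by blast
    qed
  qed
qed

lemma (in group) inverted_pow:
  assumes "x \<in> carrier G" "t \<in> carrier G" "t \<otimes> x = inv x \<otimes> t"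
  shows "t \<otimes> x [^] (k::nat) = inv (x [^] k) \<otimes> t"
proof (induction k)
  case (Suc k)
  have "t \<otimes> x [^] Suc k = (t \<otimes> x [^] k) \<otimes> x" using assms(1,2) by (simp add: m_assoc)
  also have "\<dots> = inv (x [^] k) \<otimes> (t \<otimes> x)" unfolding Suc using assms(1,2) by (simp add: m_assoc)
  also have "\<dots> = (inv (x [^] k) \<otimes> inv x) \<otimes> t"
    unfolding assms(3) using assms(1,2) by (simp add: m_assoc)
  also have "inv (x [^] k) \<otimes> inv x = inv (x [^] Suc k)"
    unfolding nat_pow_Suc2[OF assms(1)] using assms(1) by (simp add: inv_mult_group)
  finally show ?case .
qed (use assms(2) in simp)

text \<open>A non-involution in \<open>S\<close> is a rotation, and a possible third element is a
  reflection inverting it. Otherwise \<open>S\<close> consists of reflections, which are located by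
  their positions modulo 5 relative to two members \<open>u\<close> and
  \<open>v = u \<otimes> w\<close>.\<close>

lemma (in group) class_B_3_of_dihedral:
  assumes fin: "finite (carrier G)"
    and x: "x \<in> carrier G" "x [^] (5::nat) = \<one>" "x \<noteq> \<one>"
    and t: "t \<in> carrier G" "t \<otimes> t = \<one>" "t \<otimes> x = inv x \<otimes> t"
    and gen: "\<And>g. g \<in> carrier G \<Longrightarrow> \<exists>k::nat. g = x [^] k \<or> g = t \<otimes> x [^] k"
    and S: "S \<subseteq> carrier G" "\<one> \<notin> S" "S = set_inv S" "2 \<le> card S" "card S \<le> 3"
  shows "two_integral (Cay G S)"
proof -
  have tt: "t \<otimes> (t \<otimes> g) = g" if "g \<in> carrier G" for g
    using t(1,2) that by (simp add: m_assoc[symmetric])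
  have pow5: "(x [^] k) [^] (5::nat) = \<one>" for k :: nat
    using x(1,2) by (metis mult.commute nat_pow_one nat_pow_pow)
  note txk = inverted_pow[OF x(1) t(1,3)]
  have refl: "(t \<otimes> x [^] k) \<otimes> (t \<otimes> x [^] l) = inv (x [^] k) \<otimes> x [^] l" for k l :: nat
  proof -
    have "(t \<otimes> x [^] k) \<otimes> (t \<otimes> x [^] l) = inv (x [^] k) \<otimes> (t \<otimes> (t \<otimes> x [^] l))"
      unfolding txk[of k] using x(1) t(1) by (simp add: m_assoc)
    then show ?thesis using tt x(1) by simp
  qed
  have invol: "u \<otimes> u = \<one>" if "u = t \<otimes> x [^] k" for u and k :: nat
    unfolding that refl using x(1) by simp
  have inverts: "u \<otimes> x [^] l = inv (x [^] l) \<otimes> u" if "u = t \<otimes> x [^] k" for u and k l :: nat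
  proof -
    have c: "x [^] k \<otimes> x [^] l = x [^] l \<otimes> x [^] k" using x(1) by (rule nat_pow_comm)
    have "u \<otimes> x [^] l = (t \<otimes> x [^] l) \<otimes> x [^] k" unfolding that using c x(1) t(1) by (simp add: m_assoc)
    also have "\<dots> = inv (x [^] l) \<otimes> (t \<otimes> x [^] k)"
      unfolding txk[of l] using x(1) t(1) by (simp add: m_assoc)
    finally show ?thesis unfolding that .
  qed
  have nonrefl: "\<exists>k::nat. u = t \<otimes> x [^] k" if u: "u \<in> carrier G" "u \<otimes> u = \<one>" "u \<noteq> \<one>" for u
    using gen[OF u(1)] order_5_not_involution[OF u(1) _ u(2)] pow5 u(3) by metis
  have powinv: "\<exists>l::nat. inv (x [^] k) = x [^] l" for k :: nat
    using inv_eq_pow[of "x [^] k" 4] pow5[of k] x(1) by (auto simp: nat_pow_pow)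
  from inverse_closed_small_set_cases[OF S(1,3-5)] show ?thesis
  proof
    assume "\<exists>y\<in>S. inv y \<noteq> y \<and> (S = {y, inv y} \<or> (\<exists>u. inv u = u \<and> S = {y, inv y, u}))"
    then obtain y where y: "y \<in> S" "inv y \<noteq> y"
      and alt: "S = {y, inv y} \<or> (\<exists>u. inv u = u \<and> S = {y, inv y, u})" by blast
    have yG: "y \<in> carrier G" using y(1) S(1) by blast
    have "y \<noteq> t \<otimes> x [^] k" for k :: nat
      using inv_equality[OF invol[of y k] yG yG] y(2) by blast
    then obtain k :: nat where k: "y = x [^] k" using gen[OF yG] by blast
    have y5: "y [^] (5::nat) = \<one>" "y \<noteq> \<one>" using k pow5 y(2) by auto
    note std = two_integral_standard_connection_sets[OF fin yG y5]
    from alt show ?thesis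
    proof
      assume "S = {y, inv y}"
      then show ?thesis using std[OF t(1,2)] txk[of k] k by blast
    next
      assume "\<exists>u. inv u = u \<and> S = {y, inv y, u}"
      then obtain u where u: "inv u = u" "S = {y, inv y, u}" by blast
      have uG: "u \<in> carrier G" "u \<noteq> \<one>" using u(2) S(1,2) by auto
      have uu: "u \<otimes> u = \<one>" using inv_eq_selfD[OF uG(1) u(1)] .
      obtain l :: nat where "u = t \<otimes> x [^] l" using nonrefl[OF uG(1) uu uG(2)] by blast
      then have "u \<otimes> y = inv y \<otimes> u" unfolding k by (rule inverts)
      then show ?thesis using std[OF uG(1) uu] u(2) by blast
    qed
  next
    assume all: "\<forall>s\<in>S. inv s = s"
    have S_refl: "\<exists>k::nat. s = t \<otimes> x [^] k" if s: "s \<in> S" for s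
    proof -
      have "s \<in> carrier G" "s \<noteq> \<one>" using S(1,2) s by auto
      then show ?thesis using nonrefl inv_eq_selfD all s by blast
    qed
    have "card S = 2 \<or> card S = 3" using S(4,5) by auto
    then obtain u v where uv: "u \<in> S" "v \<in> S" "u \<noteq> v" "S = {u, v} \<or> (\<exists>r. r \<noteq> u \<and> r \<noteq> v \<and> S = {u, v, r})"
      by (auto simp: card_2_iff card_3_iff)
    obtain i j :: nat where ij: "u = t \<otimes> x [^] i" "v = t \<otimes> x [^] j" using S_refl uv by metis
    have G: "u \<in> carrier G" "v \<in> carrier G" using uv S(1) by auto
    obtain i' :: nat where i': "inv (x [^] i) = x [^] i'" using powinv by blast
    define d where "d = (i' + j) mod 5"
    define w where "w = x [^] d"
    have wG: "w \<in> carrier G" using x(1) by (simp add: w_def)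
    have w5: "w [^] (5::nat) = \<one>" using pow5 by (simp add: w_def)
    have uvw: "u \<otimes> v = w"
      unfolding ij refl i' w_def d_def pow_mod_exponent[OF x(1,2), symmetric]
      using x(1) by (simp add: nat_pow_mult)
    have uu: "u \<otimes> (u \<otimes> g) = g" if "g \<in> carrier G" for g
      using invol[OF ij(1)] G(1) that by (simp add: m_assoc[symmetric])
    have v: "v = u \<otimes> w" using uu[OF G(2)] uvw by simp
    have w1: "w \<noteq> \<one>" using v uv(3) G(1) by auto
    have "d \<noteq> 0" using w1 by (intro notI) (simp add: w_def)
    then have d: "d = 1 \<or> d = 2 \<or> d = 3 \<or> d = 4" using mod_less_divisor[of 5 "i' + j"] unfolding d_def by auto
    \<comment> \<open>By Fermat \<open>d ^ 3\<close> inverts \<open>d\<close> modulo 5, so every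
      rotation is a power of \<open>w\<close>.\<close>
    have xw: "x = w [^] (d ^ 3)"
    proof -
      have "d * d ^ 3 mod 5 = 1" using d by auto
      then have "x [^] (d * d ^ 3) = x" using pow_mod_exponent[OF x(1,2), of "d * d ^ 3"] x(1) by simp
      then show ?thesis using x(1) by (simp add: w_def nat_pow_pow)
    qed
    have S_pow: "\<exists>m<5. s = u \<otimes> w [^] (m::nat)" if s: "s \<in> S" for s
    proof -
      obtain k :: nat where k: "s = t \<otimes> x [^] k" using S_refl[OF s] by blast
      have sG: "s \<in> carrier G" using s S(1) by blast
      have "u \<otimes> s = x [^] (i' + k)" unfolding ij k refl i' using x(1) by (simp add: nat_pow_mult)
      also have "\<dots> = w [^] (d ^ 3 * (i' + k))" using xw wG by (metis nat_pow_pow)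
      also have "\<dots> = w [^] (d ^ 3 * (i' + k) mod 5)" by (rule pow_mod_exponent[OF wG w5])
      finally have "s = u \<otimes> w [^] (d ^ 3 * (i' + k) mod 5)" using uu[OF sG] by simp
      then show ?thesis by (intro exI[of _ "d ^ 3 * (i' + k) mod 5"]) simp
    qed
    \<comment> \<open>The reflection \<open>u \<otimes> w [^] a\<close> is the axis of symmetry; it
      takes the role of \<open>t\<close> in the standard connection sets.\<close>
    have cen: "two_integral (Cay G S)"
      if "S = {u \<otimes> w [^] a \<otimes> y, u \<otimes> w [^] a \<otimes> inv y} \<or> S = {u \<otimes> w [^] a \<otimes> y, u \<otimes> w [^] a \<otimes> inv y, u \<otimes> w [^] a}"
        and y: "y = w [^] (b::nat)" "y \<noteq> \<one>" for a b :: nat and y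
    proof -
      define c where "c = u \<otimes> w [^] a"
      have cr: "c = t \<otimes> x [^] (i + d * a)"
        using x(1) t(1) by (simp add: c_def ij w_def m_assoc nat_pow_pow nat_pow_mult)
      have yp: "y = x [^] (d * b)" using x(1) by (simp add: y w_def nat_pow_pow)
      have cG: "c \<in> carrier G" "y \<in> carrier G" using cr yp x(1) t(1) by auto
      have y5: "y [^] (5::nat) = \<one>" unfolding yp by (rule pow5)
      show ?thesis
        using two_integral_standard_connection_sets[OF fin cG(2) y5 y(2) cG(1) invol[OF cr]]
          inverts[OF cr, of "d * b"] that(1) unfolding c_def[symmetric] yp[symmetric] by blast
    qed
    have inv_w: "inv (w [^] (m::nat)) = w [^] (4 * m)" for m
    proof -
      have "(w [^] m) [^] Suc 4 = (w [^] (5::nat)) [^] m"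
        unfolding nat_pow_pow[OF wG] by (simp add: mult.commute)
      then have "(w [^] m) [^] Suc 4 = \<one>" using w5 by simp
      then show ?thesis using inv_eq_pow[of "w [^] m" 4] wG by (simp add: nat_pow_pow mult.commute[of m])
    qed
    have red: "w [^] a \<otimes> w [^] b = w [^] ((a + b) mod 5)" for a b :: nat
      using pow_mod_exponent[OF wG w5, of "a + b"] wG by (simp add: nat_pow_mult)
    have w2: "w [^] (2::nat) \<noteq> \<one>"
      using order_5_not_involution[OF wG w5] w1 wG by (auto simp: numeral_2_eq_2)
    have u0: "u \<otimes> w [^] (0::nat) = u" "u \<otimes> w [^] (1::nat) = v" using v G(1) wG by auto
    have form: "u \<otimes> w [^] a \<otimes> w [^] b = u \<otimes> w [^] ((a + b) mod 5)" for a b :: nat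
      using red[of a b] G(1) wG by (simp add: m_assoc)
    \<comment> \<open>Any two or three of the five reflections are symmetric about one of them.\<close>
    from uv(4) show ?thesis
    proof
      assume "S = {u, v}"
      \<comment> \<open>3 is half of 0 + 1 modulo 5, hence the centre of positions 0 and 1, which
        lie at offsets 2 and -2 from it.\<close>
      then have "S = {u \<otimes> w [^] (3::nat) \<otimes> w [^] (2::nat), u \<otimes> w [^] (3::nat) \<otimes> inv (w [^] (2::nat))}"
        unfolding inv_w form using u0 by simp
      then show ?thesis using cen[of 3 "w [^] (2::nat)" 2] w2 by blast
    next
      assume "\<exists>r. r \<noteq> u \<and> r \<noteq> v \<and> S = {u, v, r}"
      then obtain r where r: "r \<noteq> u" "r \<noteq> v" "S = {u, v, r}" by blast
      obtain m :: nat where m: "m < 5" "r = u \<otimes> w [^] m" using S_pow[of r] r(3) by auto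
      have "m \<noteq> 0" "m \<noteq> 1" using m(2) r(1,2) u0 by metis+
      \<comment> \<open>The position sets {0, 1, 2}, {0, 1, 3} and {0, 1, 4} are symmetric modulo 5
        about 1, 3 and 0.\<close>
      then consider "m = 2" | "m = 3" | "m = 4" using m(1) by linarith
      then show ?thesis
      proof cases
        case 1
        have arith: "((1::nat) + 1) mod 5 = 2" "((1::nat) + 4 * 1) mod 5 = 0" by simp_all
        have "S = {u \<otimes> w [^] (1::nat) \<otimes> w [^] (1::nat), u \<otimes> w [^] (1::nat) \<otimes> inv (w [^] (1::nat)), u \<otimes> w [^] (1::nat)}"
          unfolding inv_w form r(3) m(2) 1 unfolding arith u0 by (simp only: insert_commute)
        then show ?thesis using cen[of 1 "w [^] (1::nat)" 1] w1 wG by auto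
      next
        case 2
        have "S = {u \<otimes> w [^] (3::nat) \<otimes> w [^] (2::nat), u \<otimes> w [^] (3::nat) \<otimes> inv (w [^] (2::nat)), u \<otimes> w [^] (3::nat)}"
          unfolding inv_w form r(3) m(2) 2 using u0 by auto
        then show ?thesis using cen[of 3 "w [^] (2::nat)" 2] w2 by blast
      next
        case 3
        have "S = {u \<otimes> w [^] (0::nat) \<otimes> w [^] (1::nat), u \<otimes> w [^] (0::nat) \<otimes> inv (w [^] (1::nat)), u \<otimes> w [^] (0::nat)}"
          unfolding inv_w form r(3) m(2) 3 using u0 by auto
        then show ?thesis using cen[of 0 "w [^] (1::nat)" 1] w1 wG by auto
      qed
    qed
  qed
qed

subsection \<open>Groups all of whose small Cayley graphs are 2-integral\<close>

text \<open>The class equation: were no nontrivial element central, all nontrivial conjugacy classes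
  would have size divisible by \<open>p\<close>, so \<open>p\<close> would divide both the order and
  the order minus 1.\<close>

lemma (in group) p_group_center_nontrivial:
  assumes p: "Factorial_Ring.prime p" and ord: "Coset.order G = p ^ k" and fin: "finite (carrier G)"
    and nt: "carrier G \<noteq> {\<one>}"
  shows "\<exists>z\<in>carrier G. z \<noteq> \<one> \<and> (\<forall>g\<in>carrier G. g \<otimes> z = z \<otimes> g)"
proof (rule ccontr)
  assume none: "\<not> ?thesis"
  define \<phi> where "\<phi> = (\<lambda>g. \<lambda>h\<in>carrier G. g \<otimes> h \<otimes> inv g)"
  interpret A: group_action G "carrier G" \<phi>
    unfolding \<phi>_def by (rule action_by_conjugation)
  define r where "r = {(x, y). x \<in> carrier G - {\<one>} \<and> y \<in> carrier G - {\<one>} \<and> y \<in> orbit G \<phi> x}"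
  have orbE: "y \<in> orbit G \<phi> x \<longleftrightarrow> (\<exists>g\<in>carrier G. y = g \<otimes> x \<otimes> inv g)" if "x \<in> carrier G" for x y
    using that by (auto simp: orbit_def \<phi>_def)
  have orb_sub: "y \<in> carrier G" if "x \<in> carrier G" "y \<in> orbit G \<phi> x" for x y
    using that orbE by auto
  have orb_ne: "y \<noteq> \<one>" if x: "x \<in> carrier G" "x \<noteq> \<one>" "y \<in> orbit G \<phi> x" for x y
  proof
    assume "y = \<one>"
    then have "\<exists>g\<in>carrier G. \<one> = g \<otimes> x \<otimes> inv g" using x(3) orbE[OF x(1), of \<one>] by simp
    then obtain g where g: "g \<in> carrier G" "g \<otimes> x \<otimes> inv g = \<one>" by force
    have "inv (inv g) = g \<otimes> x" using inv_equality[OF g(2)] g(1) x(1) by simp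
    then have "g \<otimes> x = g" using g(1) by simp
    then show False using g(1) x(1,2) by simp
  qed
  have eqv: "equiv (carrier G - {\<one>}) r"
  proof (rule equivI)
    show "r \<subseteq> (carrier G - {\<one>}) \<times> (carrier G - {\<one>})" by (auto simp: r_def)
    show "refl_on (carrier G - {\<one>}) r"
      by (rule refl_onI) (auto simp: r_def A.orbit_refl)
    show "sym r"
      by (rule symI) (auto simp: r_def intro: A.orbit_sym)
    show "trans r"
      by (rule transI) (auto simp: r_def intro: A.orbit_trans)
  qed
  have dvd: "p dvd card C" if C': "C \<in> (carrier G - {\<one>}) // r" for C
  proof -
    obtain x where "x \<in> carrier G - {\<one>}" and xC: "C = r `` {x}"
      using C' by (rule quotientE)
    then have x: "x \<in> carrier G" "x \<noteq> \<one>" by auto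
    have C: "C = orbit G \<phi> x" unfolding xC using x orb_sub orb_ne by (auto simp: r_def)
    have "card C * card (stabilizer G \<phi> x) = p ^ k"
      using A.orbit_stabilizer_theorem[OF x(1)] ord C by simp
    then have "card C dvd p ^ k" by (metis dvd_triv_left)
    then obtain i where i: "card C = p ^ i" using p divides_primepow_nat by blast
    show ?thesis
    proof (cases i)
      case 0
      then have "card C = 1" using i by simp
      moreover have "x \<in> C" using C A.orbit_refl[OF x(1)] by simp
      ultimately have "C = {x}" by (metis card_1_singletonE singletonD)
      have "g \<otimes> x = x \<otimes> g" if g: "g \<in> carrier G" for g
      proof -
        have "g \<otimes> x \<otimes> inv g \<in> C" unfolding C orbE[OF x(1)] using g by blast
        then have "g \<otimes> x \<otimes> inv g = x" using \<open>C = {x}\<close> by simp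
        then have "(g \<otimes> x \<otimes> inv g) \<otimes> g = x \<otimes> g" by simp
        then show ?thesis using g x(1) by (simp add: m_assoc)
      qed
      then show ?thesis using none x by blast
    qed (simp add: i)
  qed
  have "p dvd card (carrier G - {\<one>})"
    by (rule equiv_imp_dvd_card[OF _ eqv dvd]) (use fin in simp_all)
  moreover have "card (carrier G) = Suc (card (carrier G - {\<one>}))"
    using fin by (metis card.remove one_closed)
  moreover have "p dvd card (carrier G)"
  proof -
    have "card (carrier G) \<noteq> 1"
      using nt by (metis card_1_singletonE one_closed singletonD)
    then have "k \<noteq> 0" using ord by (auto simp: Coset.order_def)
    then show ?thesis using ord by (simp add: Coset.order_def)
  qed
  ultimately have "p dvd 1" by (metis Suc_eq_plus1 dvd_add_right_iff)
  then show False using p by simp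
qed

lemma eq_5_power_or_twice:
  fixes n :: nat
  assumes "n > 0" "\<And>p. Factorial_Ring.prime p \<Longrightarrow> p dvd n \<Longrightarrow> p = 2 \<or> p = 5" "\<not> 4 dvd n"
  shows "\<exists>k. n = 5 ^ k \<or> n = 2 * 5 ^ k"
  using assms
proof (induction n rule: less_induct)
  case (less n)
  show ?case
  proof (cases "n = 1")
    case True
    then show ?thesis by (intro exI[of _ 0]) simp
  next
    case False
    show ?thesis
    proof (cases "5 dvd n")
      case True
      then obtain m where m: "n = 5 * m" by blast
      have "m < n" "m > 0" using m less.prems(1) by auto
      moreover have "\<not> 4 dvd m" using less.prems(3) m by (meson dvd_mult)
      ultimately obtain k where "m = 5 ^ k \<or> m = 2 * 5 ^ k"
        using less.IH[of m] less.prems(2) m by (metis dvd_mult)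
      then show ?thesis using m by (intro exI[of _ "Suc k"]) auto
    next
      case no5: False
      obtain p where "Factorial_Ring.prime p" "p dvd n" using prime_factor_nat[OF False] by blast
      then have "2 dvd n" using less.prems(2) no5 by blast
      then obtain m where m: "n = 2 * m" by blast
      have "m = 1"
      proof (rule ccontr)
        assume "m \<noteq> 1"
        then obtain p where p: "Factorial_Ring.prime p" "p dvd m" using prime_factor_nat by blast
        then have "p = 2" using less.prems(2)[of p] no5 m by (auto intro: dvd_mult)
        then have "2 * 2 dvd n" using p m mult_dvd_mono[of 2 2 2 m] by simp
        then show False using less.prems(3) by simp
      qed
      then show ?thesis using m by (intro exI[of _ 0]) simp
    qed
  qed
qed

lemma (in group) set_inv_eqI:
  assumes "S \<subseteq> carrier G" "\<And>s. s \<in> S \<Longrightarrow> inv s \<in> S"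
  shows "S = set_inv S"
proof -
  have "s \<in> set_inv S" if "s \<in> S" for s
    using that assms(1) assms(2)[OF that] by (auto simp: SET_INV_def intro!: bexI[of _ "inv s"])
  moreover have "s \<in> S" if "s \<in> set_inv S" for s
    using that assms(2) by (auto simp: SET_INV_def)
  ultimately show ?thesis by blast
qed

text \<open>The group order is a valid exponent, so the \<open>LEAST\<close> in
  \<open>exponent\<close> is attained. As 5 is prime, a nontrivial element then has order exactly 5;
  the trivial group has exponent 1.\<close>

lemma (in group) exponent_5_iff:
  assumes fin: "finite (carrier G)"
  shows "exponent G = 5 \<longleftrightarrow> (\<forall>x\<in>carrier G. x [^] (5::nat) = \<one>) \<and> carrier G \<noteq> {\<one>}"
proof -
  define Q where "Q n \<longleftrightarrow> 0 < n \<and> (\<forall>x\<in>carrier G. x [^] n = \<one>)" for n :: nat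
  have Q: "Q (Coset.order G)"
    using fin pow_order_eq_1 order_gt_0_iff_finite by (auto simp: Q_def)
  have ex: "exponent G = Least Q" unfolding exponent_def Q_def ..
  show ?thesis
  proof
    assume 5: "exponent G = 5"
    then have "Q 5" using LeastI[of Q, OF Q] ex by simp
    moreover have "carrier G \<noteq> {\<one>}"
    proof
      assume "carrier G = {\<one>}"
      then have "Q 1" by (auto simp: Q_def)
      then show False using Least_le[of Q 1] ex 5 by simp
    qed
    ultimately show "(\<forall>x\<in>carrier G. x [^] (5::nat) = \<one>) \<and> carrier G \<noteq> {\<one>}" by (simp add: Q_def)
  next
    assume *: "(\<forall>x\<in>carrier G. x [^] (5::nat) = \<one>) \<and> carrier G \<noteq> {\<one>}"
    then obtain x where x: "x \<in> carrier G" "x \<noteq> \<one>" using one_closed by blast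
    have "ord x dvd 5" using * x(1) by (simp add: pow_eq_id[symmetric])
    then have "ord x = 1 \<or> ord x = 5" using prime_nat_iff[of 5] by auto
    then have o: "ord x = 5" using ord_eq_1[OF x(1)] x(2) by blast
    have "5 \<le> n" if "Q n" for n
      using that x(1) o pow_eq_id[OF x(1), of n] by (auto simp: Q_def dest: dvd_imp_le)
    moreover have "Q 5" using * by (simp add: Q_def)
    ultimately show "exponent G = 5" unfolding ex by (intro Least_equality)
  qed
qed

text \<open>The cycle criterion bounds the order and excludes 3, 4, 7 and 11. The orders 6, 8, 9 and
  12 fall because a suitable power of \<open>a\<close> would have order 3 or 4.\<close>

lemma (in group) pow_10_of_two_integral_Cayley_graphs:
  assumes fin: "finite (carrier G)" and a: "a \<in> carrier G"
    and G: "\<And>S. S \<subseteq> carrier G \<Longrightarrow> \<one> \<notin> S \<Longrightarrow> S = set_inv S \<Longrightarrow> 2 \<le> card S \<Longrightarrow> card S \<le> 3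
      \<Longrightarrow> two_integral (Cay G S)"
  shows "a [^] (10::nat) = \<one>"
proof -
  have cyc: "ord a \<le> 12 \<and> ord a \<noteq> 3 \<and> ord a \<noteq> 4 \<and> ord a \<noteq> 7 \<and> ord a \<noteq> 11"
    if a: "a \<in> carrier G" "a \<noteq> inv a" for a
  proof -
    have "{a, inv a} \<subseteq> carrier G" "{a, inv a} = set_inv {a, inv a}"
      using a by (auto intro!: set_inv_eqI)
    moreover have "\<one> \<notin> {a, inv a}" using a by (metis inv_one inv_inv insertE singletonD)
    ultimately have "two_integral (Cay G {a, inv a})"
      using a(2) by (intro G) auto
    from two_integral_cycle[OF fin a this] show ?thesis by simp
  qed
  have ord_gt2: "b \<noteq> inv b" if "b \<in> carrier G" "ord b > 2" for b
  proof
    assume "b = inv b"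
    then have "b \<otimes> b = \<one>" using r_inv[OF that(1)] by metis
    then have "b [^] (2::nat) = \<one>" using that(1) by (simp add: numeral_2_eq_2)
    then have "ord b dvd 2" using that(1) by (simp add: pow_eq_id)
    then show False using that(2) by (auto dest: dvd_imp_le)
  qed
  have no34: "ord b \<noteq> 3" "ord b \<noteq> 4" if "b \<in> carrier G" for b
    using cyc[OF that] ord_gt2[OF that] by auto
  have pos: "ord a > 0" using ord_ge_1[OF fin a] by simp
  have pw: "ord (a [^] m) = n" if "ord a = m * n" "m > 0" for m n
    using that ord_pow[OF a, of m] by auto
  have not3: "ord a \<noteq> m * 3" if "m > 0" for m
    using pw[of m 3] no34(1)[of "a [^] m"] that a by auto
  have not4: "ord a \<noteq> m * 4" if "m > 0" for m
    using pw[of m 4] no34(2)[of "a [^] m"] that a by auto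
  have "ord a = 1 \<or> ord a = 2 \<or> ord a = 5 \<or> ord a = 10"
  proof (cases "ord a > 2")
    case True
    have "ord a \<le> 12" "ord a \<noteq> 7" "ord a \<noteq> 11" using cyc[OF a ord_gt2[OF a True]] by auto
    moreover have "ord a \<noteq> 3" "ord a \<noteq> 6" "ord a \<noteq> 9" "ord a \<noteq> 12" "ord a \<noteq> 4" "ord a \<noteq> 8"
      using not3[of 1] not3[of 2] not3[of 3] not3[of 4] not4[of 1] not4[of 2] by simp_all
    ultimately show ?thesis using True by presburger
  qed (use pos in auto)
  then have "ord a dvd 10" by auto
  then show ?thesis using a by (simp add: pow_eq_id)
qed

locale two_integral_Cayley_graphs = group G for G (structure) +
  assumes fin: "finite (carrier G)"
    and two_integral: "\<And>S. S \<subseteq> carrier G \<Longrightarrow> \<one> \<notin> S \<Longrightarrow> S = set_inv S \<Longrightarrow>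
      2 \<le> card S \<Longrightarrow> card S \<le> 3 \<Longrightarrow> two_integral (Cay G S)"
begin

lemma pow_10: "a \<in> carrier G \<Longrightarrow> a [^] (10::nat) = \<one>"
  by (rule pow_10_of_two_integral_Cayley_graphs[OF fin _ two_integral])

lemma involutions_not_commute:
  assumes "s \<in> carrier G" "t \<in> carrier G" "s \<otimes> s = \<one>" "t \<otimes> t = \<one>" "s \<noteq> \<one>" "t \<noteq> \<one>"
    and "s \<otimes> t = t \<otimes> s"
  shows "s = t"
proof (rule ccontr)
  assume "s \<noteq> t"
  have "inv s = s" "inv t = t" using inv_equality assms by auto
  then have "{s, t} = set_inv {s, t}" using assms(1,2) by (intro set_inv_eqI) auto
  then have "two_integral (Cay G {s, t})"
    using assms \<open>s \<noteq> t\<close> by (intro two_integral) auto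
  then show False
    using not_two_integral_commuting_involutions[OF fin assms(1,2) \<open>s \<noteq> t\<close> assms(3,4,7)] by blast
qed

lemma order_cases: "\<exists>k. Coset.order G = 5 ^ k \<or> Coset.order G = 2 * 5 ^ k"
proof (rule eq_5_power_or_twice)
  show "Coset.order G > 0" using fin order_gt_0_iff_finite by blast
next
  fix p :: nat assume p: "Factorial_Ring.prime p" "p dvd Coset.order G"
  then obtain m where "Coset.order G = p ^ 1 * m" by auto
  then obtain H where H: "subgroup H G" "card H = p ^ 1"
    using sylow_thm[OF p(1) is_group _ fin] by blast
  have "H \<noteq> {\<one>}" using H(2) p(1) by auto
  then obtain h where h: "h \<in> H" "h \<noteq> \<one>" using subgroup.one_closed[OF H(1)] by blast
  have hG: "h \<in> carrier G" using h(1) subgroup.mem_carrier[OF H(1)] by blast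
  interpret HG: group "G\<lparr>carrier := H\<rparr>" using subgroup.subgroup_is_group[OF H(1) is_group] .
  have "h [^]\<^bsub>G\<lparr>carrier := H\<rparr>\<^esub> Coset.order (G\<lparr>carrier := H\<rparr>) = \<one>"
    using HG.pow_order_eq_1[of h] h(1) by simp
  then have "h [^] p = \<one>" using H(2) by (simp add: Coset.order_def nat_pow_consistent[symmetric])
  then have "ord h dvd p" using hG by (simp add: pow_eq_id)
  moreover have "ord h \<noteq> 1" using ord_eq_1[OF hG] h(2) by simp
  ultimately have "ord h = p" using p(1) by (auto simp: prime_nat_iff)
  then have "p dvd 2 * 5" using pow_10[OF hG] hG by (simp add: pow_eq_id)
  then have "p dvd 2 \<or> p dvd 5" using p(1) prime_dvd_mult_iff by blast
  moreover have "Factorial_Ring.prime (5::nat)" by simp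
  ultimately show "p = 2 \<or> p = 5" using p(1) primes_dvd_imp_eq two_is_prime_nat by blast
next
  show "\<not> 4 dvd Coset.order G"
  proof
    assume "4 dvd Coset.order G"
    then obtain m where "Coset.order G = 2 ^ 2 * m" by auto
    then obtain H where H: "subgroup H G" "card H = 2 ^ 2"
      using sylow_thm[OF two_is_prime_nat is_group _ fin] by blast
    interpret HG: group "G\<lparr>carrier := H\<rparr>" using subgroup.subgroup_is_group[OF H(1) is_group] .
    have sq: "h \<otimes> h = \<one>" if h: "h \<in> H" for h
    proof -
      have hG: "h \<in> carrier G" using h subgroup.mem_carrier[OF H(1)] by blast
      have "h [^]\<^bsub>G\<lparr>carrier := H\<rparr>\<^esub> Coset.order (G\<lparr>carrier := H\<rparr>) = \<one>"
        using HG.pow_order_eq_1[of h] h by simp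
      then have "h [^] (4::nat) = \<one>" using H(2) by (simp add: Coset.order_def nat_pow_consistent[symmetric])
      then have "ord h dvd 4" "ord h dvd 10" using hG pow_10[OF hG] by (simp_all add: pow_eq_id)
      then have "ord h dvd gcd 4 10" by (rule gcd_greatest)
      moreover have "gcd 4 10 = (2::nat)" by (simp add: gcd_non_0_nat)
      ultimately have "h [^] (2::nat) = \<one>" using hG by (simp add: pow_eq_id)
      then show ?thesis using hG by (simp add: numeral_2_eq_2)
    qed
    have "finite H" using H(2) by (metis card.infinite power_not_zero zero_neq_numeral)
    then have "card (H - {\<one>}) = 3" using H subgroup.one_closed[OF H(1)] by simp
    then obtain s t where st: "s \<in> H - {\<one>}" "t \<in> H - {\<one>}" "s \<noteq> t"
      by (auto simp: card_3_iff)
    have G: "s \<in> carrier G" "t \<in> carrier G" using st subgroup.mem_carrier[OF H(1)] by auto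
    have "s \<otimes> t \<in> H" using st subgroup.m_closed[OF H(1)] by auto
    then have "inv (s \<otimes> t) = s \<otimes> t" using sq G by (intro inv_equality) auto
    moreover have "inv s = s" "inv t = t" using sq st G by (auto intro!: inv_equality)
    ultimately have "s \<otimes> t = t \<otimes> s" using G by (simp add: inv_mult_group)
    then show False using involutions_not_commute[OF G] sq st by auto
  qed
qed

end

text \<open>By counting, \<open>H\<close> and its coset through \<open>h\<close> fill the group. So
  \<open>inv g\<close>, lying outside \<open>H\<close>, equals \<open>a \<otimes> h\<close> with
  \<open>a \<in> H\<close>.\<close>

lemma (in group) index_2_mult:
  assumes H: "subgroup H G" "2 * card H = Coset.order G" and fin: "finite (carrier G)"
    and g: "g \<in> carrier G" "g \<notin> H" and h: "h \<in> carrier G" "h \<notin> H"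
  shows "h \<otimes> g \<in> H"
proof -
  note sub = subgroup.subset[OF H(1)]
  define K where "K = (\<lambda>a. a \<otimes> h) ` H"
  have "inj_on (\<lambda>a. a \<otimes> h) H" using sub h(1) by (intro inj_onI) (meson right_cancel subsetD)
  then have cK: "card K = card H" unfolding K_def by (rule card_image)
  have disj: "K \<inter> H = {}"
  proof (rule ccontr)
    assume "K \<inter> H \<noteq> {}"
    then obtain a where a: "a \<in> H" "a \<otimes> h \<in> H" by (auto simp: K_def)
    then have "inv a \<otimes> (a \<otimes> h) \<in> H" using subgroup.m_closed[OF H(1)] subgroup.m_inv_closed[OF H(1)] by blast
    moreover have "inv a \<otimes> (a \<otimes> h) = h" using a(1) sub h(1) by (simp add: m_assoc[symmetric] subset_iff)
    ultimately show False using h(2) by simp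
  qed
  have KG: "K \<union> H \<subseteq> carrier G" using sub h(1) by (auto simp: K_def)
  have "card (K \<union> H) = card K + card H"
    using KG fin disj by (intro card_Un_disjoint) (auto intro: finite_subset)
  then have "card (K \<union> H) = card (carrier G)" using cK H(2) by (simp add: Coset.order_def)
  then have "K \<union> H = carrier G" using KG fin by (intro card_subset_eq) auto
  moreover have "inv g \<notin> H"
    using subgroup.m_inv_closed[OF H(1), of "inv g"] g by auto
  ultimately have "inv g \<in> K" using g(1) by blast
  then obtain a where a: "a \<in> H" "inv g = a \<otimes> h" by (auto simp: K_def)
  have aG: "a \<in> carrier G" using a(1) sub by blast
  have "h \<otimes> g = inv a"
  proof -
    have "a \<otimes> (h \<otimes> g) = \<one>" using a(2)[symmetric] aG g(1) h(1) by (simp add: m_assoc[symmetric])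
    then have "(h \<otimes> g) \<otimes> a = \<one>" using aG g(1) h(1) inv_comm by simp
    then show ?thesis using inv_equality aG g(1) h(1) by simp
  qed
  then show ?thesis using subgroup.m_inv_closed[OF H(1) a(1)] by simp
qed

context two_integral_Cayley_graphs
begin

text \<open>Describing the Sylow 5-subgroup by \<open>x [^] 5 = \<one>\<close> makes its invariance
  under conjugation immediate. An \<open>x\<close> with this property lies in it because its fourth
  power does, by index 2, and is the inverse of \<open>x\<close>.\<close>

lemma odd_subgroup:
  assumes "Coset.order G = 2 * 5 ^ k"
  obtains H where "subgroup H G" "card H = 5 ^ k" "2 * card H = Coset.order G"
    "\<And>x. x \<in> carrier G \<Longrightarrow> x \<in> H \<longleftrightarrow> x [^] (5::nat) = \<one>"
proof -
  have "Factorial_Ring.prime (5::nat)" by simp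
  from sylow_thm[OF this is_group, of k 2] assms fin
  obtain H where H: "subgroup H G" "card H = 5 ^ k" by (auto simp: mult.commute)
  have H2: "2 * card H = Coset.order G" using H(2) assms by simp
  interpret HG: group "G\<lparr>carrier := H\<rparr>" using subgroup.subgroup_is_group[OF H(1) is_group] .
  have "x [^] (5::nat) = \<one>" if x: "x \<in> carrier G" "x \<in> H" for x
  proof -
    have "x [^]\<^bsub>G\<lparr>carrier := H\<rparr>\<^esub> Coset.order (G\<lparr>carrier := H\<rparr>) = \<one>"
      using HG.pow_order_eq_1[of x] x by simp
    then have "x [^] ((5::nat) ^ k) = \<one>"
      using H(2) by (simp add: Coset.order_def nat_pow_consistent[symmetric])
    then have "ord x dvd 5 ^ k" "ord x dvd 2 * 5" using x(1) pow_10[OF x(1)] by (simp_all add: pow_eq_id)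
    moreover have "coprime (ord x) 2"
      using \<open>ord x dvd 5 ^ k\<close> by (metis coprime_commute coprime_divisors coprime_power_right_iff dvd_refl
          odd_numeral coprime_left_2_iff_odd even_power)
    ultimately have "ord x dvd 5" using coprime_dvd_mult_right_iff by blast
    then show ?thesis using x(1) by (simp add: pow_eq_id)
  qed
  moreover have "x \<in> H" if x: "x \<in> carrier G" "x [^] (5::nat) = \<one>" for x
  proof (rule ccontr)
    assume n: "x \<notin> H"
    have xx: "x \<otimes> x \<in> H" using index_2_mult[OF H(1) H2 fin x(1) n x(1) n] .
    then have x4: "(x \<otimes> x) \<otimes> (x \<otimes> x) \<in> H" using subgroup.m_closed[OF H(1)] by blast
    have "x [^] (5::nat) = ((x \<otimes> x) \<otimes> (x \<otimes> x)) \<otimes> x"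
      using x(1) by (simp add: eval_nat_numeral m_assoc)
    then have "inv ((x \<otimes> x) \<otimes> (x \<otimes> x)) = x"
      using x by (metis inv_comm inv_equality m_closed)
    then show False using n subgroup.m_inv_closed[OF H(1) x4] by simp
  qed
  ultimately show thesis using that[OF H H2] by blast
qed

end

context two_integral_Cayley_graphs
begin

text \<open>If they commuted, the mixed triple would apply: \<open>y\<close> is not a power of
  \<open>x\<close>, because \<open>t\<close> inverts all powers of \<open>x\<close> but fixes
  \<open>y\<close>, which differs from its inverse.\<close>

lemma inverted_and_centralized_not_commute:
  assumes x: "x \<in> carrier G" "x [^] (5::nat) = \<one>" "x \<noteq> \<one>"
    and y: "y \<in> carrier G" "y [^] (5::nat) = \<one>" "y \<noteq> \<one>"
    and t: "t \<in> carrier G" "t \<otimes> t = \<one>" "t \<otimes> x = inv x \<otimes> t" "t \<otimes> y = y \<otimes> t"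
  shows "x \<otimes> y \<noteq> y \<otimes> x"
proof
  assume comm: "x \<otimes> y = y \<otimes> x"
  have t1: "t \<noteq> \<one>"
  proof
    assume "t = \<one>"
    then have "x = inv x" using t(3) x(1) by simp
    then have "x \<otimes> x = \<one>" using r_inv[OF x(1)] by metis
    then show False using order_5_not_involution[OF x(1,2)] x(3) by blast
  qed
  have t5: "t [^] (5::nat) \<noteq> \<one>" using order_5_not_involution[OF t(1) _ t(2)] t1 by blast
  have yne: "y \<noteq> inv y"
  proof
    assume "y = inv y"
    then have "y \<otimes> y = \<one>" using r_inv[OF y(1)] by metis
    then show False using order_5_not_involution[OF y(1,2)] y(3) by blast
  qed
  have pow: "y \<noteq> x [^] k" for k :: nat
  proof
    assume k: "y = x [^] k"
    have "y \<otimes> t = inv y \<otimes> t" using inverted_pow[OF x(1) t(1,3), of k] t(4) unfolding k by simp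
    then show False using yne y(1) t(1) by simp
  qed
  have ty: "t \<otimes> inv y = inv y \<otimes> t" using commute_inv[OF y(1) t(1)] t(4) by simp
  have invs: "inv (y \<otimes> t) = inv y \<otimes> t" "inv (inv y \<otimes> t) = y \<otimes> t" "inv (x \<otimes> t) = x \<otimes> t"
    using inv_equality[OF t(2) t(1) t(1)] x(1) y(1) t(1) ty t(4) inverted_inv[OF x(1) t(1,3)]
    by (simp_all add: inv_mult_group)
  have no1: "c \<otimes> t \<noteq> \<one>" if c: "c \<in> carrier G" "c [^] (5::nat) = \<one>" for c
  proof
    assume "c \<otimes> t = \<one>"
    then have "inv t = c" using inv_equality c t(1) by simp
    then have "t = c" using inv_equality[OF t(2) t(1) t(1)] by simp
    then show False using t5 c(2) by simp
  qed
  have iy: "inv y [^] (5::nat) = \<one>" using y(1,2) by (simp add: nat_pow_inv)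
  let ?S = "{y \<otimes> t, inv y \<otimes> t, x \<otimes> t}"
  have "two_integral (Cay G ?S)"
  proof (rule two_integral)
    show "?S \<subseteq> carrier G" using x(1) y(1) t(1) by auto
    then show "?S = set_inv ?S" using invs by (intro set_inv_eqI) auto
    show "\<one> \<notin> ?S" using no1[OF y(1,2)] no1[OF _ iy] no1[OF x(1,2)] y(1) by auto
    have "y \<otimes> t \<noteq> inv y \<otimes> t" using yne y(1) t(1) by simp
    then have "card {y \<otimes> t, inv y \<otimes> t} = 2" by simp
    then show "2 \<le> card ?S" using card_mono[of ?S "{y \<otimes> t, inv y \<otimes> t}"] by auto
    show "card ?S \<le> 3" by (simp add: card_insert_if)
  qed
  then show False using not_two_integral_mixed[OF fin x y(1,2) pow comm t] by blast
qed

lemma inverted_elements_cyclic: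
  assumes a: "a \<in> carrier G" "a [^] (5::nat) = \<one>" "a \<noteq> \<one>"
    and b: "b \<in> carrier G" "b [^] (5::nat) = \<one>" and comm: "a \<otimes> b = b \<otimes> a"
    and t: "t \<in> carrier G" "t \<otimes> t = \<one>" "t \<noteq> \<one>" "t \<otimes> a = inv a \<otimes> t" "t \<otimes> b = inv b \<otimes> t"
  shows "\<exists>k::nat. b = a [^] k"
proof (rule ccontr)
  assume "\<not> ?thesis"
  then have pow: "b \<noteq> a [^] k" for k :: nat by blast
  have t5: "t [^] (5::nat) \<noteq> \<one>" using order_5_not_involution[OF t(1) _ t(2)] t(3) by blast
  have it: "inv t = t" by (rule inv_equality[OF t(2) t(1) t(1)])
  have invs: "inv (t \<otimes> a) = t \<otimes> a" "inv (t \<otimes> b) = t \<otimes> b"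
    using a(1) b(1) t(1,4,5) it by (simp_all add: inv_mult_group)
  have no1: "t \<otimes> c \<noteq> \<one>" if c: "c \<in> carrier G" "c [^] (5::nat) = \<one>" for c
  proof
    assume "t \<otimes> c = \<one>"
    then have "inv c = t" using inv_equality c t(1) by simp
    then have "t [^] (5::nat) = inv (c [^] (5::nat))" using nat_pow_inv[OF c(1), of 5] by simp
    then have "t [^] (5::nat) = \<one>" using c(2) by simp
    then show False using t5 by simp
  qed
  let ?S = "{t, t \<otimes> a, t \<otimes> b}"
  have "two_integral (Cay G ?S)"
  proof (rule two_integral)
    show "?S \<subseteq> carrier G" using a(1) b(1) t(1) by auto
    then show "?S = set_inv ?S" using invs it by (intro set_inv_eqI) auto
    show "\<one> \<notin> ?S" using no1[OF a(1,2)] no1[OF b(1,2)] t(3) by auto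
    have "t \<noteq> t \<otimes> a" using a(1,3) t(1) by auto
    then have "card {t, t \<otimes> a} = 2" by simp
    then show "2 \<le> card ?S" using card_mono[of ?S "{t, t \<otimes> a}"] by auto
    show "card ?S \<le> 3" by (simp add: card_insert_if)
  qed
  then show False
    using not_two_integral_three_reflections[OF fin a b(1,2) pow comm t(1,2,4,5)] by blast
qed

text \<open>Conjugation \<open>c\<close> by \<open>t\<close> turns out to have no nontrivial fixed
  point on \<open>H\<close>. A fixed-point-free involutory automorphism of a finite group is
  inversion, so \<open>H\<close> is abelian, and the triple of reflections leaves room for only one
  cyclic factor.\<close>

lemma two_involutions_imp_dihedral:
  assumes H: "subgroup H G" "card H = 5 ^ k" "2 * card H = Coset.order G"
    and H5: "\<And>x. x \<in> carrier G \<Longrightarrow> x \<in> H \<longleftrightarrow> x [^] (5::nat) = \<one>"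
    and t: "t \<in> carrier G" "t \<otimes> t = \<one>" "t \<noteq> \<one>"
    and u: "u \<in> carrier G" "u \<otimes> u = \<one>" "u \<noteq> \<one>" "u \<noteq> t"
  shows "\<exists>s. s \<in> H \<and> s \<noteq> \<one> \<and> t \<otimes> s = inv s \<otimes> t \<and> (\<forall>h\<in>H. \<exists>k::nat. h = s [^] k)"
proof -
  have HG: "h \<in> carrier G" if "h \<in> H" for h using subgroup.mem_carrier[OF H(1) that] .
  have h5: "h [^] (5::nat) = \<one>" if "h \<in> H" for h using H5[OF HG[OF that]] that by simp
  have tH: "t \<notin> H" "u \<notin> H"
    using order_5_not_involution[OF t(1) _ t(2)] order_5_not_involution[OF u(1) _ u(2)] t u H5 by auto
  have tt: "t \<otimes> (t \<otimes> g) = g" if "g \<in> carrier G" for g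
    using t(1,2) that by (simp add: m_assoc[symmetric])
  have it: "inv t = t" "inv u = u" using inv_equality t u by auto
  define c where "c g = t \<otimes> g \<otimes> t" for g
  have cG: "c g \<in> carrier G" if "g \<in> carrier G" for g using that t(1) by (simp add: c_def)
  have cm: "c (g \<otimes> h) = c g \<otimes> c h" if "g \<in> carrier G" "h \<in> carrier G" for g h
    using that t(1) by (simp add: c_def m_assoc tt)
  have cc: "c (c g) = g" if "g \<in> carrier G" for g
    using that t(1,2) by (simp add: c_def m_assoc tt)
  have c1: "c \<one> = \<one>" using t(1,2) by (simp add: c_def)
  have ci: "c (inv g) = inv (c g)" if g: "g \<in> carrier G" for g
  proof -
    have "c (inv g) \<otimes> c g = \<one>" using cm[of "inv g" g] g c1 by simp
    then show ?thesis using inv_equality cG g by (metis inv_closed)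
  qed
  have cH: "c h \<in> H" if "h \<in> H" for h
  proof -
    have h: "h \<in> carrier G" using HG that .
    have "c h [^] n = c (h [^] n)" for n :: nat
      by (induction n) (use h in \<open>auto simp: c1 cm\<close>)
    then show ?thesis using H5[OF cG[OF h]] h5[OF that] c1 by simp
  qed
  have c_inv: "t \<otimes> g = inv g \<otimes> t" if g: "g \<in> carrier G" "c g = inv g" for g
  proof -
    have "c g \<otimes> t = t \<otimes> g" using g(1) t(1,2) by (simp add: c_def m_assoc)
    then show ?thesis using g(2) by simp
  qed
  have c_fix: "t \<otimes> g = g \<otimes> t" if g: "g \<in> carrier G" "c g = g" for g
  proof -
    have "c g \<otimes> t = t \<otimes> g" using g(1) t(1,2) by (simp add: c_def m_assoc)
    then show ?thesis using g(2) by simp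
  qed
  \<comment> \<open>The product of two involutions is inverted by each of them; it lies in
    \<open>H\<close> because \<open>H\<close> has index 2.\<close>
  define s where "s = t \<otimes> u"
  have sH: "s \<in> H" unfolding s_def using index_2_mult[OF H(1,3) fin u(1) tH(2) t(1) tH(1)] .
  have s1: "s \<noteq> \<one>"
  proof
    assume "s = \<one>"
    then have "inv u = t" unfolding s_def using inv_equality t(1) u(1) by simp
    then show False using it u(4) by simp
  qed
  have cs: "c s = inv s"
    unfolding s_def c_def using t(1) u(1) by (simp add: tt inv_mult_group it m_assoc)
  \<comment> \<open>The inverted \<open>s\<close> and the fixed \<open>y\<close> need not commute,
    as \<open>H\<close> may be nonabelian so far; a central element has to replace one of
    them.\<close>
  have no_fix: "y = \<one>" if y: "y \<in> H" "c y = y" for y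
  proof (rule ccontr)
    assume y1: "y \<noteq> \<one>"
    have yG: "y \<in> carrier G" using HG y(1) .
    interpret K: group "G\<lparr>carrier := H\<rparr>" using subgroup.subgroup_is_group[OF H(1) is_group] .
    have "\<exists>z\<in>carrier (G\<lparr>carrier := H\<rparr>). z \<noteq> \<one>\<^bsub>G\<lparr>carrier := H\<rparr>\<^esub> \<and>
        (\<forall>g\<in>carrier (G\<lparr>carrier := H\<rparr>). g \<otimes>\<^bsub>G\<lparr>carrier := H\<rparr>\<^esub> z = z \<otimes>\<^bsub>G\<lparr>carrier := H\<rparr>\<^esub> g)"
    proof (rule K.p_group_center_nontrivial)
      show "Factorial_Ring.prime (5::nat)" by simp
      show "Coset.order (G\<lparr>carrier := H\<rparr>) = 5 ^ k" using H(2) by (simp add: Coset.order_def)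
      show "finite (carrier (G\<lparr>carrier := H\<rparr>))"
        using fin HG by (auto intro: finite_subset[of H "carrier G"])
      show "carrier (G\<lparr>carrier := H\<rparr>) \<noteq> {\<one>\<^bsub>G\<lparr>carrier := H\<rparr>\<^esub>}" using sH s1 by auto
    qed
    then obtain z where z: "z \<in> H" "z \<noteq> \<one>" "\<And>g. g \<in> H \<Longrightarrow> g \<otimes> z = z \<otimes> g" by auto
    have zG: "z \<in> carrier G" using HG z(1) .
    \<comment> \<open>Either \<open>z\<close> is a central element of \<open>H\<close> fixed by \<open>t\<close>, or \<open>inv z \<otimes> c z\<close> is one that is inverted
      by \<open>t\<close>: in both cases an inverted and a fixed element commute.\<close>
    show False
    proof (cases "c z = z")
      case True
      show False
        using inverted_and_centralized_not_commute[OF HG[OF sH] h5[OF sH] s1 zG h5[OF z(1)] z(2) t(1,2)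
            c_inv[OF HG[OF sH] cs] c_fix[OF zG True]] z(3)[OF sH] by blast
    next
      case False
      define w where "w = inv z \<otimes> c z"
      have wH: "w \<in> H"
        unfolding w_def using subgroup.m_closed[OF H(1)] subgroup.m_inv_closed[OF H(1)] cH z(1) by blast
      have "c w = inv (c z) \<otimes> z" unfolding w_def using zG by (simp add: cm cG ci cc)
      also have "\<dots> = inv w" unfolding w_def using zG cG by (simp add: inv_mult_group)
      finally have cw: "c w = inv w" .
      have w1: "w \<noteq> \<one>"
      proof
        assume "w = \<one>"
        then have "z \<otimes> w = z" using zG by simp
        moreover have "z \<otimes> w = c z" using zG cG by (simp add: w_def m_assoc[symmetric])
        ultimately show False using False by simp
      qed
      have yz: "y \<otimes> inv z = inv z \<otimes> y" using commute_inv[OF zG yG] z(3)[OF y(1)] by simp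
      have ycz: "y \<otimes> c z = c z \<otimes> y"
        using arg_cong[OF z(3)[OF y(1)], of c] cm[OF yG zG] cm[OF zG yG] y(2) by simp
      have "w \<otimes> y = inv z \<otimes> (c z \<otimes> y)" unfolding w_def using zG cG yG by (simp add: m_assoc)
      also have "\<dots> = (inv z \<otimes> y) \<otimes> c z" unfolding ycz[symmetric] using zG cG yG by (simp add: m_assoc)
      also have "\<dots> = y \<otimes> w" unfolding yz[symmetric] w_def using zG cG yG by (simp add: m_assoc)
      finally have wy: "w \<otimes> y = y \<otimes> w" .
      show False
        using inverted_and_centralized_not_commute[OF HG[OF wH] h5[OF wH] w1 yG h5[OF y(1)] y1 t(1,2)
            c_inv[OF HG[OF wH] cw] c_fix[OF yG y(2)]] wy by blast
    qed
  qed
  have finH: "finite H" using fin HG by (auto intro: finite_subset[of H "carrier G"])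
  \<comment> \<open>Equal values make \<open>q \<otimes> inv p\<close> a fixed point. By finiteness
    every element of \<open>H\<close> then has the form \<open>inv p \<otimes> c p\<close>, and
    \<open>c\<close> visibly inverts such elements.\<close>
  have inj: "inj_on (\<lambda>p. inv p \<otimes> c p) H"
  proof (rule inj_onI)
    fix p q assume pq: "p \<in> H" "q \<in> H" and eq: "inv p \<otimes> c p = inv q \<otimes> c q"
    have G: "p \<in> carrier G" "q \<in> carrier G" using HG pq by auto
    have "q \<otimes> (inv p \<otimes> c p) \<otimes> inv (c p) = q \<otimes> (inv q \<otimes> c q) \<otimes> inv (c p)" by (simp only: eq)
    moreover have "q \<otimes> (inv p \<otimes> c p) \<otimes> inv (c p) = q \<otimes> inv p"
      using G cG[OF G(1)] by (simp add: m_assoc)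
    moreover have "q \<otimes> (inv q \<otimes> c q) \<otimes> inv (c p) = c (q \<otimes> inv p)"
      using G cG[OF G(1)] cG[OF G(2)] by (simp add: cm ci m_assoc[symmetric])
    ultimately have "c (q \<otimes> inv p) = q \<otimes> inv p" by simp
    moreover have "q \<otimes> inv p \<in> H"
      using pq subgroup.m_closed[OF H(1)] subgroup.m_inv_closed[OF H(1)] by blast
    ultimately have "q \<otimes> inv p = \<one>" using no_fix by blast
    then have "inv (inv p) = q" using inv_equality[of q "inv p"] G by simp
    then show "p = q" using G by simp
  qed
  have "(\<lambda>p. inv p \<otimes> c p) ` H \<subseteq> H"
    using subgroup.m_closed[OF H(1)] subgroup.m_inv_closed[OF H(1)] cH by blast
  then have surj: "(\<lambda>p. inv p \<otimes> c p) ` H = H" using endo_inj_surj[OF finH _ inj] by blast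
  have all: "c h = inv h" if hH: "h \<in> H" for h
  proof -
    have "h \<in> (\<lambda>p. inv p \<otimes> c p) ` H" unfolding surj by (rule hH)
    then obtain p where p: "p \<in> H" "h = inv p \<otimes> c p" by (rule imageE) simp
    have pG: "p \<in> carrier G" using HG p(1) .
    show ?thesis unfolding p(2) using pG cG[OF pG] by (simp add: cm ci cc inv_mult_group)
  qed
  have "\<exists>k::nat. h = s [^] k" if hH: "h \<in> H" for h
  proof -
    have hG: "h \<in> carrier G" and sG: "s \<in> carrier G" using HG hH sH by auto
    \<comment> \<open>Inversion is now multiplicative on \<open>H\<close>, which forces
      commutativity.\<close>
    have "inv (s \<otimes> h) = c s \<otimes> c h"
      using all[of "s \<otimes> h"] subgroup.m_closed[OF H(1) sH hH] cm[OF sG hG] by simp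
    then have "inv (s \<otimes> h) = inv (h \<otimes> s)"
      using all[OF sH] all[OF hH] hG sG by (simp add: inv_mult_group)
    then have comm: "s \<otimes> h = h \<otimes> s" using hG sG by (metis inv_inv m_closed)
    show ?thesis
      by (rule inverted_elements_cyclic[OF sG h5[OF sH] s1 hG h5[OF hH] comm t
            c_inv[OF sG all[OF sH]] c_inv[OF hG all[OF hH]]])
  qed
  then show ?thesis using sH s1 c_inv[OF HG[OF sH] cs] by blast
qed

end

section \<open>Recognising the isomorphism types\<close>

lemma (in group) iso_direct_product_involution:
  assumes H: "subgroup H G" "2 * card H = Coset.order G" and fin: "finite (carrier G)"
    and t: "t \<in> carrier G" "t \<otimes> t = \<one>" "t \<notin> H" "\<And>h. h \<in> H \<Longrightarrow> t \<otimes> h = h \<otimes> t"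
  shows "G \<cong> (G\<lparr>carrier := H\<rparr>) \<times>\<times> integer_mod_group 2"
proof -
  let ?P = "(G\<lparr>carrier := H\<rparr>) \<times>\<times> integer_mod_group 2"
  have HG: "h \<in> carrier G" if "h \<in> H" for h using subgroup.mem_carrier[OF H(1) that] .
  define f where "f = (\<lambda>(p, i :: int). if i = 0 then p else p \<otimes> t)"
  have carr: "carrier ?P = H \<times> {0, 1}" by (auto simp: DirProd_def carrier_integer_mod_group)
  interpret HG: group "G\<lparr>carrier := H\<rparr>" using subgroup.subgroup_is_group[OF H(1) is_group] .
  have grp: "group ?P" by (rule DirProd_group) (auto simp: HG.is_group)
  have th: "t \<otimes> (h \<otimes> g) = h \<otimes> (t \<otimes> g)" if "h \<in> H" "g \<in> carrier G" for h g
    using t(1,4) HG that by (simp add: m_assoc[symmetric])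
  have "f \<in> iso ?P G"
  proof (rule isoI)
    show "f \<in> hom ?P G"
    proof (rule homI)
      fix a assume "a \<in> carrier ?P"
      then show "f a \<in> carrier G" unfolding carr using HG t(1) by (auto simp: f_def)
    next
      fix a b assume ab: "a \<in> carrier ?P" "b \<in> carrier ?P"
      then obtain p i q j where pq: "a = (p, i)" "b = (q, j)" "p \<in> H" "q \<in> H" "i \<in> {0, 1}" "j \<in> {0, 1}"
        unfolding carr by blast
      have "f (a \<otimes>\<^bsub>?P\<^esub> b) = f (p \<otimes> q, (i + j) mod 2)" by (simp add: pq DirProd_def)
      also have "\<dots> = f a \<otimes> f b"
        using pq(5,6) HG[OF pq(3)] HG[OF pq(4)] t(1,2) th[OF pq(4) t(1)] t(4)[OF pq(4)]
        by (auto simp: f_def pq(1,2) m_assoc)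
      finally show "f (a \<otimes>\<^bsub>?P\<^esub> b) = f a \<otimes> f b" .
    qed
    have inj: "inj_on f (carrier ?P)"
    proof (rule inj_onI)
      have no: "q \<otimes> t \<noteq> p" if "p \<in> H" "q \<in> H" for p q
      proof
        assume "q \<otimes> t = p"
        then have "t = inv q \<otimes> p" using HG that t(1) by (auto simp: m_assoc[symmetric])
        then show False
          using t(3) subgroup.m_closed[OF H(1)] subgroup.m_inv_closed[OF H(1)] that by blast
      qed
      fix a b assume ab: "a \<in> carrier ?P" "b \<in> carrier ?P" and eq: "f a = f b"
      then obtain p i q j where pq: "a = (p, i)" "b = (q, j)" "p \<in> H" "q \<in> H" "i \<in> {0, 1}" "j \<in> {0, 1}"
        unfolding carr by blast
      show "a = b"
        using pq(5,6) eq no[OF pq(3,4)] no[OF pq(4,3)] HG[OF pq(3)] HG[OF pq(4)] t(1)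
        by (auto simp: f_def pq(1,2))
    qed
    have "f ` carrier ?P = carrier G"
    proof (rule card_subset_eq[OF fin])
      show "f ` carrier ?P \<subseteq> carrier G" unfolding carr using HG t(1) by (auto simp: f_def)
      have "card (f ` carrier ?P) = card (carrier ?P)" by (rule card_image[OF inj])
      also have "\<dots> = 2 * card H" unfolding carr by (simp add: card_cartesian_product)
      finally show "card (f ` carrier ?P) = card (carrier G)" using H(2) by (simp add: Coset.order_def)
    qed
    then show "bij_betw f (carrier ?P) (carrier G)" using inj by (simp add: bij_betw_def)
  qed
  then have "?P \<cong> G" by (rule is_isoI)
  then show ?thesis by (rule group.iso_sym[OF grp])
qed

text \<open>The map sends a pair to \<open>s [^] a\<close>, times \<open>t\<close> for reflections.
  It is onto by \<open>gen\<close>, and injective by counting, since its domain has 10 elements and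
  the group at least as many.\<close>

lemma (in group) iso_dihedral_group_5:
  assumes fin: "finite (carrier G)" and ord: "10 \<le> Coset.order G"
    and s: "s \<in> carrier G" "s [^] (5::nat) = \<one>"
    and t: "t \<in> carrier G" "t \<otimes> t = \<one>" "t \<otimes> s = inv s \<otimes> t"
    and gen: "\<And>g. g \<in> carrier G \<Longrightarrow> \<exists>k::nat. g = s [^] k \<or> g = s [^] k \<otimes> t"
  shows "G \<cong> dihedral_group 5"
proof -
  let ?D = "dihedral_group 5"
  define f where "f = (\<lambda>(a :: int, c). if c then s [^] a \<otimes> t else s [^] a)"
  have carr: "carrier ?D = {0..<5} \<times> UNIV" by (simp add: dihedral_group_def)
  have mod5: "s [^] (a mod 5) = s [^] a" for a :: int
  proof -
    have "int (ord s) dvd a mod 5 - a"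
    proof -
      have "ord s dvd 5" using s by (simp add: pow_eq_id)
      then have "int (ord s) dvd 5" by (metis of_nat_dvd_iff of_nat_numeral)
      moreover have "5 dvd a mod 5 - a" by (simp add: mod_eq_dvd_iff[symmetric])
      ultimately show ?thesis by (rule dvd_trans)
    qed
    then show ?thesis using int_pow_eq[OF s(1)] by (metis dvd_diff_commute)
  qed
  \<comment> \<open>Integer exponents are first reduced modulo 5 to natural ones, where
    \<open>inverted_pow\<close> applies.\<close>
  have ts: "t \<otimes> s [^] a = s [^] (- a) \<otimes> t" for a :: int
  proof -
    have nat: "t \<otimes> s [^] n = s [^] (- int n) \<otimes> t" for n :: nat
      using inverted_pow[OF s(1) t(1,3), of n] s(1) by (simp add: int_pow_neg int_pow_int)
    have "s [^] a = s [^] nat (a mod 5)"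
      by (metis mod5 int_pow_int pos_mod_sign zero_less_numeral int_nat_eq)
    then have "t \<otimes> s [^] a = s [^] (- (a mod 5)) \<otimes> t"
      using nat[of "nat (a mod 5)"] by simp
    also have "s [^] (- (a mod 5)) = s [^] (- a)"
      using mod5[of "- (a mod 5)"] mod5[of "- a"] by (simp add: mod_minus_eq)
    finally show ?thesis .
  qed
  have cl: "f a \<in> carrier G" for a using s(1) t(1) by (cases a) (auto simp: f_def)
  have "f \<in> iso ?D G"
  proof (rule isoI)
    show "f \<in> hom ?D G"
    proof (rule homI)
      fix x y assume "x \<in> carrier ?D" "y \<in> carrier ?D"
      obtain a c b d where xy: "x = (a, c)" "y = (b, d)" by (cases x; cases y)
      have m: "f (x \<otimes>\<^bsub>?D\<^esub> y) = f ((if c then a - b else a + b), c \<noteq> d)"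
        by (simp add: xy dihedral_group_def f_def mod5)
      show "f (x \<otimes>\<^bsub>?D\<^esub> y) = f x \<otimes> f y"
      proof (cases c)
        case False
        then show ?thesis unfolding m using s(1) t(1)
          by (cases d) (simp_all add: xy f_def int_pow_mult m_assoc)
      next
        case True
        have e: "s [^] (a - b) = s [^] a \<otimes> s [^] (- b)" using int_pow_mult[OF s(1), of a "- b"] by simp
        have "f x \<otimes> s [^] b = s [^] a \<otimes> (t \<otimes> s [^] b)" using True s(1) t(1) by (simp add: xy f_def m_assoc)
        also have "\<dots> = s [^] (a - b) \<otimes> t" unfolding ts e using s(1) t(1) by (simp add: m_assoc)
        finally have 1: "f x \<otimes> s [^] b = s [^] (a - b) \<otimes> t" .
        show ?thesis
        proof (cases d)
          case False
          then show ?thesis unfolding m using True 1 by (simp add: xy(2) f_def)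
        next
          case d: True
          have "f x \<otimes> f y = (f x \<otimes> s [^] b) \<otimes> t" using d s(1) t(1) cl[of x] by (simp add: xy(2) f_def m_assoc)
          also have "\<dots> = s [^] (a - b)" unfolding 1 using s(1) t(1,2) by (simp add: m_assoc)
          finally show ?thesis unfolding m using True d by (simp add: f_def)
        qed
      qed
    qed (rule cl)
    have "carrier G \<subseteq> f ` carrier ?D"
    proof
      fix g assume "g \<in> carrier G"
      then obtain k :: nat where k: "g = s [^] k \<or> g = s [^] k \<otimes> t" using gen by blast
      have "s [^] k = s [^] (int k mod 5)" unfolding mod5 by (simp add: int_pow_int)
      then have "g = f (int k mod 5, False) \<or> g = f (int k mod 5, True)" using k by (auto simp: f_def)
      moreover have "(int k mod 5, c) \<in> carrier ?D" for c by (simp add: carr)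
      ultimately show "g \<in> f ` carrier ?D" by blast
    qed
    then have im: "f ` carrier ?D = carrier G" using cl by blast
    have cD: "card (carrier ?D) = 10" by (simp add: carr card_cartesian_product)
    then have "finite (carrier ?D)" by (metis card.infinite zero_neq_numeral)
    then have "card (f ` carrier ?D) \<le> 10" using card_image_le cD by metis
    then have "card (f ` carrier ?D) = card (carrier ?D)"
      using im ord cD by (simp add: Coset.order_def)
    then have "inj_on f (carrier ?D)" using \<open>finite (carrier ?D)\<close> by (simp add: eq_card_imp_inj_on)
    then show "bij_betw f (carrier ?D) (carrier G)" using im by (simp add: bij_betw_def)
  qed
  then have "?D \<cong> G" by (rule is_isoI)
  then show ?thesis by (rule group.iso_sym[OF group_dihedral_group[of 5, simplified]])
qed

text \<open>For even order the number of involutions decides: a second one leads to the dihedral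
  group, while a unique one equals all its conjugates and splits off as a direct factor.\<close>

lemma class_B_3_cases:
  fixes G :: "'a monoid"
  assumes G: "G \<in> class_B 3" and ord2: "2 < Coset.order G"
  shows "(\<exists>P :: 'a monoid. p_group 5 P \<and> exponent P = 5 \<and> G \<cong> P) \<or>
    (\<exists>P :: 'a monoid. p_group 5 P \<and> exponent P = 5 \<and> G \<cong> P \<times>\<times> integer_mod_group 2) \<or>
    G \<cong> dihedral_group 5"
proof -
  interpret two_integral_Cayley_graphs G
    using G by (auto simp: class_B_def two_integral_Cayley_graphs_def two_integral_Cayley_graphs_axioms_def)
  have nt: "carrier G \<noteq> {\<one>\<^bsub>G\<^esub>}" using ord2 by (auto simp: Coset.order_def)
  from order_cases obtain k where k: "Coset.order G = 5 ^ k \<or> Coset.order G = 2 * 5 ^ k" by blast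
  then show ?thesis
  proof
    assume o: "Coset.order G = 5 ^ k"
    have "x [^]\<^bsub>G\<^esub> (5::nat) = \<one>\<^bsub>G\<^esub>" if x: "x \<in> carrier G" for x
    proof -
      have "ord x dvd 5 ^ k" "ord x dvd 2 * 5"
        using ord_dvd_group_order[OF x] o pow_10[OF x] x by (simp_all add: pow_eq_id)
      moreover have "coprime (5 ^ k) (2 :: nat)" by simp
      ultimately have "ord x dvd 5" by (metis coprime_divisors coprime_dvd_mult_right_iff dvd_refl)
      then show ?thesis using x by (simp add: pow_eq_id)
    qed
    then have "exponent G = 5" using exponent_5_iff[OF fin] nt by simp
    moreover have "p_group 5 G" using o is_group by (auto simp: p_group_def)
    moreover have "G \<cong> G" by (rule iso_refl)
    ultimately show ?thesis by blast
  next
    assume o: "Coset.order G = 2 * 5 ^ k"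
    obtain H where H: "subgroup H G" "card H = 5 ^ k" "2 * card H = Coset.order G"
      "\<And>x. x \<in> carrier G \<Longrightarrow> x \<in> H \<longleftrightarrow> x [^]\<^bsub>G\<^esub> (5::nat) = \<one>\<^bsub>G\<^esub>"
      using odd_subgroup[OF o] by metis
    have HG: "h \<in> carrier G" if "h \<in> H" for h using subgroup.mem_carrier[OF H(1) that] .
    have "H \<noteq> carrier G" using H(3) ord2 by (auto simp: Coset.order_def)
    then obtain g where g: "g \<in> carrier G" "g \<notin> H" using HG by blast
    \<comment> \<open>The fifth power of an element outside \<open>H\<close> is nontrivial, and it
      squares to \<open>g [^] 10\<close>, which is trivial.\<close>
    define t where "t = g [^]\<^bsub>G\<^esub> (5::nat)"
    have tG: "t \<in> carrier G" using g(1) by (simp add: t_def)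
    have t1: "t \<noteq> \<one>\<^bsub>G\<^esub>" using H(4)[OF g(1)] g(2) by (simp add: t_def)
    have "t \<otimes>\<^bsub>G\<^esub> t = g [^]\<^bsub>G\<^esub> (10::nat)" using g(1) by (simp add: t_def nat_pow_mult)
    then have tt: "t \<otimes>\<^bsub>G\<^esub> t = \<one>\<^bsub>G\<^esub>" using pow_10[OF g(1)] by simp
    have tH: "t \<notin> H" using order_5_not_involution[OF tG _ tt] H(4)[OF tG] t1 by blast
    show ?thesis
    proof (cases "\<exists>u\<in>carrier G. u \<otimes>\<^bsub>G\<^esub> u = \<one>\<^bsub>G\<^esub> \<and> u \<noteq> \<one>\<^bsub>G\<^esub> \<and> u \<noteq> t")
      case True
      then obtain u where u: "u \<in> carrier G" "u \<otimes>\<^bsub>G\<^esub> u = \<one>\<^bsub>G\<^esub>" "u \<noteq> \<one>\<^bsub>G\<^esub>" "u \<noteq> t" by blast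
      obtain s where s: "s \<in> H" "s \<noteq> \<one>\<^bsub>G\<^esub>" "t \<otimes>\<^bsub>G\<^esub> s = inv\<^bsub>G\<^esub> s \<otimes>\<^bsub>G\<^esub> t"
        "\<And>h. h \<in> H \<Longrightarrow> \<exists>k::nat. h = s [^]\<^bsub>G\<^esub> k"
        using two_involutions_imp_dihedral[OF H tG tt t1 u] by blast
      \<comment> \<open>For \<open>k = 0\<close> the group would have order 2; otherwise it has the
        10 elements needed for the counting argument.\<close>
      have "k \<noteq> 0" using ord2 o by (cases k) auto
      then have "(5::nat) ^ 1 \<le> 5 ^ k" by (intro power_increasing) auto
      then have o10: "10 \<le> Coset.order G" using o by simp
      have "\<exists>k::nat. h = s [^]\<^bsub>G\<^esub> k \<or> h = s [^]\<^bsub>G\<^esub> k \<otimes>\<^bsub>G\<^esub> t" if h: "h \<in> carrier G" for h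
      proof (cases "h \<in> H")
        case False
        have "h \<otimes>\<^bsub>G\<^esub> t \<in> H" by (rule index_2_mult[OF H(1,3) fin tG tH h False])
        then obtain k :: nat where "h \<otimes>\<^bsub>G\<^esub> t = s [^]\<^bsub>G\<^esub> k" using s(4) by blast
        then have "s [^]\<^bsub>G\<^esub> k \<otimes>\<^bsub>G\<^esub> t = h" using h tG tt by (metis m_assoc r_one)
        then show ?thesis by blast
      qed (use s(4) in blast)
      then show ?thesis
        using iso_dihedral_group_5[OF fin o10 HG[OF s(1)] _ tG tt s(3)] H(4)[OF HG[OF s(1)]] s(1) by blast
    next
      case False
      have cen: "t \<otimes>\<^bsub>G\<^esub> h = h \<otimes>\<^bsub>G\<^esub> t" if h: "h \<in> H" for h
      proof -
        have hG: "h \<in> carrier G" using HG h .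
        define u where "u = h \<otimes>\<^bsub>G\<^esub> t \<otimes>\<^bsub>G\<^esub> inv\<^bsub>G\<^esub> h"
        have uG: "u \<in> carrier G" using hG tG by (simp add: u_def)
        have "u \<otimes>\<^bsub>G\<^esub> u = h \<otimes>\<^bsub>G\<^esub> t \<otimes>\<^bsub>G\<^esub> (inv\<^bsub>G\<^esub> h \<otimes>\<^bsub>G\<^esub> h) \<otimes>\<^bsub>G\<^esub> t \<otimes>\<^bsub>G\<^esub> inv\<^bsub>G\<^esub> h"
          unfolding u_def using hG tG by (simp only: m_assoc m_closed inv_closed)
        also have "\<dots> = h \<otimes>\<^bsub>G\<^esub> (t \<otimes>\<^bsub>G\<^esub> t) \<otimes>\<^bsub>G\<^esub> inv\<^bsub>G\<^esub> h" using hG tG by (simp add: m_assoc)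
        also have "\<dots> = \<one>\<^bsub>G\<^esub>" using hG by (simp add: tt)
        finally have uu: "u \<otimes>\<^bsub>G\<^esub> u = \<one>\<^bsub>G\<^esub>" .
        have uh: "u \<otimes>\<^bsub>G\<^esub> h = h \<otimes>\<^bsub>G\<^esub> t" using hG tG by (simp add: u_def m_assoc)
        have "u \<noteq> \<one>\<^bsub>G\<^esub>"
        proof
          assume "u = \<one>\<^bsub>G\<^esub>"
          then have "h \<otimes>\<^bsub>G\<^esub> t = h" using uh hG by simp
          then show False using hG tG t1 by simp
        qed
        then have "u = t" using False uG uu by blast
        then show ?thesis using uh by simp
      qed
      have iso: "G \<cong> (G\<lparr>carrier := H\<rparr>) \<times>\<times> integer_mod_group 2"
        by (rule iso_direct_product_involution[OF H(1,3) fin tG tt tH cen])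
      interpret P: group "G\<lparr>carrier := H\<rparr>" using subgroup.subgroup_is_group[OF H(1) is_group] .
      have "finite H" using H(2) by (metis card.infinite power_not_zero zero_neq_numeral)
      moreover have "H \<noteq> {\<one>\<^bsub>G\<^esub>}" using H(3) ord2 by auto
      moreover have "x [^]\<^bsub>G\<lparr>carrier := H\<rparr>\<^esub> (5::nat) = \<one>\<^bsub>G\<^esub>" if "x \<in> H" for x
        using H(4)[OF HG[OF that]] that by (simp add: nat_pow_consistent[symmetric])
      ultimately have "exponent (G\<lparr>carrier := H\<rparr>) = 5" using P.exponent_5_iff by simp
      moreover have "p_group 5 (G\<lparr>carrier := H\<rparr>)"
        using P.is_group H(2) by (auto simp: p_group_def Coset.order_def)
      ultimately show ?thesis using iso by blast
    qed
  qed
qed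

section \<open>The three families belong to the class\<close>

lemma class_B_3I:
  fixes G :: "'a monoid"
  assumes "group G" "finite (carrier G)"
    and "\<And>S. S \<subseteq> carrier G \<Longrightarrow> \<one>\<^bsub>G\<^esub> \<notin> S \<Longrightarrow> S = set_inv\<^bsub>G\<^esub> S \<Longrightarrow> 2 \<le> card S \<Longrightarrow> card S \<le> 3
      \<Longrightarrow> two_integral (Cay G S)"
  shows "G \<in> class_B 3"
  using assms unfolding class_B_def by blast

lemma exponent_5_pow:
  assumes "p_group 5 P" "exponent P = 5" "x \<in> carrier P"
  shows "x [^]\<^bsub>P\<^esub> (5::nat) = \<one>\<^bsub>P\<^esub>"
proof -
  interpret P: group P using assms(1) by (simp add: p_group_def)
  have "Coset.order P > 0" using assms(1) by (auto simp: p_group_def)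
  then have "finite (carrier P)" by (simp add: P.order_gt_0_iff_finite)
  then show ?thesis using P.exponent_5_iff assms(2,3) by simp
qed

text \<open>The central involution criterion with the identity in the role of
  \<open>t\<close>.\<close>

lemma class_B_3_of_exponent_5:
  fixes G :: "'a monoid"
  assumes G: "group G" "finite (carrier G)" and P: "p_group 5 P" "exponent P = 5" and iso: "G \<cong> P"
  shows "G \<in> class_B 3"
proof -
  interpret group G by fact
  obtain h where h: "h \<in> iso G P" using iso by (auto simp: is_iso_def)
  interpret h: group_hom G P h
    using G(1) P(1) h by (auto simp: group_hom_def group_hom_axioms_def p_group_def iso_def)
  have pow5: "g [^]\<^bsub>G\<^esub> (5::nat) = \<one>\<^bsub>G\<^esub>" if g: "g \<in> carrier G" for g
  proof -
    have "h (g [^]\<^bsub>G\<^esub> (5::nat)) = h \<one>\<^bsub>G\<^esub>"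
      using exponent_5_pow[OF P h.hom_closed[OF g]] g by (simp only: h.hom_nat_pow h.hom_one)
    moreover have "inj_on h (carrier G)" using h by (simp add: iso_def bij_betw_def)
    ultimately show ?thesis using g by (meson inj_onD nat_pow_closed one_closed)
  qed
  show ?thesis
    by (rule class_B_3I[OF G], rule group.class_B_3_of_central_involution[OF G, of "\<one>\<^bsub>G\<^esub>"])
      (use pow5 in auto)
qed

lemma class_B_3_of_exponent_5_times_2:
  fixes G :: "'a monoid"
  assumes G: "group G" "finite (carrier G)" and P: "p_group 5 P" "exponent P = 5"
    and iso: "G \<cong> P \<times>\<times> integer_mod_group 2"
  shows "G \<in> class_B 3"
proof -
  let ?Q = "P \<times>\<times> integer_mod_group 2"
  interpret group G by fact
  interpret P: group P using P(1) by (simp add: p_group_def)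
  have Q: "group ?Q" by (rule DirProd_group) (auto simp: P.is_group)
  have carr: "carrier ?Q = carrier P \<times> {0, 1}" by (auto simp: carrier_integer_mod_group)
  obtain h where h: "h \<in> iso ?Q G" using iso_sym[OF iso] by (auto simp: is_iso_def)
  have hm: "h (a \<otimes>\<^bsub>?Q\<^esub> b) = h a \<otimes>\<^bsub>G\<^esub> h b" if "a \<in> carrier ?Q" "b \<in> carrier ?Q" for a b
    using h that unfolding iso_def hom_def by blast
  have hG: "h a \<in> carrier G" if "a \<in> carrier ?Q" for a
    using h that unfolding iso_def hom_def by blast
  have h1: "h (\<one>\<^bsub>P\<^esub>, 0) = \<one>\<^bsub>G\<^esub>" using hom_one[of h ?Q G] h Q G(1) by (simp add: iso_def)
  have surj: "\<exists>p\<in>carrier P. g = h (p, 0) \<or> g = h (p, 1)" if "g \<in> carrier G" for g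
  proof -
    have "g \<in> h ` carrier ?Q" using h that by (simp add: iso_def bij_betw_def)
    then show ?thesis unfolding carr by auto
  qed
  define t where "t = h (\<one>\<^bsub>P\<^esub>, 1)"
  have pow5: "h (p, 0) [^]\<^bsub>G\<^esub> (5::nat) = \<one>\<^bsub>G\<^esub>" if p: "p \<in> carrier P" for p
  proof -
    have "h (p, 0) [^]\<^bsub>G\<^esub> n = h (p [^]\<^bsub>P\<^esub> n, 0)" for n :: nat
    proof (induction n)
      case (Suc n)
      have "h (p [^]\<^bsub>P\<^esub> n, 0) \<otimes>\<^bsub>G\<^esub> h (p, 0) = h (p [^]\<^bsub>P\<^esub> Suc n, 0)"
        using hm[of "(p [^]\<^bsub>P\<^esub> n, 0)" "(p, 0)"] p by (simp add: carr del: carrier_DirProd)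
      then show ?case using Suc by simp
    qed (simp add: h1)
    then show ?thesis using exponent_5_pow[OF P p] h1 by simp
  qed
  have tmul: "t \<otimes>\<^bsub>G\<^esub> h (p, i) = h (p, (1 + i) mod 2)" "h (p, i) \<otimes>\<^bsub>G\<^esub> t = h (p, (i + 1) mod 2)"
    if "p \<in> carrier P" "i \<in> {0, 1}" for p i
    using hm[of "(\<one>\<^bsub>P\<^esub>, 1)" "(p, i)"] hm[of "(p, i)" "(\<one>\<^bsub>P\<^esub>, 1)"] that
    by (auto simp: t_def carr simp del: carrier_DirProd)
  have tG: "t \<in> carrier G" unfolding t_def by (rule hG) (simp add: carr del: carrier_DirProd)
  have tt: "t \<otimes>\<^bsub>G\<^esub> t = \<one>\<^bsub>G\<^esub>"
    using tmul(1)[of "\<one>\<^bsub>P\<^esub>" 1] h1 by (simp add: t_def[symmetric])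
  have comm: "t \<otimes>\<^bsub>G\<^esub> g = g \<otimes>\<^bsub>G\<^esub> t" if g: "g \<in> carrier G" for g
    using surj[OF g] tmul by (auto simp: add.commute)
  have pow: "g [^]\<^bsub>G\<^esub> (5::nat) = \<one>\<^bsub>G\<^esub> \<or> (t \<otimes>\<^bsub>G\<^esub> g) [^]\<^bsub>G\<^esub> (5::nat) = \<one>\<^bsub>G\<^esub>"
    if g: "g \<in> carrier G" for g
    using surj[OF g] pow5 tmul(1) by auto
  show ?thesis
    by (rule class_B_3I[OF G], rule class_B_3_of_central_involution[OF G(2) tG tt comm pow])
qed

lemma class_B_3_of_dihedral_group_5:
  fixes G :: "'a monoid"
  assumes G: "group G" "finite (carrier G)" and iso: "G \<cong> dihedral_group 5"
  shows "G \<in> class_B 3"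
proof -
  let ?D = "dihedral_group 5"
  interpret group G by fact
  have D: "group ?D" by (rule group_dihedral_group) simp
  have carr: "(a, c) \<in> carrier ?D \<longleftrightarrow> 0 \<le> a \<and> a < 5" for a c by (auto simp: dihedral_group_def)
  have multD: "(a, c) \<otimes>\<^bsub>?D\<^esub> (b, d) = ((if c then a - b else a + b) mod 5, c \<noteq> d)" for a b c d
    by (simp add: dihedral_group_def)
  obtain h where h: "h \<in> iso ?D G" using iso_sym[OF iso] by (auto simp: is_iso_def)
  have hm: "h a \<otimes>\<^bsub>G\<^esub> h b = h (a \<otimes>\<^bsub>?D\<^esub> b)" if "a \<in> carrier ?D" "b \<in> carrier ?D" for a b
    using h that unfolding iso_def hom_def by auto
  have hG: "h a \<in> carrier G" if "a \<in> carrier ?D" for a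
    using h that unfolding iso_def hom_def by blast
  have h1: "h (0, False) = \<one>\<^bsub>G\<^esub>" using hom_one[of h ?D G] h D G(1) by (simp add: iso_def dihedral_group_def)
  define x where "x = h (1, False)"
  define t where "t = h (0, True)"
  have G': "x \<in> carrier G" "t \<in> carrier G" unfolding x_def t_def by (rule hG, simp add: carr)+
  have pow: "x [^]\<^bsub>G\<^esub> n = h (int n mod 5, False)" for n :: nat
  proof (induction n)
    case (Suc n)
    have "h (int n mod 5, False) \<otimes>\<^bsub>G\<^esub> x = h (int (Suc n) mod 5, False)"
      unfolding x_def by (subst hm) (simp_all add: carr multD mod_add_right_eq add.commute)
    then show ?case using Suc by simp
  qed (simp add: h1)
  have x5: "x [^]\<^bsub>G\<^esub> (5::nat) = \<one>\<^bsub>G\<^esub>" using pow[of 5] h1 by simp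
  have x1: "x \<noteq> \<one>\<^bsub>G\<^esub>"
  proof
    assume "x = \<one>\<^bsub>G\<^esub>"
    then have "h (1, False) = h (0, False)" using h1 by (simp add: x_def)
    moreover have "inj_on h (carrier ?D)" using h by (simp add: iso_def bij_betw_def)
    ultimately show False using inj_onD[of h "carrier ?D" "(1, False)" "(0, False)"] by (simp add: carr)
  qed
  have tt: "t \<otimes>\<^bsub>G\<^esub> t = \<one>\<^bsub>G\<^esub>" unfolding t_def by (subst hm) (simp_all add: carr multD h1)
  \<comment> \<open>The inversion relation in a form without inverses, so that it can be computed in
    coordinates.\<close>
  have "x \<otimes>\<^bsub>G\<^esub> (t \<otimes>\<^bsub>G\<^esub> x) = t"
  proof -
    have "t \<otimes>\<^bsub>G\<^esub> x = h (4, True)" unfolding t_def x_def by (subst hm) (simp_all add: carr multD)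
    moreover have "x \<otimes>\<^bsub>G\<^esub> h (4, True) = t" unfolding t_def x_def by (subst hm) (simp_all add: carr multD)
    ultimately show ?thesis by simp
  qed
  then have "inv\<^bsub>G\<^esub> x \<otimes>\<^bsub>G\<^esub> (x \<otimes>\<^bsub>G\<^esub> (t \<otimes>\<^bsub>G\<^esub> x)) = inv\<^bsub>G\<^esub> x \<otimes>\<^bsub>G\<^esub> t" by simp
  then have tx: "t \<otimes>\<^bsub>G\<^esub> x = inv\<^bsub>G\<^esub> x \<otimes>\<^bsub>G\<^esub> t" using G' by (simp add: m_assoc[symmetric])
  have gen: "\<exists>k::nat. g = x [^]\<^bsub>G\<^esub> k \<or> g = t \<otimes>\<^bsub>G\<^esub> x [^]\<^bsub>G\<^esub> k" if "g \<in> carrier G" for g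
  proof -
    have "g \<in> h ` carrier ?D" using h that by (simp add: iso_def bij_betw_def)
    then obtain a c where ac: "g = h (a, c)" "0 \<le> a" "a < 5" by (auto simp: carr)
    show ?thesis
    proof (cases c)
      case False
      then have "g = x [^]\<^bsub>G\<^esub> nat a" using ac by (simp add: pow)
      then show ?thesis by blast
    next
      case True
      \<comment> \<open>Multiplying by the reflection on the left negates the rotation coordinate,
        hence the exponent \<open>- a\<close>.\<close>
      have "t \<otimes>\<^bsub>G\<^esub> x [^]\<^bsub>G\<^esub> nat ((- a) mod 5) = h (a, True)"
        unfolding pow t_def using ac(2,3)
        by (subst hm) (simp_all add: carr multD mod_minus_eq mod_diff_right_eq)
      then have "g = t \<otimes>\<^bsub>G\<^esub> x [^]\<^bsub>G\<^esub> nat ((- a) mod 5)" using True ac(1) by simp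
      then show ?thesis by blast
    qed
  qed
  show ?thesis
    by (rule class_B_3I[OF G], rule class_B_3_of_dihedral[OF G(2) G'(1) x5 x1 G'(2) tt tx gen])
qed

text \<open>Groups of order at most 2 lie in every class vacuously, whence the bound on the order.
  Taking \<open>P\<close> over the type of \<open>G\<close> loses nothing, since a group of either
  form contains a copy of \<open>P\<close> as a subgroup.\<close>

theorem theorem6p11:
  fixes G :: "'a monoid"
  assumes "group G" and "finite (carrier G)"
    and "2 < Coset.order G"
  shows "G \<in> class_B 3 \<longleftrightarrow>
    (\<exists>P :: 'a monoid. p_group 5 P \<and> exponent P = 5 \<and> G \<cong> P) \<or>
    (\<exists>P :: 'a monoid. p_group 5 P \<and> exponent P = 5 \<and> G \<cong> P \<times>\<times> integer_mod_group 2) \<or>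
    G \<cong> dihedral_group 5"
  using class_B_3_cases[OF _ assms(3)] class_B_3_of_exponent_5[OF assms(1,2)]
    class_B_3_of_exponent_5_times_2[OF assms(1,2)] class_B_3_of_dihedral_group_5[OF assms(1,2)]
  by blast


end
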